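(* There exists a doubly indexed family $(C_{r,n})_{r\ge1,n\ge1}$ of positive reals such that for each fixed $r$, $C_{r,n}=\tilde{\mathcal O}(1)$ as $n\to\infty$, and such that for each $n\ge1$ the following holds. Let $\boldsymbol\pi$ be a uniformly random set partition of $[n]$ and for $1\le i<j\le n$ let $X_{ij}=\mathbf 1[\text{there is an arc from } i \text{ to } j \text{ in } \boldsymbol\pi]$; let $A^n$ be the set of these variables. Let $G^n$ be the weighted complete graph on $A^n$ where the edge between $X_{ij}$ and $X_{i'j'}$ has weight $1$ if $i=i'$ or $j=j'$, and $1/n$ otherwise. Let $\Psi(B)=n^{-\#(B)}$ for a multiset $B$ of elements of $A^n$, where $\#(B)$ is the number of distinct elements of $B$. Then $G^n$ is a $(\Psi,\mathbf C_n)$ weighted dependency graph for $A^n$, where $\mathbf C_n=(C_{r,n})_{r\ge1}$.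
   Context: In a set partition $\pi$ of $[n]$ there is an arc from $i$ to $j$ ($i<j$) if $j$ is the smallest element larger than $i$ in the block of $i$. For random variables $X_1,\dots,X_r$ with finite moments, $\kappa(X_1,\dots,X_r)=\sum_{\pi}\mu(\pi,[r])\prod_{B\in\pi}\mathbb E(\prod_{i\in B}X_i)$ (sum over set partitions of $[r]$, $\mu$ the Möbius function of the set-partition lattice). For a weighted graph $H$ (weights in $(0,1]$, non-edges weight $0$), $\mathcal M(H)$ is the maximal product of edge weights over spanning trees of $H$ ($0$ if disconnected). A weighted graph $G$ on $A$ is a $(\Psi,\mathbf C)$ weighted dependency graph for $\{Y_\alpha,\alpha\in A\}$ if for every multiset $B=\{\alpha_1,\dots,\alpha_r\}$ of elements of $A$, $|\kappa(Y_{\alpha_1},\dots,Y_{\alpha_r})|\le C_r\Psi(B)\mathcal M(G[B])$, with $G[B]$ the induced subgraph on the distinct elements of $B$. $f(n)=\tilde{\mathcal O}(g(n))$ means $f(n)=\mathcal O(g(n)\ln(n)^d)$ for some $d\ge0$. *)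

theory Defs
  imports "HOL-Probability.Probability" "HOL-Library.Landau_Symbols"
begin

section \<open>Joint cumulants\<close>

text \<open>
  The Moebius function of the lattice of set partitions of a finite set \<open>A\<close>, ordered by
  refinement: \<open>\<mu>(P, P) = 1\<close> and \<open>\<mu>(P, Q) = - (\<Sum>R. \<mu>(P, R))\<close>, with \<open>R\<close> ranging over
  \<open>P \<le> R < Q\<close>. The value \<open>0\<close> for incomparable arguments is a dummy.
\<close>

function partition_moebius :: "'a set \<Rightarrow> 'a set set \<Rightarrow> 'a set set \<Rightarrow> int" where
  "partition_moebius A P Q =
     (if \<not> finite A \<or> \<not> refines A P Q then 0
      else if P = Q then 1
      else - (\<Sum>R | refines A P R \<and> refines A R Q \<and> R \<noteq> Q. partition_moebius A P R))"
  by pat_completeness auto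
termination
proof (relation "Wellfounded.measure (\<lambda>(A, P, Q). card {R. refines A P R \<and> refines A R Q})", goal_cases)
  case 1
  then show ?case by simp
next
  case (2 A P Q R)
  then have fin: "finite A" and PQ: "refines A P Q"
    and R: "refines A P R" "refines A R Q" "R \<noteq> Q"
    by auto
  have "{S. refines A P S \<and> refines A S Q} \<subseteq> {S. partition_on A S}"
    by (auto simp: refines_def)
  then have "finite {S. refines A P S \<and> refines A S Q}"
    using finitely_many_partition_on[OF fin] finite_subset by blast
  moreover have "{S. refines A P S \<and> refines A S R} \<subset> {S. refines A P S \<and> refines A S Q}"
    proof
    show "{S. refines A P S \<and> refines A S R} \<subseteq> {S. refines A P S \<and> refines A S Q}"
      using R(2) refines_trans by blast
    show "{S. refines A P S \<and> refines A S R} \<noteq> {S. refines A P S \<and> refines A S Q}"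
    proof
      assume eq: "{S. refines A P S \<and> refines A S R} = {S. refines A P S \<and> refines A S Q}"
      have "refines A Q Q"
        using PQ refines_def refines_refl by blast
      with PQ eq have "refines A Q R" by blast
      with R show False using refines_asym by blast
    qed
  qed
  ultimately show ?case
    by (simp add: psubset_card_mono)
qed

declare partition_moebius.simps [simp del]

definition joint_cumulant :: "'w measure \<Rightarrow> nat \<Rightarrow> (nat \<Rightarrow> 'w \<Rightarrow> real) \<Rightarrow> real" where
  "joint_cumulant M r X =
     (\<Sum>P | partition_on {1..r} P.
        of_int (partition_moebius {1..r} P {{1..r}}) *
        (\<Prod>B\<in>P. \<integral>\<omega>. (\<Prod>i\<in>B. X i \<omega>) \<partial>M))"


section \<open>Weighted graphs and spanning trees\<close>

text \<open>
  A weighted graph on \<open>V\<close> is given by a function \<open>w\<close> on the two-element subsets of \<open>V\<close>; the edges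
  are those of positive weight. The values of \<open>w\<close> on all other sets are irrelevant. The induced
  subgraph on \<open>U \<subseteq> V\<close> is given by the same \<open>w\<close>, with vertex set \<open>U\<close>.
\<close>

definition weighted_graph :: "'v set \<Rightarrow> ('v set \<Rightarrow> real) \<Rightarrow> bool" where
  "weighted_graph V w \<longleftrightarrow> (\<forall>e. e \<subseteq> V \<and> card e = 2 \<longrightarrow> 0 \<le> w e \<and> w e \<le> 1)"

definition edges_of :: "'v set \<Rightarrow> ('v set \<Rightarrow> real) \<Rightarrow> 'v set set" where
  "edges_of V w = {e. e \<subseteq> V \<and> card e = 2 \<and> w e > 0}"

definition graph_connected :: "'v set \<Rightarrow> 'v set set \<Rightarrow> bool" where
  "graph_connected V E \<longleftrightarrow> (\<forall>u\<in>V. \<forall>v\<in>V. (u, v) \<in> {(x, y). {x, y} \<in> E}\<^sup>*)"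

definition is_cycle :: "'v set set \<Rightarrow> 'v list \<Rightarrow> bool" where
  "is_cycle E vs \<longleftrightarrow> length vs \<ge> 3 \<and> distinct vs \<and>
     (\<forall>i<length vs. {vs ! i, vs ! (Suc i mod length vs)} \<in> E)"

definition is_tree :: "'v set \<Rightarrow> 'v set set \<Rightarrow> bool" where
  "is_tree V E \<longleftrightarrow> graph_connected V E \<and> (\<nexists>vs. is_cycle E vs)"

definition spanning_trees :: "'v set \<Rightarrow> ('v set \<Rightarrow> real) \<Rightarrow> 'v set set set" where
  "spanning_trees V w = {T. T \<subseteq> edges_of V w \<and> is_tree V T}"

definition max_tree_weight :: "'v set \<Rightarrow> ('v set \<Rightarrow> real) \<Rightarrow> real" where
  "max_tree_weight V w =
     (if graph_connected V (edges_of V w)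
      then Max ((\<lambda>T. \<Prod>e\<in>T. w e) ` spanning_trees V w) else 0)"


section \<open>Weighted dependency graphs\<close>

text \<open>
  The multiset \<open>B = {\<alpha>\<^sub>1, \<dots>, \<alpha>\<^sub>r}\<close> is represented by an enumeration \<open>a\<close> on \<open>{1..r}\<close>,
  so \<open>a ` {1..r}\<close> is its set of distinct elements.
\<close>

definition weighted_dependency_graph ::
  "'w measure \<Rightarrow> 'i set \<Rightarrow> ('i \<Rightarrow> 'w \<Rightarrow> real) \<Rightarrow> ('i set \<Rightarrow> real) \<Rightarrow>
   ('i multiset \<Rightarrow> real) \<Rightarrow> (nat \<Rightarrow> real) \<Rightarrow> bool" where
  "weighted_dependency_graph M A Y w \<Psi> C \<longleftrightarrow>
     prob_space M \<and>
     (\<forall>\<alpha>\<in>A. Y \<alpha> \<in> borel_measurable M \<and> (\<forall>k::nat. integrable M (\<lambda>\<omega>. \<bar>Y \<alpha> \<omega>\<bar> ^ k))) \<and>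
     weighted_graph A w \<and>
     (\<forall>r\<ge>1. \<forall>a. a ` {1..r} \<subseteq> A \<longrightarrow>
        \<bar>joint_cumulant M r (\<lambda>i. Y (a i))\<bar>
          \<le> C r * \<Psi> (image_mset a (mset_set {1..r})) * max_tree_weight (a ` {1..r}) w)"


section \<open>Arcs in random set partitions\<close>

definition random_set_partition :: "nat \<Rightarrow> nat set set pmf" where
  "random_set_partition n = pmf_of_set {P. partition_on {1..n} P}"

definition has_arc :: "nat set set \<Rightarrow> nat \<Rightarrow> nat \<Rightarrow> bool" where
  "has_arc P i j \<longleftrightarrow> i < j \<and> (\<exists>B\<in>P. i \<in> B \<and> j \<in> B \<and> (\<forall>k\<in>B. i < k \<longrightarrow> j \<le> k))"

definition arc_indices :: "nat \<Rightarrow> (nat \<times> nat) set" where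
  "arc_indices n = {(i, j). 1 \<le> i \<and> i < j \<and> j \<le> n}"

definition arc_var :: "nat \<times> nat \<Rightarrow> nat set set \<Rightarrow> real" where
  "arc_var = (\<lambda>(i, j) P. if has_arc P i j then 1 else 0)"

definition arc_weight :: "nat \<Rightarrow> (nat \<times> nat) set \<Rightarrow> real" where
  "arc_weight n e =
     (if \<exists>i j i' j'. e = {(i, j), (i', j')} \<and> (i = i' \<or> j = j') then 1 else 1 / real n)"

definition arc_Psi :: "nat \<Rightarrow> (nat \<times> nat) multiset \<Rightarrow> real" where
  "arc_Psi n B = 1 / real n ^ card (set_mset B)"


section \<open>Bounds up to logarithmic factors\<close>

definition soft_bigo :: "(nat \<Rightarrow> real) \<Rightarrow> (nat \<Rightarrow> real) set" where
  "soft_bigo g = {f. \<exists>d\<ge>0. f \<in> O(\<lambda>n. g n * ln (real n) powr d)}"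

end

theory Submission
  imports
    Defs
    "HOL-Complex_Analysis.Complex_Analysis"
    "HOL-Computational_Algebra.Fundamental_Theorem_Algebra"
    "HOL-Real_Asymp.Real_Asymp"
begin

text \<open>
  By Dobinski's formula, a uniform set partition of \<open>[n]\<close> is the kernel of a uniform colouring of
  \<open>[n]\<close> with \<open>M\<close> colours, where \<open>P(M = m)\<close> is proportional to \<open>m ^ n / m!\<close>. Given \<open>M = m\<close>, the
  probability of a set of arcs is an explicit product, \<open>m\<close> to the minus number of arcs times factors
  \<open>1 - d / m\<close>, and over different components of the weight-one graph it factorizes up to relative
  errors of order \<open>1 / n\<close> to the number of components involved minus one, up to logarithms. This
  bounds the conditional cumulants, on a complex disc around the mean of \<open>M\<close>.

  By the law of total cumulance it remains to bound joint cumulants of smooth functions of \<open>M\<close>. The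
  moment generating function of \<open>M\<close> is \<open>exp (u - 1) * T(u) / T(1)\<close>, \<open>u = exp v\<close>, for a Touchard
  polynomial \<open>T\<close> without zeros in the right half-plane. Hence the cumulant generating function is
  analytic and of size \<open>n\<close> near \<open>0\<close>, which gives concentration of \<open>M\<close> and small joint cumulants of
  exponentials of \<open>M\<close>; by Taylor expansion these approximate the functions in question.
\<close>

section \<open>Cumulants and set partitions\<close>

text \<open>The target exponent is one \<open>1 / n\<close> per distinct arc and one per component
  after the first. For a partition \<open>P\<close> of the indices, the conditional cumulant of each
  block supplies its arcs and its components minus one. The \<open>card P - 1\<close> powers still
  missing must come from the joint cumulant of the resulting functions of \<open>M\<close>.

  The obstacle is this last gain, because \<open>M\<close> is only concentrated on the scale
  \<open>sqrt n\<close>. It comes from smoothness on a scale that is \<open>n\<close> up to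
  logarithms: one factor \<open>n\<close>, the size of the cumulant generating function, meets two
  factors \<open>1 / n\<close> from rescaling. Such smoothness is read off from bounds on a complex
  disc, hence the continuation of arc probabilities to complex \<open>z\<close>.

  Taylor polynomials in \<open>exp x - 1\<close>, and not in \<open>x\<close>, have joint moments
  that are exact values of the moment generating function; so one cluster bound serves both arcs and
  functions of \<open>M\<close>. The approximation error has no such structure. A degree
  proportional to \<open>r\<close> makes it smaller than the target power on the bulk, and a window
  wider than \<open>sqrt n\<close> by logarithms does so on the tails.\<close>

lemma finite_refines_interval:
  "finite A \<Longrightarrow> finite {P. refines A R P \<and> refines A P Q}"
  by (rule finite_subset[OF _ finitely_many_partition_on]) (auto simp: refines_def)

lemma sum_moebius_interval:
  assumes "finite A" "refines A P Q"
  shows "(\<Sum>R | refines A P R \<and> refines A R Q. partition_moebius A P R) = (if P = Q then 1 else 0)"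
proof (cases "P = Q")
  case True
  then have "{R. refines A P R \<and> refines A R Q} = {P}"
    using assms refines_asym by auto
  then show ?thesis using True assms by (simp add: partition_moebius.simps[of A Q Q])
next
  case False
  have Q: "refines A Q Q" using assms(2) refines_def refines_refl by blast
  have eq: "{R. refines A P R \<and> refines A R Q}
      = insert Q {R. refines A P R \<and> refines A R Q \<and> R \<noteq> Q}"
    using assms(2) Q by auto
  have "finite {R. refines A P R \<and> refines A R Q \<and> R \<noteq> Q}"
    by (rule finite_subset[OF _ finite_refines_interval[OF assms(1), of P Q]]) auto
  then show ?thesis
    unfolding eq using False assms
    by (subst sum.insert) (auto simp: partition_moebius.simps[of A P Q])
qed

text \<open>The recursion for \<open>partition_moebius\<close> fixes sums over the upper argument,
  while Moebius inversion needs the lower one. Let \<open>E Q\<close> be the sum in question.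
  Summing \<open>E\<close> over the interval from \<open>R\<close> to the top and exchanging the
  sums leaves only \<open>P = Q\<close>, so the total is 1. By induction \<open>E R = 1\<close>
  already exhausts it and \<open>E\<close> vanishes strictly in between, so
  \<open>E Q = 0\<close>.\<close>

lemma sum_moebius_interval_dual:
  assumes "finite A" "refines A R Q"
  shows "(\<Sum>P | refines A R P \<and> refines A P Q. partition_moebius A P Q) = (if R = Q then 1 else 0)"
  using assms(2)
proof (induction "card {P. refines A R P \<and> refines A P Q}" arbitrary: Q rule: less_induct)
  case less
  define I where "I = (\<lambda>P Q. {S. refines A P S \<and> refines A S Q})"
  define E where "E = (\<lambda>Q. \<Sum>P\<in>I R Q. partition_moebius A P Q)"
  have finI: "finite (I P Q)" for P Q
    unfolding I_def by (rule finite_refines_interval[OF assms(1)])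
  have RR: "refines A R R" and QQ: "refines A Q Q"
    using less.prems refines_def refines_refl by blast+
  have IH: "E Q' = (if R = Q' then 1 else 0)" if "Q' \<in> I R Q" "Q' \<noteq> Q" for Q'
  proof -
    have "I R Q' \<subseteq> I R Q" using that refines_trans unfolding I_def by blast
    moreover have "Q \<in> I R Q" "Q \<notin> I R Q'"
      using that QQ less.prems refines_asym unfolding I_def by blast+
    ultimately have "card (I R Q') < card (I R Q)"
      by (metis finI psubsetI psubset_card_mono)
    then show ?thesis
      using less.hyps[of Q'] that unfolding E_def I_def by blast
  qed
  show ?case
  proof (cases "R = Q")
    case True
    then have "{P. refines A R P \<and> refines A P Q} = {R}"
      using RR refines_asym by auto
    then show ?thesis using True assms RR by (simp add: partition_moebius.simps[of A Q Q])
  next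
    case False
    have "(\<Sum>Q'\<in>I R Q. E Q') = (\<Sum>Q'\<in>I R Q. \<Sum>P\<in>I R Q. if refines A P Q' then partition_moebius A P Q' else 0)"
    proof (rule sum.cong[OF refl])
      fix Q' assume Q': "Q' \<in> I R Q"
      have "I R Q' = {P\<in>I R Q. refines A P Q'}"
        using Q' refines_trans unfolding I_def by blast
      then show "E Q' = (\<Sum>P\<in>I R Q. if refines A P Q' then partition_moebius A P Q' else 0)"
        by (simp only: E_def sum.inter_filter[OF finI])
    qed
    also have "\<dots> = (\<Sum>P\<in>I R Q. \<Sum>Q'\<in>I R Q. if refines A P Q' then partition_moebius A P Q' else 0)"
      by (rule sum.swap)
    also have "\<dots> = (\<Sum>P\<in>I R Q. if P = Q then 1 else 0)"
    proof (rule sum.cong[OF refl])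
      fix P assume P: "P \<in> I R Q"
      have "I P Q = {Q'\<in>I R Q. refines A P Q'}"
        using P refines_trans unfolding I_def by blast
      then have "(\<Sum>Q'\<in>I R Q. if refines A P Q' then partition_moebius A P Q' else 0)
          = (\<Sum>Q'\<in>I P Q. partition_moebius A P Q')"
        by (simp only: sum.inter_filter[OF finI])
      then show "(\<Sum>Q'\<in>I R Q. if refines A P Q' then partition_moebius A P Q' else 0)
          = (if P = Q then 1 else 0)"
        using sum_moebius_interval[OF assms(1), of P Q] P unfolding I_def by simp
    qed
    also have "\<dots> = 1"
      using less.prems QQ finI[of R Q] by (simp add: I_def)
    finally have tot: "(\<Sum>Q'\<in>I R Q. E Q') = 1" .
    define J where "J = I R Q - {Q, R}"
    have "I R Q = insert Q (insert R J)"
      using less.prems QQ RR unfolding I_def J_def by auto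
    moreover have "finite J" "Q \<notin> J" "R \<notin> J" using finI by (auto simp: J_def)
    ultimately have "(\<Sum>Q'\<in>I R Q. E Q') = E Q + (E R + (\<Sum>Q'\<in>J. E Q'))"
      using False by simp
    moreover have "(\<Sum>Q'\<in>J. E Q') = 0"
      by (rule sum.neutral) (use IH in \<open>auto simp: J_def\<close>)
    moreover have "E R = 1" using IH[of R] False RR less.prems unfolding I_def by auto
    ultimately have "E Q = 0" using tot by simp
    then show ?thesis using False unfolding E_def I_def by simp
  qed
qed

section \<open>Moments and cumulants as inverse transforms of set functions\<close>

definition part_sum :: "('a set \<Rightarrow> complex) \<Rightarrow> 'a set \<Rightarrow> complex" where
  "part_sum k S = (\<Sum>P | partition_on S P. \<Prod>B\<in>P. k B)"

text \<open>Here \<open>f\<close> stands for the joint moments, without reference to random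
  variables. The same transform is applied to arc probabilities for a fixed, possibly complex,
  number of urns, and to means of functions of the number of urns, where the elements of the index
  set are themselves blocks.\<close>

definition cumulant :: "('a set \<Rightarrow> complex) \<Rightarrow> 'a set \<Rightarrow> complex" where
  "cumulant f S =
     (\<Sum>P | partition_on S P. of_int (partition_moebius S P {S}) * (\<Prod>B\<in>P. f B))"

lemma part_sum_empty [simp]: "part_sum k {} = 1"
  by (simp add: part_sum_def partition_on_empty)

lemma part_sum_cong:
  assumes "\<And>B. B \<subseteq> S \<Longrightarrow> B \<noteq> {} \<Longrightarrow> k B = k' B"
  shows "part_sum k S = part_sum k' S"
  unfolding part_sum_def
  by (intro sum.cong prod.cong refl assms) (auto simp: partition_on_def)

lemma cumulant_cong:
  assumes "\<And>B. B \<subseteq> S \<Longrightarrow> B \<noteq> {} \<Longrightarrow> f B = f' B"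
  shows "cumulant f S = cumulant f' S"
  unfolding cumulant_def
  by (intro sum.cong prod.cong refl arg_cong2[where f="(*)"] assms) (auto simp: partition_on_def)

lemma partition_on_Un_iff_subset:
  assumes "partition_on S P" "b \<subseteq> P"
  shows "partition_on (\<Union>b) b" "partition_on (S - \<Union>b) (P - b)"
proof -
  show "partition_on (\<Union>b) b"
    using assms by (auto simp: partition_on_def disjoint_def)
  have "X \<inter> Y = {}" if "X \<in> P - b" "Y \<in> b" for X Y
    using that assms unfolding partition_on_def disjoint_def by (metis DiffE subsetD)
  then have "S - \<Union>b = \<Union>(P - b)"
    using assms(1,2) by (fastforce simp: partition_on_def)
  then show "partition_on (S - \<Union>b) (P - b)"
    using assms by (auto simp: partition_on_def disjoint_def)
qed

lemma partition_on_Un_disjoint: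
  assumes "partition_on C b" "partition_on D P" "C \<inter> D = {}"
  shows "partition_on (C \<union> D) (b \<union> P)" "b \<inter> P = {}"
proof -
  have *: "X \<inter> Y = {}" if "X \<in> b" "Y \<in> P" for X Y
    using that assms by (auto simp: partition_on_def)
  have "disjoint (b \<union> P)"
    using assms by (intro disjoint_union) (auto simp: partition_on_def)
  then show "partition_on (C \<union> D) (b \<union> P)"
    using assms by (auto simp: partition_on_def)
  show "b \<inter> P = {}"
  proof (rule ccontr)
    assume "b \<inter> P \<noteq> {}"
    then obtain X where "X \<in> b" "X \<in> P" by auto
    then show False using *[of X X] assms(1) by (auto simp: partition_on_def)
  qed
qed

text \<open>A partition with a subfamily \<open>b\<close> covering \<open>x\<close> amounts to the
  set \<open>C\<close> covered by \<open>b\<close> together with partitions of \<open>C\<close> and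
  of its complement. With \<open>F\<close> supported on single blocks this gives the recursion for
  \<open>part_sum\<close>; with general \<open>F\<close> it gives the law of total
  cumulance.\<close>

lemma sum_partition_sub:
  fixes F :: "'a set set \<Rightarrow> 'a set set \<Rightarrow> 'b::comm_monoid_add"
  assumes "finite S" "x \<in> S"
  shows "(\<Sum>P | partition_on S P. \<Sum>b | b \<subseteq> P \<and> x \<in> \<Union>b. F b (P - b))
       = (\<Sum>C | C \<subseteq> S \<and> x \<in> C. \<Sum>b | partition_on C b. \<Sum>P | partition_on (S - C) P. F b P)"
proof -
  have fin: "finite {P. partition_on T P}" if "T \<subseteq> S" for T
    using that assms(1) finite_subset finitely_many_partition_on by blast
  have finP: "finite P" if "partition_on T P" "T \<subseteq> S" for P T
    using that assms(1) finite_subset finite_elements by blast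
  have "(\<Sum>P | partition_on S P. \<Sum>b | b \<subseteq> P \<and> x \<in> \<Union>b. F b (P - b))
     = (\<Sum>(P, b)\<in>(SIGMA P:{P. partition_on S P}. {b. b \<subseteq> P \<and> x \<in> \<Union>b}). F b (P - b))"
    by (rule sum.Sigma) (auto simp: fin finP)
  also have "\<dots> = (\<Sum>(C, b, P)\<in>(SIGMA C:{C. C \<subseteq> S \<and> x \<in> C}. {b. partition_on C b} \<times> {P. partition_on (S - C) P}). F b P)"
  proof (rule sum.reindex_bij_witness[where
      i = "\<lambda>(C, b, P). (b \<union> P, b)" and j = "\<lambda>(P, b). (\<Union>b, b, P - b)"], goal_cases)
    case (1 z)
    then show ?case by auto
  next
    case (2 z)
    then obtain P b where z: "z = (P, b)" "partition_on S P" "b \<subseteq> P" "x \<in> \<Union>b" by auto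
    then have "\<Union>b \<subseteq> S" by (auto simp: partition_on_def)
    with z partition_on_Un_iff_subset[OF z(2,3)] show ?case by auto
  next
    case (3 z)
    then obtain C b P where z: "z = (C, b, P)" "partition_on C b" "partition_on (S - C) P" by auto
    have "b \<inter> P = {}" using partition_on_Un_disjoint(2)[OF z(2,3)] by auto
    with z show ?case by (auto simp: partition_on_def)
  next
    case (4 z)
    then obtain C b P where z: "z = (C, b, P)" "partition_on C b" "partition_on (S - C) P"
      "C \<subseteq> S" "x \<in> C" by auto
    moreover have "C \<union> (S - C) = S" using z by auto
    ultimately show ?case using partition_on_Un_disjoint(1)[OF z(2,3)]
      by (auto simp: partition_on_def)
  next
    case (5 z)
    then show ?case by auto
  qed
  also have "\<dots> = (\<Sum>C | C \<subseteq> S \<and> x \<in> C. \<Sum>(b, P)\<in>{b. partition_on C b} \<times> {P. partition_on (S - C) P}. F b P)"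
    by (rule sum.Sigma[symmetric]) (use assms fin in auto)
  also have "\<dots> = (\<Sum>C | C \<subseteq> S \<and> x \<in> C. \<Sum>b | partition_on C b. \<Sum>P | partition_on (S - C) P. F b P)"
    by (intro sum.cong refl) (simp add: sum.cartesian_product)
  finally show ?thesis .
qed

lemma part_sum_rec:
  assumes "finite S" "x \<in> S"
  shows "part_sum k S = (\<Sum>C | C \<subseteq> S \<and> x \<in> C. k C * part_sum k (S - C))"
proof -
  define F where "F = (\<lambda>b P. if \<exists>C. b = {C} then (\<Prod>B\<in>b. k B) * (\<Prod>B\<in>P. k B) else 0)"
  have "part_sum k S = (\<Sum>P | partition_on S P. \<Sum>b | b \<subseteq> P \<and> x \<in> \<Union>b. F b (P - b))"
    unfolding part_sum_def
  proof (rule sum.cong[OF refl], clarify)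
    fix P assume P: "partition_on S P"
    then have finP: "finite P" using assms finite_elements by blast
    from P obtain X where X: "X \<in> P" "x \<in> X" using assms by (auto simp: partition_on_def)
    have uniq: "Y = X" if "Y \<in> P" "x \<in> Y" for Y
      using P X that unfolding partition_on_def disjoint_def by blast
    have "(\<Sum>b | b \<subseteq> P \<and> x \<in> \<Union>b. F b (P - b)) = (\<Sum>b\<in>{{X}}. F b (P - b))"
    proof (rule sum.mono_neutral_right)
      show "finite {b. b \<subseteq> P \<and> x \<in> \<Union>b}"
        using finP by (auto intro: finite_subset[of _ "Pow P"])
      show "{{X}} \<subseteq> {b. b \<subseteq> P \<and> x \<in> \<Union>b}" using X by auto
      show "\<forall>b\<in>{b. b \<subseteq> P \<and> x \<in> \<Union>b} - {{X}}. F b (P - b) = 0"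
      proof
        fix b assume "b \<in> {b. b \<subseteq> P \<and> x \<in> \<Union>b} - {{X}}"
        then obtain Y where b: "b \<subseteq> P" "b \<noteq> {X}" "x \<in> Y" "Y \<in> b" by blast
        then have "Y = X" using uniq by blast
        then have "\<not> (\<exists>C. b = {C})" using b by auto
        then show "F b (P - b) = 0" by (simp add: F_def)
      qed
    qed
    also have "\<dots> = (\<Prod>B\<in>P. k B)"
      using prod.remove[OF finP X(1), of k] by (simp add: F_def)
    finally show "(\<Prod>B\<in>P. k B) = (\<Sum>b | b \<subseteq> P \<and> x \<in> \<Union>b. F b (P - b))" by simp
  qed
  also have "\<dots> = (\<Sum>C | C \<subseteq> S \<and> x \<in> C. \<Sum>b | partition_on C b. \<Sum>P | partition_on (S - C) P. F b P)"
    by (rule sum_partition_sub[OF assms])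
  also have "\<dots> = (\<Sum>C | C \<subseteq> S \<and> x \<in> C. k C * part_sum k (S - C))"
  proof (rule sum.cong[OF refl], clarify)
    fix C assume C: "C \<subseteq> S" "x \<in> C"
    then have "finite C" using assms finite_subset by blast
    have "(\<Sum>b | partition_on C b. \<Sum>P | partition_on (S - C) P. F b P)
        = (\<Sum>b\<in>{{C}}. \<Sum>P | partition_on (S - C) P. F b P)"
    proof (rule sum.mono_neutral_right)
      show "finite {b. partition_on C b}" using \<open>finite C\<close> by (rule finitely_many_partition_on)
      show "{{C}} \<subseteq> {b. partition_on C b}" using C partition_on_space[of C] by auto
      show "\<forall>b\<in>{b. partition_on C b} - {{C}}. (\<Sum>P | partition_on (S - C) P. F b P) = 0"
      proof
        fix b assume "b \<in> {b. partition_on C b} - {{C}}"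
        then have "\<not> (\<exists>D. b = {D})" by (auto simp: partition_on_def)
        then show "(\<Sum>P | partition_on (S - C) P. F b P) = 0" by (simp add: F_def)
      qed
    qed
    then show "(\<Sum>b | partition_on C b. \<Sum>P | partition_on (S - C) P. F b P) = k C * part_sum k (S - C)"
      by (simp add: F_def part_sum_def sum_distrib_left)
  qed
  finally show ?thesis .
qed

text \<open>Partitioning every block of \<open>P\<close> separately amounts to choosing a refinement
  of \<open>P\<close>. In the induction step a refinement is cut into its blocks inside and outside
  the new block \<open>X\<close>.\<close>

lemma prod_part_sum:
  assumes "finite A" "partition_on A P"
  shows "(\<Prod>B\<in>P. part_sum k B) = (\<Sum>R | refines A R P. \<Prod>B\<in>R. k B)"
proof -
  have "finite P" using assms finite_elements by blast
  then show ?thesis using assms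
  proof (induction P arbitrary: A)
    case empty
    then have "A = {}" by (simp add: partition_on_def)
    then have "{R. refines A R {}} = {{}}" by (auto simp: refines_def partition_on_empty)
    then show ?case by simp
  next
    case (insert X P)
    define A' where "A' = A - X"
    have disj: "disjnt X (\<Union>P)" and X: "X \<noteq> {}" "X \<subseteq> A"
      using insert.prems(2) insert.hyps
      by (auto simp: partition_on_def disjoint_def disjnt_def)
    have A': "partition_on A' P"
      using insert.prems(2) disj partition_on_insert[of X P A] unfolding A'_def by blast
    have finX: "finite X" "finite A'" using X insert.prems finite_subset A'_def by auto
    have "(\<Prod>B\<in>insert X P. part_sum k B) = part_sum k X * (\<Sum>R | refines A' R P. \<Prod>B\<in>R. k B)"
      using insert.IH[OF finX(2) A'] insert.hyps by simp
    also have "\<dots> = (\<Sum>(Q, R)\<in>{Q. partition_on X Q} \<times> {R. refines A' R P}. (\<Prod>B\<in>Q. k B) * (\<Prod>B\<in>R. k B))"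
      unfolding part_sum_def by (simp add: sum_product sum.cartesian_product)
    also have "\<dots> = (\<Sum>R | refines A R (insert X P). \<Prod>B\<in>R. k B)"
    proof (rule sum.reindex_bij_witness[where
        j = "\<lambda>(Q, R). Q \<union> R" and i = "\<lambda>R. ({B\<in>R. B \<subseteq> X}, {B\<in>R. \<not> B \<subseteq> X})"], goal_cases)
      case (1 z)
      then obtain Q R where z: "z = (Q, R)" "partition_on X Q" "refines A' R P" by auto
      have "\<forall>B\<in>Q. B \<subseteq> X" using z(2) by (auto simp: partition_on_def)
      moreover have "\<forall>B\<in>R. \<not> B \<subseteq> X"
      proof
        fix B assume "B \<in> R"
        then have "B \<noteq> {}" "B \<subseteq> A - X"
          using z(3) by (auto simp: refines_def partition_on_def A'_def)
        then show "\<not> B \<subseteq> X" by auto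
      qed
      ultimately show ?case using z(1) by auto
    next
      case (2 z)
      then obtain Q R where z: "z = (Q, R)" "partition_on X Q" "refines A' R P" by auto
      have "partition_on (X \<union> A') (Q \<union> R)"
        using z by (intro partition_on_Un_disjoint) (auto simp: refines_def A'_def)
      moreover have "X \<union> A' = A" using X by (auto simp: A'_def)
      moreover have "\<forall>B\<in>Q. B \<subseteq> X" using z(2) by (auto simp: partition_on_def)
      ultimately show ?case using z insert.prems unfolding refines_def by auto
    next
      case (3 R)
      then show ?case by auto
    next
      case (4 R)
      then have R: "partition_on A R" "\<forall>B\<in>R. \<exists>Y\<in>insert X P. B \<subseteq> Y" by (auto simp: refines_def)
      define Q where "Q = {B\<in>R. B \<subseteq> X}"
      have Q: "partition_on X Q"
        unfolding Q_def using 4 by (intro refines_obtains_subset[of A R "insert X P"]) auto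
      have "partition_on (A - \<Union>Q) (R - Q)"
        by (rule partition_on_Un_iff_subset(2)[OF R(1)]) (auto simp: Q_def)
      then have "partition_on A' (R - Q)"
        using Q by (simp add: A'_def partition_on_def)
      moreover have "R - Q = {B\<in>R. \<not> B \<subseteq> X}" by (auto simp: Q_def)
      ultimately show ?case using Q A' R(2) by (auto simp: refines_def Q_def)
    next
      case (5 z)
      then obtain Q R where z: "z = (Q, R)" "partition_on X Q" "refines A' R P" by auto
      have "Q \<inter> R = {}"
        using z by (intro partition_on_Un_disjoint(2)[of X Q A' R]) (auto simp: refines_def A'_def)
      moreover have "finite Q" "finite R"
        using z finX finite_elements unfolding refines_def by blast+
      ultimately show ?case using z by (simp add: prod.union_disjoint)
    qed
    finally show ?case .
  qed
qed

text \<open>Moebius inversion: expanding the products gives a double sum over a partition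
  \<open>P\<close> and its refinements \<open>R\<close>, and for fixed \<open>R\<close> the sum over
  \<open>P\<close> is the dual interval sum with top \<open>{A}\<close>.\<close>

lemma cumulant_part_sum:
  assumes "finite A" "A \<noteq> {}"
  shows "cumulant (part_sum k) A = k A"
proof -
  define S where "S = {P. partition_on A P}"
  have fin: "finite S" unfolding S_def using assms(1) by (rule finitely_many_partition_on)
  have top: "refines A P {A}" if "partition_on A P" for P
    using that assms(2) partition_on_space by (auto simp: refines_def partition_on_def)
  have "cumulant (part_sum k) A
      = (\<Sum>P\<in>S. \<Sum>R\<in>S. if refines A R P then of_int (partition_moebius A P {A}) * (\<Prod>B\<in>R. k B) else 0)"
    unfolding cumulant_def S_def[symmetric]
  proof (rule sum.cong[OF refl])
    fix P assume P: "P \<in> S"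
    have "{R. refines A R P} = {R\<in>S. refines A R P}" by (auto simp: S_def refines_def)
    then show "of_int (partition_moebius A P {A}) * (\<Prod>B\<in>P. part_sum k B)
        = (\<Sum>R\<in>S. if refines A R P then of_int (partition_moebius A P {A}) * (\<Prod>B\<in>R. k B) else 0)"
      using prod_part_sum[OF assms(1), of P] P
      by (simp only: sum.inter_filter[OF fin, symmetric] sum_distrib_left)
        (simp add: S_def sum_distrib_left)
  qed
  also have "\<dots> = (\<Sum>R\<in>S. \<Sum>P\<in>S. if refines A R P then of_int (partition_moebius A P {A}) * (\<Prod>B\<in>R. k B) else 0)"
    by (rule sum.swap)
  also have "\<dots> = (\<Sum>R\<in>S. if R = {A} then (\<Prod>B\<in>R. k B) else 0)"
  proof (rule sum.cong[OF refl])
    fix R assume R: "R \<in> S"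
    have *: "{P\<in>S. refines A R P} = {P. refines A R P \<and> refines A P {A}}"
      using top by (auto simp: S_def refines_def)
    have "(\<Sum>P\<in>S. if refines A R P then of_int (partition_moebius A P {A}) * (\<Prod>B\<in>R. k B) else 0)
       = of_int (\<Sum>P\<in>{P\<in>S. refines A R P}. partition_moebius A P {A}) * (\<Prod>B\<in>R. k B)"
      by (simp only: sum.inter_filter[OF fin, symmetric] of_int_sum sum_distrib_right)
    also have "\<dots> = (if R = {A} then (\<Prod>B\<in>R. k B) else 0)"
      unfolding * using R top by (subst sum_moebius_interval_dual[OF assms(1)]) (auto simp: S_def)
    finally show "(\<Sum>P\<in>S. if refines A R P then of_int (partition_moebius A P {A}) * (\<Prod>B\<in>R. k B) else 0)
       = (if R = {A} then (\<Prod>B\<in>R. k B) else 0)" .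
  qed
  also have "\<dots> = k A"
    using fin assms(2) partition_on_space[of A] by (subst sum.delta) (auto simp: S_def)
  finally show ?thesis .
qed

text \<open>A preimage of \<open>f\<close> under \<open>part_sum\<close>, obtained by solving for
  the one-block term. It shows that \<open>part_sum\<close> is onto, which turns the one-sided
  inverse \<open>cumulant\<close> into a two-sided one.\<close>

function moment_log :: "('a set \<Rightarrow> complex) \<Rightarrow> 'a set \<Rightarrow> complex" where
  "moment_log f S = (if finite S
     then f S - (\<Sum>P | partition_on S P \<and> P \<noteq> {S}. \<Prod>B\<in>P. moment_log f B) else 0)"
  by pat_completeness auto
termination
proof (relation "Wellfounded.measure (\<lambda>(f, S). card S)", goal_cases)
  case 1
  then show ?case by simp
next
  case (2 f S P B)
  then have P: "partition_on S P" "P \<noteq> {S}" "B \<in> P" by auto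
  then have "B \<subseteq> S" by (auto simp: partition_on_def)
  moreover have "B \<noteq> S"
  proof
    assume B: "B = S"
    have "X = S" if "X \<in> P" for X
    proof (rule ccontr)
      assume "X \<noteq> S"
      then have "X \<inter> S = {}"
        using P B that by (auto simp: partition_on_def disjoint_def)
      moreover have "X \<subseteq> S" "X \<noteq> {}" using P that by (auto simp: partition_on_def)
      ultimately show False by auto
    qed
    then have "P = {S}" using P(3) B by blast
    then show False using P(2) by simp
  qed
  ultimately have "B \<subset> S" by (rule psubsetI)
  then show ?case using 2(1) by (simp add: psubset_card_mono)
qed

declare moment_log.simps [simp del]

lemma part_sum_moment_log:
  assumes "finite S" "S \<noteq> {}"
  shows "part_sum (moment_log f) S = f S"
proof -
  have eq: "{P. partition_on S P} = insert {S} {P. partition_on S P \<and> P \<noteq> {S}}"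
    using assms(2) partition_on_space[of S] by auto
  have "finite {P. partition_on S P \<and> P \<noteq> {S}}"
    by (rule finite_subset[OF _ finitely_many_partition_on[OF assms(1)]]) auto
  then show ?thesis
    unfolding part_sum_def eq using assms(1) by (simp add: moment_log.simps[of f S])
qed

lemma part_sum_cumulant:
  assumes "finite S" "S \<noteq> {}"
  shows "part_sum (cumulant f) S = f S"
proof -
  have "cumulant f B = moment_log f B" if B: "B \<subseteq> S" "B \<noteq> {}" for B
  proof -
    have "finite B" using B assms(1) finite_subset by blast
    have "cumulant f B = cumulant (part_sum (moment_log f)) B"
      by (intro cumulant_cong part_sum_moment_log[symmetric])
        (use \<open>finite B\<close> finite_subset in blast)+
    then show ?thesis using cumulant_part_sum[OF \<open>finite B\<close> B(2)] by simp
  qed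
  then have "part_sum (cumulant f) S = part_sum (moment_log f) S"
    by (rule part_sum_cong)
  then show ?thesis using part_sum_moment_log[OF assms] by simp
qed

section \<open>The recursion that characterizes cumulants, and its consequences\<close>

lemma cumulant_rec:
  assumes "finite S" "x \<in> S" "f {} = 1"
  shows "f S = (\<Sum>C | C \<subseteq> S \<and> x \<in> C. cumulant f C * f (S - C))"
proof -
  have *: "part_sum (cumulant f) T = f T" if "T \<subseteq> S" for T
    using that assms part_sum_cumulant[of T f] finite_subset[of T S] by (cases "T = {}") auto
  have "f S = part_sum (cumulant f) S" using * by simp
  also have "\<dots> = (\<Sum>C | C \<subseteq> S \<and> x \<in> C. cumulant f C * f (S - C))"
    by (subst part_sum_rec[OF assms(1,2)], intro sum.cong refl) (simp add: *)
  finally show ?thesis .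
qed

lemma cumulant_eq_rec:
  assumes "finite S" "x \<in> S" "f {} = 1"
  shows "cumulant f S = f S - (\<Sum>C | C \<subset> S \<and> x \<in> C. cumulant f C * f (S - C))"
proof -
  have "{C. C \<subseteq> S \<and> x \<in> C} = insert S {C. C \<subset> S \<and> x \<in> C}"
    using assms(2) by auto
  moreover have "finite {C. C \<subset> S \<and> x \<in> C}"
    by (rule finite_subset[of _ "Pow S"]) (use assms(1) in auto)
  ultimately show ?thesis using cumulant_rec[of S x f] assms by simp
qed

text \<open>The term \<open>C = S\<close> carries the factor \<open>f {} = 1\<close>, so the
  recursion determines \<open>k S\<close> from smaller sets. One pinned element for each
  \<open>S\<close> suffices.\<close>

lemma cumulant_unique:
  assumes "finite A" "A \<noteq> {}" "f {} = 1"
    and rec: "\<And>S. S \<subseteq> A \<Longrightarrow> S \<noteq> {} \<Longrightarrow> \<exists>x\<in>S. f S = (\<Sum>C | C \<subseteq> S \<and> x \<in> C. k C * f (S - C))"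
  shows "cumulant f A = k A"
proof -
  have "cumulant f S = k S" if "S \<subseteq> A" "S \<noteq> {}" for S
    using finite_subset[OF that(1) assms(1)] that
  proof (induction S rule: finite_psubset_induct)
    case (psubset S)
    then obtain x where x: "x \<in> S" "f S = (\<Sum>C | C \<subseteq> S \<and> x \<in> C. k C * f (S - C))"
      using rec by blast
    have eq: "{C. C \<subseteq> S \<and> x \<in> C} = insert S {C. C \<subset> S \<and> x \<in> C}"
      using x(1) by auto
    have fin: "finite {C. C \<subset> S \<and> x \<in> C}"
      by (rule finite_subset[of _ "Pow S"]) (use psubset.hyps in auto)
    have "(\<Sum>C | C \<subset> S \<and> x \<in> C. cumulant f C * f (S - C))
        = (\<Sum>C | C \<subset> S \<and> x \<in> C. k C * f (S - C))"
      by (intro sum.cong refl) (use psubset in auto)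
    then show ?case
      using cumulant_eq_rec[of S x f] psubset.hyps x assms(3) fin unfolding eq by simp
  qed
  then show ?thesis using assms(2) by auto
qed

text \<open>The candidate \<open>k\<close> is the cumulant with all sets that meet both sides put to
  zero. It satisfies the recursion: pinning \<open>x\<close> on one side confines \<open>C\<close>
  to that side, where the recursion of \<open>f\<close> applies and the factor of the other side can
  be pulled out. By uniqueness, \<open>k\<close> is the cumulant.\<close>

lemma cumulant_factor_eq_0:
  assumes "finite A" "f {} = 1" "A \<inter> U \<noteq> {}" "A - U \<noteq> {}"
    and "\<And>S. S \<subseteq> A \<Longrightarrow> f S = f (S \<inter> U) * f (S - U)"
  shows "cumulant f A = 0"
proof -
  define k where "k = (\<lambda>C. if C \<inter> U \<noteq> {} \<and> C - U \<noteq> {} then 0 else cumulant f C)"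
  have aux: "\<exists>x\<in>S. f S = (\<Sum>C | C \<subseteq> S \<and> x \<in> C. k C * f (S - C))"
    if S: "S \<subseteq> A" "S \<noteq> {}" for S
  proof -
    have finS: "finite S" using S assms(1) finite_subset by blast
    have main: "f S = (\<Sum>C | C \<subseteq> S \<and> x \<in> C. k C * f (S - C))"
      if x: "x \<in> S \<inter> W" and W: "W = U \<or> W = - U" for x W
    proof -
      have split: "f T = f (T \<inter> W) * f (T - W)" if "T \<subseteq> A" for T
        using W assms(5)[OF that] by (auto simp: Int_commute Diff_eq ac_simps)
      have "(\<Sum>C | C \<subseteq> S \<and> x \<in> C. k C * f (S - C))
          = (\<Sum>C | C \<subseteq> S \<inter> W \<and> x \<in> C. k C * f (S - C))"
        by (rule sum.mono_neutral_right)
          (use finS W x in \<open>auto simp: k_def intro: finite_subset[of _ "Pow S"]\<close>)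
      also have "\<dots> = (\<Sum>C | C \<subseteq> S \<inter> W \<and> x \<in> C. cumulant f C * f (S \<inter> W - C) * f (S - W))"
      proof (intro sum.cong refl)
        fix C assume "C \<in> {C. C \<subseteq> S \<inter> W \<and> x \<in> C}"
        then have C: "C \<subseteq> S \<inter> W" by simp
        have "k C = cumulant f C" using C W by (auto simp: k_def)
        moreover have "f (S - C) = f ((S - C) \<inter> W) * f (S - C - W)"
          using S by (intro split) auto
        moreover have "(S - C) \<inter> W = S \<inter> W - C" "S - C - W = S - W" using C by auto
        ultimately show "k C * f (S - C) = cumulant f C * f (S \<inter> W - C) * f (S - W)" by simp
      qed
      also have "\<dots> = f (S \<inter> W) * f (S - W)"
        using cumulant_rec[of "S \<inter> W" x f] finS x assms(2) by (simp add: sum_distrib_right)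
      also have "\<dots> = f S" using split[OF S(1)] by simp
      finally show ?thesis by simp
    qed
    show ?thesis
    proof (cases "S \<inter> U = {}")
      case True
      then show ?thesis using S main[of _ "- U"] by blast
    next
      case False
      then show ?thesis using main[of _ U] by blast
    qed
  qed
  have "cumulant f A = k A"
  proof (rule cumulant_unique[where f = f and k = k])
    show "finite A" by (rule assms(1))
    show "f {} = 1" by (rule assms(2))
    show "A \<noteq> {}" using assms(3) by auto
  next
    fix S assume "S \<subseteq> A" "S \<noteq> {}"
    then show "\<exists>x\<in>S. f S = (\<Sum>C | C \<subseteq> S \<and> x \<in> C. k C * f (S - C))" by (rule aux)
  qed
  then show ?thesis using assms(3,4) by (simp add: k_def)
qed

text \<open>The law of total cumulance, with \<open>g\<close> the joint moments of the conditional cumulants.\<close>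

lemma cumulant_total:
  assumes "finite A" "A \<noteq> {}" "g {} = 1"
    and f: "\<And>S. S \<subseteq> A \<Longrightarrow> f S = (\<Sum>P | partition_on S P. g P)"
  shows "cumulant f A = (\<Sum>P | partition_on A P. cumulant g P)"
proof (rule cumulant_unique[where f = f and k = "\<lambda>C. \<Sum>P | partition_on C P. cumulant g P"])
  show "finite A" "A \<noteq> {}" using assms by auto
  show "f {} = 1" using f[of "{}"] assms(3) by (simp add: partition_on_empty)
next
  fix S assume S: "S \<subseteq> A" "S \<noteq> {}"
  then obtain x where x: "x \<in> S" by blast
  have finS: "finite S" using S assms(1) finite_subset by blast
  have "f S = (\<Sum>P | partition_on S P. \<Sum>b | b \<subseteq> P \<and> x \<in> \<Union>b. cumulant g b * g (P - b))"
    unfolding f[OF S(1)]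
  proof (rule sum.cong[OF refl], clarify)
    fix P assume P: "partition_on S P"
    then have finP: "finite P" using finS finite_elements by blast
    from P obtain X where X: "X \<in> P" "x \<in> X" using x by (auto simp: partition_on_def)
    have uniq: "Y = X" if "Y \<in> P" "x \<in> Y" for Y
      using P X that unfolding partition_on_def disjoint_def by blast
    \<comment> \<open>A subfamily covers \<open>x\<close> exactly if it contains the block
      \<open>X\<close> of \<open>x\<close>, so the recursion for \<open>g\<close> on the index set
      \<open>P\<close>, pinned at \<open>X\<close>, matches the sum over subfamilies covering
      \<open>x\<close>.\<close>
    have "x \<in> \<Union>b \<longleftrightarrow> X \<in> b" if "b \<subseteq> P" for b
      using uniq X(2) that by blast
    then have eq: "{b. b \<subseteq> P \<and> x \<in> \<Union>b} = {b. b \<subseteq> P \<and> X \<in> b}" by blast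
    show "g P = (\<Sum>b | b \<subseteq> P \<and> x \<in> \<Union>b. cumulant g b * g (P - b))"
      unfolding eq using cumulant_rec[of P X g] finP X assms(3) by simp
  qed
  also have "\<dots> = (\<Sum>C | C \<subseteq> S \<and> x \<in> C. \<Sum>b | partition_on C b. \<Sum>P | partition_on (S - C) P. cumulant g b * g P)"
    by (rule sum_partition_sub[OF finS x])
  also have "\<dots> = (\<Sum>C | C \<subseteq> S \<and> x \<in> C. (\<Sum>P | partition_on C P. cumulant g P) * f (S - C))"
  proof (intro sum.cong refl)
    fix C
    have "f (S - C) = (\<Sum>P | partition_on (S - C) P. g P)" using S by (intro f) auto
    then show "(\<Sum>b | partition_on C b. \<Sum>P | partition_on (S - C) P. cumulant g b * g P)
        = (\<Sum>P | partition_on C P. cumulant g P) * f (S - C)"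
      by (simp add: sum_product)
  qed
  finally show "\<exists>x\<in>S. f S = (\<Sum>C | C \<subseteq> S \<and> x \<in> C. (\<Sum>P | partition_on C P. cumulant g P) * f (S - C))"
    using x by blast
qed

section \<open>Cumulants of nearly factorizing moment functions\<close>

text \<open>A set grown from \<open>c\<close> gains at most \<open>card D - 1\<close> vertices with
  each hyperedge \<open>D\<close> that meets it. A maximal subfamily \<open>M\<close> obeying this
  count must reach all of \<open>C\<close>, since otherwise connectivity supplies one more
  hyperedge.\<close>

lemma connected_hypergraph_card:
  assumes "finite C" "c \<in> C" "finite E" and sub: "\<And>D. D \<in> E \<Longrightarrow> D \<subseteq> C"
    and conn: "\<And>A. A \<subseteq> C \<Longrightarrow> A \<noteq> {} \<Longrightarrow> A \<noteq> C \<Longrightarrow> \<exists>D\<in>E. D \<inter> A \<noteq> {} \<and> \<not> D \<subseteq> A"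
  shows "card C - 1 \<le> (\<Sum>D\<in>E. card D - 1)"
proof -
  define Q where "Q = (\<lambda>M. card (insert c (\<Union>M)) \<le> 1 + (\<Sum>D\<in>M. card D - 1))"
  have "finite {M \<in> Pow E. Q M}" "{} \<in> {M \<in> Pow E. Q M}"
    using assms(3) by (auto simp: Q_def)
  then obtain M where M: "M \<subseteq> E" "Q M" and
    max: "\<And>M'. M' \<subseteq> E \<Longrightarrow> Q M' \<Longrightarrow> M \<subseteq> M' \<Longrightarrow> M = M'"
    using finite_has_maximal[of "{M \<in> Pow E. Q M}"] by (metis (no_types, lifting) PowD PowI empty_iff mem_Collect_eq)
  define A where "A = insert c (\<Union>M)"
  have AC: "A \<subseteq> C" using M(1) sub assms(2) by (auto simp: A_def)
  then have finA: "finite A" using assms(1) finite_subset by blast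
  have "A = C"
  proof (rule ccontr)
    assume "A \<noteq> C"
    then obtain D where D: "D \<in> E" "D \<inter> A \<noteq> {}" "\<not> D \<subseteq> A"
      using conn[OF AC] by (auto simp: A_def)
    then have "D \<notin> M" by (auto simp: A_def)
    have finD: "finite D" using D sub assms(1) finite_subset by blast
    have "card (A \<union> D) + card (A \<inter> D) = card A + card D"
      using card_Un_Int[OF finA finD] by simp
    moreover have "card (A \<inter> D) \<ge> 1"
      using D(2) finD by (simp add: card_gt_0_iff Suc_le_eq Int_commute)
    moreover have "card D \<ge> 1"
      using D(2) finD by (auto simp: card_gt_0_iff Suc_le_eq)
    ultimately have "card (A \<union> D) \<le> card A + (card D - 1)" by linarith
    moreover have "insert c (\<Union>(insert D M)) = A \<union> D" by (auto simp: A_def)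
    moreover have "finite M" using M(1) assms(3) finite_subset by blast
    ultimately have "Q (insert D M)"
      using M(2) \<open>D \<notin> M\<close> by (simp add: Q_def A_def)
    then have "M = insert D M" using max[of "insert D M"] D M by auto
    then show False using \<open>D \<notin> M\<close> by auto
  qed
  then have "card C \<le> 1 + (\<Sum>D\<in>M. card D - 1)" using M(2) by (simp add: Q_def A_def)
  also have "(\<Sum>D\<in>M. card D - 1) \<le> (\<Sum>D\<in>E. card D - 1)"
    by (rule sum_mono2) (use M assms(3) in auto)
  finally show ?thesis by simp
qed

text \<open>The maximum with 1 makes the constant monotone under powers, so a product over few
  couplings can be estimated by the one over all couplings.\<close>

lemma norm_exp_minus_1_le:
  fixes z :: complex
  assumes "norm z \<le> b * e" "0 \<le> b" "0 \<le> e" "e \<le> 1"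
  shows "norm (exp z - 1) \<le> max 1 (b * exp b) * e"
proof -
  have "norm (exp z - 1) \<le> norm z * exp (norm z)"
  proof -
    have s: "(\<lambda>n. z ^ Suc n /\<^sub>R fact (Suc n)) sums (exp z - 1)"
      using exp_converges[of z] by (subst sums_Suc_iff) simp
    have t: "(\<lambda>n. norm z * (norm z ^ n /\<^sub>R fact n)) sums (norm z * exp (norm z))"
      by (intro sums_mult exp_converges)
    show ?thesis
    proof (rule norm_sums_le[OF s t])
      fix n
      have "fact n \<le> (fact (Suc n) :: real)" by (simp add: fact_mono)
      then have "inverse (fact (Suc n)) \<le> (inverse (fact n) :: real)"
        by (intro le_imp_inverse_le) auto
      then have "norm z ^ Suc n * inverse (fact (Suc n)) \<le> norm z ^ Suc n * inverse (fact n)"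
        by (intro mult_left_mono) auto
      then show "norm (z ^ Suc n /\<^sub>R fact (Suc n)) \<le> norm z * (norm z ^ n /\<^sub>R fact n)"
        by (simp add: norm_mult norm_power mult_ac del: fact_Suc)
    qed
  qed
  also have "\<dots> \<le> (b * e) * exp b"
    using assms mult_left_le[of e b] by (intro mult_mono) auto
  also have "\<dots> = (b * exp b) * e" by simp
  also have "\<dots> \<le> max 1 (b * exp b) * e"
    by (intro mult_right_mono) (use assms in auto)
  finally show ?thesis .
qed

definition moebius_mass :: "'a set \<Rightarrow> real" where
  "moebius_mass I = (\<Sum>P | partition_on I P. \<bar>of_int (partition_moebius I P {I})\<bar>)"

text \<open>Over \<open>r\<close> indices there are at most \<open>2 ^ r\<close> couplings. Each is
  estimated by the maximum, and the factor 2 counts the sets of couplings.\<close>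

definition cluster_const :: "nat \<Rightarrow> real \<Rightarrow> real" where
  "cluster_const r C = (2 * max 1 (r * C * exp (r * C))) ^ 2 ^ r"

lemma moebius_mass_nonneg: "0 \<le> moebius_mass I"
  unfolding moebius_mass_def by (intro sum_nonneg) auto

lemma cluster_const_pos: "0 < cluster_const r C"
  unfolding cluster_const_def by auto

lemma card_partition_le:
  assumes "finite I" "partition_on I P"
  shows "card P \<le> card I"
proof -
  have fin: "finite P" using assms finite_elements by blast
  have fB: "finite B" if "B \<in> P" for B
    using that assms finite_subset[of B I] by (auto simp: partition_on_def)
  have "card P = (\<Sum>B\<in>P. 1)" by simp
  also have "\<dots> \<le> (\<Sum>B\<in>P. card B)"
  proof (rule sum_mono)
    fix B assume "B \<in> P"
    then have "B \<noteq> {}" using assms(2) by (auto simp: partition_on_def)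
    then show "1 \<le> card B" using fB[OF \<open>B \<in> P\<close>] by (simp add: card_gt_0_iff Suc_le_eq)
  qed
  also have "\<dots> = card I" using product_partition[OF assms(2) fB] by simp
  finally show ?thesis .
qed

text \<open>
  If a moment function is a product over components up to factors \<open>exp (\<tau> D)\<close> coupling the
  components in \<open>D\<close>, then expanding \<open>exp = 1 + (exp - 1)\<close> writes the cumulant as a sum over sets of
  couplings; the terms whose couplings do not connect all components add up to cumulants of
  factorizing moment functions and hence cancel.
\<close>

lemma cumulant_cluster_bound:
  fixes I :: "'a set" and comp :: "'a \<Rightarrow> 'c" and F G :: "'a set \<Rightarrow> complex" and \<tau> :: "'c set \<Rightarrow> 'a set \<Rightarrow> complex"
    and \<eta> C0 \<Gamma> :: real
  defines "Hyp \<equiv> {D. D \<subseteq> comp ` I \<and> 2 \<le> card D}"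
  assumes fin: "finite I" and ne: "I \<noteq> {}"
    and G1: "G {} = 1"
    and G: "\<And>S A. S \<subseteq> I \<Longrightarrow> G S = G {i\<in>S. comp i \<in> A} * G {i\<in>S. comp i \<notin> A}"
    and F: "\<And>S. S \<subseteq> I \<Longrightarrow> F S = G S * exp (\<Sum>D\<in>Hyp. \<tau> D S)"
    and \<tau>: "\<And>D S. D \<in> Hyp \<Longrightarrow> S \<subseteq> I \<Longrightarrow> \<tau> D S = \<tau> D {i\<in>S. comp i \<in> D}"
    and \<tau>0: "\<And>D. D \<in> Hyp \<Longrightarrow> \<tau> D {} = 0"
    and \<tau>b: "\<And>D S. D \<in> Hyp \<Longrightarrow> S \<subseteq> I \<Longrightarrow> norm (\<tau> D S) \<le> C0 * \<eta> ^ (card D - 1)"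
    and \<eta>: "0 \<le> \<eta>" "\<eta> \<le> 1" "0 \<le> C0"
    and \<Gamma>: "\<And>P. partition_on I P \<Longrightarrow> (\<Prod>B\<in>P. norm (G B)) \<le> \<Gamma>"
  shows "norm (cumulant F I) \<le>
    moebius_mass I * \<Gamma> * cluster_const (card I) C0 * \<eta> ^ (card (comp ` I) - 1)"
proof -
  define C where "C = comp ` I"
  define N where "N = card I"
  define K0 where "K0 = max 1 (N * C0 * exp (N * C0))"
  define V where "V = (\<lambda>D P. exp (\<Sum>B\<in>P. \<tau> D B) - 1)"
  define \<mu> where "\<mu> = (\<lambda>P. (of_int (partition_moebius I P {I}) :: complex))"
  \<comment> \<open>\<open>K E\<close> is the contribution in which precisely the couplings in
    \<open>E\<close> are taken from the factor \<open>exp - 1\<close>, while \<open>FE E\<close> is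
    the moment function with only the couplings in \<open>E\<close> switched on.\<close>
  define K where "K = (\<lambda>E. \<Sum>P | partition_on I P. \<mu> P * (\<Prod>B\<in>P. G B) * (\<Prod>D\<in>E. V D P))"
  define FE where "FE = (\<lambda>E S. G S * exp (\<Sum>D\<in>E. \<tau> D S))"
  have finC: "finite C" and neC: "C \<noteq> {}" using fin ne by (auto simp: C_def)
  have HypC: "Hyp \<subseteq> Pow C" by (auto simp: Hyp_def C_def)
  then have finH: "finite Hyp" using finC finite_subset by blast
  have finE: "finite E" if "E \<subseteq> Hyp" for E using that finH finite_subset by blast
  have exp1: "cumulant (FE E) I = (\<Sum>E'\<in>Pow E. K E')" if E: "E \<subseteq> Hyp" for E
  proof -
    have "cumulant (FE E) I = (\<Sum>P | partition_on I P. \<Sum>E'\<in>Pow E. \<mu> P * (\<Prod>B\<in>P. G B) * (\<Prod>D\<in>E'. V D P))"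
      unfolding cumulant_def
    proof (rule sum.cong[OF refl])
      fix P assume "P \<in> {P. partition_on I P}"
      then have finP: "finite P" using fin finite_elements by blast
      have "(\<Prod>B\<in>P. FE E B) = (\<Prod>B\<in>P. G B) * exp (\<Sum>B\<in>P. \<Sum>D\<in>E. \<tau> D B)"
        by (simp add: FE_def prod.distrib exp_sum finP)
      also have "(\<Sum>B\<in>P. \<Sum>D\<in>E. \<tau> D B) = (\<Sum>D\<in>E. \<Sum>B\<in>P. \<tau> D B)" by (rule sum.swap)
      also have "exp \<dots> = (\<Prod>D\<in>E. V D P + 1)"
        by (simp add: V_def exp_sum finE[OF E])
      also have "\<dots> = (\<Sum>E'\<in>Pow E. \<Prod>D\<in>E'. V D P)"
        using prod_add[OF finE[OF E], of "\<lambda>D. V D P" "\<lambda>_. 1"] by simp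
      finally show "of_int (partition_moebius I P {I}) * (\<Prod>B\<in>P. FE E B) = (\<Sum>E'\<in>Pow E. \<mu> P * (\<Prod>B\<in>P. G B) * (\<Prod>D\<in>E'. V D P))"
        by (simp add: sum_distrib_left mult.assoc \<mu>_def)
    qed
    also have "\<dots> = (\<Sum>E'\<in>Pow E. K E')" by (subst sum.swap) (simp add: K_def)
    finally show ?thesis .
  qed
  \<comment> \<open>If no coupling in \<open>E\<close> crosses the boundary of \<open>A\<close>,
    then \<open>FE E\<close> factorizes along \<open>A\<close> and its cumulant vanishes. That
    cumulant is the sum of \<open>K\<close> over all subsets of \<open>E\<close>; none of them
    crosses the boundary either, so by induction only \<open>K E\<close> is left.\<close>
  have zero: "K E = 0"
    if "E \<subseteq> Hyp" "A \<subseteq> C" "A \<noteq> {}" "A \<noteq> C" "\<And>D. D \<in> E \<Longrightarrow> D \<inter> A = {} \<or> D \<subseteq> A" for E A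
    using finE[OF that(1)] that(1,5)
  proof (induction E rule: finite_psubset_induct)
    case (psubset E)
    define U where "U = {i. comp i \<in> A}"
    have "cumulant (FE E) I = 0"
    proof (rule cumulant_factor_eq_0[where U = U])
      have "\<tau> D {} = 0" if "D \<in> E" for D using that \<tau>0 psubset.prems(1) by blast
      then show "FE E {} = 1" by (simp add: FE_def G1)
      show "I \<inter> U \<noteq> {}" "I - U \<noteq> {}"
        using that(2-4) by (auto simp: U_def C_def)
      fix S assume S: "S \<subseteq> I"
      have "\<tau> D S = \<tau> D (S \<inter> U) + \<tau> D (S - U)" if D: "D \<in> E" for D
      proof -
        have DH: "D \<in> Hyp" using D psubset.prems(1) by blast
        have t: "\<tau> D T = \<tau> D {i\<in>T. comp i \<in> D}" if "T \<subseteq> S" for T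
          using \<tau>[OF DH, of T] that S by blast
        consider "D \<inter> A = {}" | "D \<subseteq> A" using psubset.prems(2)[OF D] by blast
        then show ?thesis
        proof cases
          case 1
          then have "{i\<in>S \<inter> U. comp i \<in> D} = {}" "{i\<in>S - U. comp i \<in> D} = {i\<in>S. comp i \<in> D}"
            by (auto simp: U_def)
          then show ?thesis using t[of S] t[of "S \<inter> U"] t[of "S - U"] \<tau>0[OF DH]
            by (simp only: Int_lower1 Diff_subset order_refl add_0 add_0_right simp_thms)
        next
          case 2
          then have "{i\<in>S - U. comp i \<in> D} = {}" "{i\<in>S \<inter> U. comp i \<in> D} = {i\<in>S. comp i \<in> D}"
            by (auto simp: U_def)
          then show ?thesis using t[of S] t[of "S \<inter> U"] t[of "S - U"] \<tau>0[OF DH]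
            by (simp only: Int_lower1 Diff_subset order_refl add_0 add_0_right simp_thms)
        qed
      qed
      then have "(\<Sum>D\<in>E. \<tau> D S) = (\<Sum>D\<in>E. \<tau> D (S \<inter> U)) + (\<Sum>D\<in>E. \<tau> D (S - U))"
        by (simp add: sum.distrib)
      moreover have "S \<inter> U = {i\<in>S. comp i \<in> A}" "S - U = {i\<in>S. comp i \<notin> A}"
        by (auto simp: U_def)
      ultimately show "FE E S = FE E (S \<inter> U) * FE E (S - U)"
        using G[OF S, of A] by (simp add: FE_def exp_add)
    qed (rule fin)
    then have "0 = (\<Sum>E'\<in>Pow E. K E')" using exp1[OF psubset.prems(1)] by simp
    also have "\<dots> = K E + (\<Sum>E'\<in>Pow E - {E}. K E')"
      using psubset.hyps by (intro sum.remove) auto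
    also have "(\<Sum>E'\<in>Pow E - {E}. K E') = 0"
    proof (rule sum.neutral, rule ballI)
      fix E' assume "E' \<in> Pow E - {E}"
      then have "E' \<subset> E" by auto
      moreover from this have "E' \<subseteq> Hyp" "\<And>D. D \<in> E' \<Longrightarrow> D \<inter> A = {} \<or> D \<subseteq> A"
        using psubset.prems by (blast, blast)
      ultimately show "K E' = 0" using psubset.IH by blast
    qed
    finally show ?case by simp
  qed
  have K0: "K0 \<ge> 1" by (simp add: K0_def)
  have \<Gamma>0: "0 \<le> \<Gamma>"
    using \<Gamma>[OF partition_on_space[OF ne]] by (rule order_trans[rotated]) (auto intro: prod_nonneg)
  have bound: "norm (K E) \<le> moebius_mass I * \<Gamma> * (K0 ^ card Hyp * \<eta> ^ (card C - 1))"
    if E: "E \<subseteq> Hyp" for E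
  proof (cases "\<exists>A. A \<subseteq> C \<and> A \<noteq> {} \<and> A \<noteq> C \<and> (\<forall>D\<in>E. D \<inter> A = {} \<or> D \<subseteq> A)")
    case True
    then have "K E = 0" using zero[OF E] by blast
    then show ?thesis using K0 \<Gamma>0 moebius_mass_nonneg[of I] \<eta> by simp
  next
    case False
    obtain c where "c \<in> C" using neC by blast
    \<comment> \<open>For a connecting family the exponents \<open>card D - 1\<close> add up to at
      least the target exponent. This is why a coupling of \<open>D\<close> is measured by that
      power of \<eta>.\<close>
    have sumE: "card C - 1 \<le> (\<Sum>D\<in>E. card D - 1)"
    proof (rule connected_hypergraph_card[OF finC \<open>c \<in> C\<close> finE[OF E]])
      show "D \<subseteq> C" if "D \<in> E" for D using that E HypC by blast
      show "\<exists>D\<in>E. D \<inter> A \<noteq> {} \<and> \<not> D \<subseteq> A" if "A \<subseteq> C" "A \<noteq> {}" "A \<noteq> C" for A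
        using that False by metis
    qed
    have "norm (\<mu> P * (\<Prod>B\<in>P. G B) * (\<Prod>D\<in>E. V D P))
        \<le> \<bar>of_int (partition_moebius I P {I})\<bar> * (\<Gamma> * (K0 ^ card Hyp * \<eta> ^ (card C - 1)))"
      if P: "partition_on I P" for P
    proof -
      have V: "norm (V D P) \<le> K0 * \<eta> ^ (card D - 1)" if D: "D \<in> E" for D
        unfolding V_def K0_def
      proof (rule norm_exp_minus_1_le)
        have "norm (\<Sum>B\<in>P. \<tau> D B) \<le> (\<Sum>B\<in>P. C0 * \<eta> ^ (card D - 1))"
          using D E P by (intro sum_norm_le \<tau>b) (auto simp: partition_on_def)
        also have "\<dots> = card P * (C0 * \<eta> ^ (card D - 1))" by simp
        also have "\<dots> \<le> N * (C0 * \<eta> ^ (card D - 1))"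
          using card_partition_le[OF fin P] \<eta> by (intro mult_right_mono) (auto simp: N_def)
        finally show "norm (\<Sum>B\<in>P. \<tau> D B) \<le> N * C0 * \<eta> ^ (card D - 1)" by simp
      qed (use \<eta> in \<open>auto intro: power_le_one\<close>)
      have "norm (\<Prod>D\<in>E. V D P) \<le> (\<Prod>D\<in>E. K0 * \<eta> ^ (card D - 1))"
        unfolding prod_norm[symmetric] by (intro prod_mono) (use V in auto)
      also have "\<dots> = K0 ^ card E * \<eta> ^ (\<Sum>D\<in>E. card D - 1)"
        by (simp add: prod.distrib power_sum)
      also have "\<dots> \<le> K0 ^ card Hyp * \<eta> ^ (card C - 1)"
        using K0 \<eta> E finH sumE
        by (intro mult_mono power_increasing power_decreasing card_mono) auto
      finally have "norm (\<Prod>D\<in>E. V D P) \<le> K0 ^ card Hyp * \<eta> ^ (card C - 1)" .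
      then have "norm (\<Prod>B\<in>P. G B) * norm (\<Prod>D\<in>E. V D P) \<le> \<Gamma> * (K0 ^ card Hyp * \<eta> ^ (card C - 1))"
        using \<Gamma>[OF P] \<Gamma>0 by (intro mult_mono) (auto simp: prod_norm)
      then show ?thesis
        unfolding norm_mult mult.assoc \<mu>_def norm_of_int by (rule mult_left_mono) simp
    qed
    then have "norm (K E) \<le> (\<Sum>P | partition_on I P.
        \<bar>of_int (partition_moebius I P {I})\<bar> * (\<Gamma> * (K0 ^ card Hyp * \<eta> ^ (card C - 1))))"
      unfolding K_def by (intro sum_norm_le) auto
    then show ?thesis by (simp add: moebius_mass_def sum_distrib_right mult.assoc)
  qed
  have "cumulant F I = cumulant (FE Hyp) I"
    by (intro cumulant_cong) (simp add: F FE_def)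
  also have "\<dots> = (\<Sum>E'\<in>Pow Hyp. K E')" by (rule exp1) simp
  finally have "norm (cumulant F I)
      \<le> (\<Sum>E'\<in>Pow Hyp. moebius_mass I * \<Gamma> * (K0 ^ card Hyp * \<eta> ^ (card C - 1)))"
    using bound by (simp only:) (intro sum_norm_le, auto)
  also have "\<dots> = moebius_mass I * \<Gamma> * ((2 * K0) ^ card Hyp * \<eta> ^ (card C - 1))"
    using finH by (simp add: card_Pow power_mult_distrib)
  also have "\<dots> \<le> moebius_mass I * \<Gamma> * ((2 * K0) ^ 2 ^ N * \<eta> ^ (card C - 1))"
  proof -
    have "card Hyp \<le> 2 ^ card C"
      using card_mono[OF _ HypC] finC by (simp add: card_Pow)
    also have "\<dots> \<le> 2 ^ N"
      using card_image_le[OF fin, of comp] by (intro power_increasing) (auto simp: C_def N_def)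
    finally have "(2 * K0) ^ card Hyp \<le> (2 * K0) ^ 2 ^ N"
      using K0 by (intro power_increasing) auto
    then show ?thesis
      using \<Gamma>0 moebius_mass_nonneg[of I] \<eta> by (intro mult_left_mono mult_right_mono) auto
  qed
  finally show ?thesis
    by (simp add: cluster_const_def K0_def N_def C_def mult.assoc)
qed

section \<open>Taylor expansions and alternating sums\<close>

text \<open>Up to sign this is an iterated finite difference with one step \<open>d s\<close> per
  element of \<open>D\<close>, and each difference lowers the degree by one. The shift
  \<open>c\<close> is there for the induction.\<close>

lemma alternating_sum_power_eq_0:
  fixes d :: "'a \<Rightarrow> complex"
  assumes "finite D" "j < card D"
  shows "(\<Sum>X\<in>Pow D. (-1) ^ card X * (c + (\<Sum>s\<in>X. d s)) ^ j) = 0"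
  using assms
proof (induction D arbitrary: c j rule: finite_induct)
  case empty
  then show ?case by simp
next
  case (insert s D)
  define A where "A = (\<lambda>c j. \<Sum>X\<in>Pow D. (-1) ^ card X * (c + (\<Sum>s\<in>X. d s)) ^ j)"
  have fin: "finite X" "s \<notin> X" if "X \<in> Pow D" for X
    using that insert.hyps finite_subset by auto
  have "inj_on (insert s) (Pow D)" using insert.hyps(2) by (auto simp: inj_on_def)
  moreover have "Pow D \<inter> insert s ` Pow D = {}" using insert.hyps(2) by auto
  ultimately have "(\<Sum>X\<in>Pow (insert s D). (-1) ^ card X * (c + (\<Sum>s\<in>X. d s)) ^ j)
      = A c j + (\<Sum>X\<in>Pow D. (-1) ^ card (insert s X) * (c + (\<Sum>s\<in>insert s X. d s)) ^ j)"
    using insert.hyps by (simp add: Pow_insert sum.union_disjoint sum.reindex A_def)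
  also have "(\<Sum>X\<in>Pow D. (-1) ^ card (insert s X) * (c + (\<Sum>s\<in>insert s X. d s)) ^ j) = - A (c + d s) j"
    unfolding A_def sum_negf[symmetric] by (intro sum.cong refl) (simp add: fin add.assoc)
  also have "A (c + d s) j = A c j"
  proof -
    have "A (c + d s) j = (\<Sum>X\<in>Pow D. \<Sum>i\<le>j. (-1) ^ card X * (of_nat (j choose i) * (c + (\<Sum>s\<in>X. d s)) ^ i * d s ^ (j - i)))"
      unfolding A_def
    proof (intro sum.cong refl)
      fix X
      have "(c + d s + sum d X) ^ j = ((c + sum d X) + d s) ^ j" by (simp add: ac_simps)
      then show "(-1) ^ card X * (c + d s + sum d X) ^ j
        = (\<Sum>i\<le>j. (-1) ^ card X * (of_nat (j choose i) * (c + sum d X) ^ i * d s ^ (j - i)))"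
        by (simp only: binomial_ring sum_distrib_left)
    qed
    also have "\<dots> = (\<Sum>i\<le>j. of_nat (j choose i) * d s ^ (j - i) * A c i)"
      unfolding A_def sum_distrib_left by (subst sum.swap) (intro sum.cong refl, simp)
    also have "\<dots> = (\<Sum>i\<in>{j}. of_nat (j choose i) * d s ^ (j - i) * A c i)"
    proof (rule sum.mono_neutral_right)
      show "\<forall>i\<in>{..j} - {j}. of_nat (j choose i) * d s ^ (j - i) * A c i = 0"
      proof
        fix i assume "i \<in> {..j} - {j}"
        then have "i < card D" using insert.prems insert.hyps by simp
        then show "of_nat (j choose i) * d s ^ (j - i) * A c i = 0"
          using insert.IH[of i c] by (simp add: A_def)
      qed
    qed auto
    finally show ?thesis by simp
  qed
  finally show ?case by simp
qed

text \<open>Cauchy's estimates for the coefficients; the factor 2 bounds the geometric series with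
  ratio at most 1/2.\<close>

lemma taylor_remainder_bound:
  fixes f :: "complex \<Rightarrow> complex"
  assumes hol: "f holomorphic_on cball 0 R" and "R > 0"
    and bound: "\<And>y. y \<in> cball 0 R \<Longrightarrow> norm (f y) \<le> A"
  shows "norm ((deriv ^^ j) f 0 / fact j) \<le> A / R ^ j"
    and "norm y \<le> R / 2 \<Longrightarrow>
      norm (f y - (\<Sum>j<K. (deriv ^^ j) f 0 / fact j * y ^ j)) \<le> 2 * A * (norm y / R) ^ K"
proof -
  define a where "a = (\<lambda>j. (deriv ^^ j) f 0 / fact j)"
  have a: "norm (a j) \<le> A / R ^ j" for j
  proof -
    have "norm ((deriv ^^ j) f 0) \<le> fact j * A / R ^ j"
      using hol holomorphic_on_subset[OF hol ball_subset_cball] \<open>R > 0\<close> bound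
      by (intro Cauchy_inequality) (auto intro: holomorphic_on_imp_continuous_on)
    then show ?thesis by (simp add: a_def norm_divide field_simps)
  qed
  then show "norm ((deriv ^^ j) f 0 / fact j) \<le> A / R ^ j" unfolding a_def .
  assume y: "norm y \<le> R / 2"
  define q where "q = norm y / R"
  have q: "0 \<le> q" "q \<le> 1 / 2" using y \<open>R > 0\<close> by (auto simp: q_def field_simps)
  have A: "0 \<le> A" using bound[of 0] \<open>R > 0\<close> norm_ge_zero[of "f 0"] by (simp del: norm_ge_zero)
  have s: "(\<lambda>j. a j * y ^ j) sums f y"
    using holomorphic_power_series[of f 0 R y] holomorphic_on_subset[OF hol ball_subset_cball] y \<open>R > 0\<close>
    by (simp add: a_def)
  then have s': "(\<lambda>j. a (j + K) * y ^ (j + K)) sums (f y - (\<Sum>j<K. a j * y ^ j))"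
    by (rule sums_split_initial_segment)
  have "(\<lambda>j. A * q ^ K * q ^ j) sums (A * q ^ K * (1 / (1 - q)))"
    by (intro sums_mult geometric_sums) (use q in auto)
  then have "norm (f y - (\<Sum>j<K. a j * y ^ j)) \<le> A * q ^ K * (1 / (1 - q))"
  proof (rule norm_sums_le[OF s'])
    fix j
    have "norm (a (j + K) * y ^ (j + K)) \<le> A / R ^ (j + K) * norm y ^ (j + K)"
      unfolding norm_mult norm_power by (intro mult_right_mono a) auto
    also have "\<dots> = A * q ^ K * q ^ j"
      by (simp add: q_def power_divide power_add field_simps)
    finally show "norm (a (j + K) * y ^ (j + K)) \<le> A * q ^ K * q ^ j" .
  qed
  also have "\<dots> \<le> A * q ^ K * 2"
    using q A by (intro mult_left_mono) (auto simp: field_simps)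
  finally show "norm (f y - (\<Sum>j<K. (deriv ^^ j) f 0 / fact j * y ^ j)) \<le> 2 * A * (norm y / R) ^ K"
    by (simp add: a_def q_def mult_ac)
qed

text \<open>Taylor terms below degree \<open>card D\<close> are annihilated, so only the remainders
  count: \<open>2 ^ card D\<close> of them, each with the factor 2 of the remainder bound.\<close>

lemma alternating_sum_holomorphic_bound:
  fixes f :: "complex \<Rightarrow> complex" and d :: "'a \<Rightarrow> complex"
  assumes hol: "f holomorphic_on cball 0 R" and "R > 0"
    and bound: "\<And>y. y \<in> cball 0 R \<Longrightarrow> norm (f y) \<le> A"
    and D: "finite D" and d: "(\<Sum>s\<in>D. norm (d s)) \<le> b" "b \<le> R / 2"
  shows "norm (\<Sum>X\<in>Pow D. (-1) ^ card X * f (\<Sum>s\<in>X. d s)) \<le> 2 ^ (card D + 1) * A * (b / R) ^ card D"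
proof -
  define a where "a = (\<lambda>j. (deriv ^^ j) f 0 / fact j)"
  define t where "t = (\<lambda>X. \<Sum>s\<in>X. d s)"
  have t: "norm (t X) \<le> b" if "X \<in> Pow D" for X
  proof -
    have "norm (t X) \<le> (\<Sum>s\<in>X. norm (d s))" unfolding t_def by (rule norm_sum)
    also have "\<dots> \<le> (\<Sum>s\<in>D. norm (d s))" using that D by (intro sum_mono2) auto
    finally show ?thesis using d by simp
  qed
  have A: "0 \<le> A" using bound[of 0] \<open>R > 0\<close> norm_ge_zero[of "f 0"] by (simp del: norm_ge_zero)
  have "(\<Sum>X\<in>Pow D. (-1) ^ card X * (\<Sum>j<card D. a j * t X ^ j))
      = (\<Sum>j<card D. a j * (\<Sum>X\<in>Pow D. (-1) ^ card X * t X ^ j))"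
    unfolding sum_distrib_left by (subst sum.swap) (intro sum.cong refl, simp)
  also have "\<dots> = 0"
    using alternating_sum_power_eq_0[OF D, where c = 0 and d = d]
    by (intro sum.neutral) (auto simp: t_def)
  finally have "(\<Sum>X\<in>Pow D. (-1) ^ card X * f (t X))
      = (\<Sum>X\<in>Pow D. (-1) ^ card X * (f (t X) - (\<Sum>j<card D. a j * t X ^ j)))"
    by (simp add: right_diff_distrib sum_subtractf)
  also have "norm \<dots> \<le> (\<Sum>X\<in>Pow D. 2 * A * (b / R) ^ card D)"
  proof (rule sum_norm_le)
    fix X assume X: "X \<in> Pow D"
    have "norm (f (t X) - (\<Sum>j<card D. a j * t X ^ j)) \<le> 2 * A * (norm (t X) / R) ^ card D"
      unfolding a_def using t[OF X] d(2)
      by (intro taylor_remainder_bound(2)[OF hol \<open>R > 0\<close> bound]) auto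
    also have "\<dots> \<le> 2 * A * (b / R) ^ card D"
      using t[OF X] A \<open>R > 0\<close> by (intro mult_left_mono power_mono divide_right_mono) auto
    finally show "norm ((-1) ^ card X * (f (t X) - (\<Sum>j<card D. a j * t X ^ j))) \<le> 2 * A * (b / R) ^ card D"
      by (simp add: norm_mult norm_power)
  qed
  finally show ?thesis using D by (simp add: card_Pow t_def mult_ac)
qed

section \<open>Arcs and colourings\<close>

definition arc_depth :: "(nat \<times> nat) set \<Rightarrow> nat \<Rightarrow> nat" where
  "arc_depth S k = card {(i, j) \<in> S. i < k \<and> k < j}"

definition compatible_arcs :: "(nat \<times> nat) set \<Rightarrow> bool" where
  "compatible_arcs S \<longleftrightarrow> inj_on fst S \<and> inj_on snd S"

text \<open>Only positions up to \<open>k\<close> are tested, so that colours can be chosen from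
  left to right and counted one position at a time.\<close>

definition respects_arcs :: "(nat \<times> nat) set \<Rightarrow> nat \<Rightarrow> (nat \<Rightarrow> nat) \<Rightarrow> bool" where
  "respects_arcs S k c \<longleftrightarrow>
     (\<forall>(i, j)\<in>S. \<forall>p\<in>{1..k}. (p = j \<longrightarrow> c p = c i) \<and> (i < p \<and> p < j \<longrightarrow> c p \<noteq> c i))"

definition colour_kernel :: "nat \<Rightarrow> (nat \<Rightarrow> nat) \<Rightarrow> nat set set" where
  "colour_kernel n c = (\<lambda>x. {y\<in>{1..n}. c y = c x}) ` {1..n}"

lemma finite_arc_indices: "finite (arc_indices n)"
  by (rule finite_subset[of _ "{1..n} \<times> {1..n}"]) (auto simp: arc_indices_def)

lemma finite_colourings: "finite {c \<in> {1..k::nat} \<rightarrow>\<^sub>E {..<m::nat}. Q c}"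
  by (rule finite_subset[of _ "{1..k} \<rightarrow>\<^sub>E {..<m}"]) (auto intro: finite_PiE)

lemma respects_arcs_Suc:
  assumes S: "S \<subseteq> arc_indices n"
  shows "respects_arcs S (Suc k) (c(Suc k := v)) \<longleftrightarrow>
    respects_arcs S k c \<and> (\<forall>(i, j)\<in>S. (Suc k = j \<longrightarrow> v = c i) \<and> (i < Suc k \<and> Suc k < j \<longrightarrow> v \<noteq> c i))"
proof -
  have lt: "i < j" if "(i, j) \<in> S" for i j using that S by (auto simp: arc_indices_def)
  have ins: "{1..Suc k} = insert (Suc k) {1..k}" by auto
  define c' where "c' = c(Suc k := v)"
  define A where "A = (\<lambda>i j. \<forall>p\<in>{1..Suc k}. (p = j \<longrightarrow> c' p = c' i) \<and> (i < p \<and> p < j \<longrightarrow> c' p \<noteq> c' i))"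
  define B where "B = (\<lambda>i j. \<forall>p\<in>{1..k}. (p = j \<longrightarrow> c p = c i) \<and> (i < p \<and> p < j \<longrightarrow> c p \<noteq> c i))"
  define C where "C = (\<lambda>i j. (Suc k = j \<longrightarrow> v = c i) \<and> (i < Suc k \<and> Suc k < j \<longrightarrow> v \<noteq> c i))"
  have ABC: "A i j \<longleftrightarrow> B i j \<and> C i j" if "(i, j) \<in> S" for i j
  \<comment> \<open>An arc that starts at the new position has not imposed any condition so far, so
    changing the colour of its start is harmless.\<close>
  proof (cases "i = Suc k")
    case True
    then show ?thesis unfolding A_def B_def C_def using lt[OF that] by auto
  next
    case False
    then have "c' i = c i" "c' (Suc k) = v" "\<forall>p\<in>{1..k}. c' p = c p" by (auto simp: c'_def)
    then show ?thesis unfolding A_def B_def C_def ins by auto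
  qed
  have "respects_arcs S (Suc k) c' \<longleftrightarrow> (\<forall>(i, j)\<in>S. A i j)"
    by (simp only: respects_arcs_def A_def)
  also have "\<dots> \<longleftrightarrow> (\<forall>(i, j)\<in>S. B i j) \<and> (\<forall>(i, j)\<in>S. C i j)"
    using ABC by fast
  finally show ?thesis by (simp only: respects_arcs_def B_def C_def c'_def)
qed

text \<open>An arc ending at the new position forces the colour. Otherwise the colours of the arcs
  passing over it are forbidden. These are pairwise distinct: at the start of the later of two such
  arcs the earlier one is still open and forbids its own colour there.\<close>

lemma card_colour_choices:
  assumes S: "S \<subseteq> arc_indices n" and comp: "compatible_arcs S"
    and c: "c \<in> {1..k} \<rightarrow>\<^sub>E {..<m}" "respects_arcs S k c"
  shows "real (card {v\<in>{..<m}. \<forall>(i, j)\<in>S. (Suc k = j \<longrightarrow> v = c i) \<and> (i < Suc k \<and> Suc k < j \<longrightarrow> v \<noteq> c i)})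
    = (if Suc k \<in> snd ` S then 1 else real m - arc_depth S (Suc k))" (is "real (card ?W) = _")
proof -
  have lt: "1 \<le> i" "i < j" if "(i, j) \<in> S" for i j using that S by (auto simp: arc_indices_def)
  have ne: "c i \<noteq> c i'" if "(i, j) \<in> S" "(i', j') \<in> S" "i < i'" "i' < j" "i' \<le> k" for i j i' j'
    using c(2) that lt(1)[OF that(2)] unfolding respects_arcs_def by fastforce
  have neq: "i \<noteq> i'" "j \<noteq> j'" if "(i, j) \<in> S" "(i', j') \<in> S" "(i, j) \<noteq> (i', j')" for i j i' j'
    using comp that unfolding compatible_arcs_def inj_on_def by (metis fst_conv snd_conv)+
  have finS: "finite S" using S finite_arc_indices finite_subset by blast
  show ?thesis
  proof (cases "Suc k \<in> snd ` S")
    case True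
    then obtain i where i: "(i, Suc k) \<in> S" by force
    have "?W = {c i}"
    proof (intro equalityI subsetI)
      fix v assume "v \<in> ?W"
      then show "v \<in> {c i}" using i by auto
    next
      fix v assume "v \<in> {c i}"
      then have v: "v = c i" by simp
      have "i \<in> {1..k}" using lt[OF i] by auto
      then have "c i < m" using c(1) by (auto simp: PiE_iff)
      moreover have "v = c i'" if "(i', Suc k) \<in> S" for i'
        using neq(2)[OF i that] v by auto
      moreover have "v \<noteq> c i'" if "(i', j') \<in> S" "i' < Suc k" "Suc k < j'" for i' j'
      proof -
        have "i \<noteq> i'" using neq(1)[OF i that(1)] that by auto
        then consider "i < i'" | "i' < i" by linarith
        then show ?thesis
          by cases (use ne[OF i that(1)] ne[OF that(1) i] that v lt(2)[OF i] in auto)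
      qed
      ultimately show "v \<in> ?W" using v by auto
    qed
    then show ?thesis using True by simp
  next
    case False
    define Act where "Act = {(i, j) \<in> S. i < Suc k \<and> Suc k < j}"
    have W: "?W = {..<m} - (\<lambda>(i, j). c i) ` Act"
      using False by (fastforce simp: Act_def image_iff)
    have sub: "(\<lambda>(i, j). c i) ` Act \<subseteq> {..<m}"
    proof (rule image_subsetI)
      fix z assume "z \<in> Act"
      then obtain i j where "z = (i, j)" "i \<in> {1..k}" using lt by (cases z) (auto simp: Act_def)
      then show "(case z of (i, j) \<Rightarrow> c i) \<in> {..<m}" using c(1) by (auto simp: PiE_iff)
    qed
    have inj: "inj_on (\<lambda>(i, j). c i) Act"
    proof (rule inj_onI)
      fix z z' assume "z \<in> Act" "z' \<in> Act" and eq: "(case z of (i, j) \<Rightarrow> c i) = (case z' of (i, j) \<Rightarrow> c i)"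
      then obtain i j i' j' where z: "z = (i, j)" "z' = (i', j')"
        and a: "(i, j) \<in> Act" "(i', j') \<in> Act" "c i = c i'" by (cases z; cases z') auto
      then have b: "(i, j) \<in> S" "(i', j') \<in> S" "i \<le> k" "i' \<le> k" "i' < j" "i < j'"
        by (auto simp: Act_def)
      have "\<not> i < i'" "\<not> i' < i" using ne[OF b(1,2)] ne[OF b(2,1)] a(3) b by auto
      then have "i = i'" by simp
      then have "(i, j) = (i', j')" using neq(1)[OF b(1,2)] by blast
      then show "z = z'" using z by simp
    qed
    have cA: "card ((\<lambda>(i, j). c i) ` Act) = card Act" by (rule card_image[OF inj])
    \<comment> \<open>The forbidden colours are distinct elements of a set of size \<open>m\<close>,
      hence the subtraction of natural numbers agrees with the real one.\<close>
    then have "card Act \<le> m" using card_mono[OF _ sub] by simp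
    moreover have "card ?W = m - card Act"
      unfolding W using sub cA by (subst card_Diff_subset) (auto intro: finite_subset)
    ultimately show ?thesis using False by (simp add: Act_def arc_depth_def of_nat_diff)
  qed
qed

lemma card_respecting_colourings:
  assumes S: "S \<subseteq> arc_indices n" and comp: "compatible_arcs S"
  shows "real (card {c \<in> {1..k} \<rightarrow>\<^sub>E {..<m}. respects_arcs S k c})
    = (\<Prod>p\<in>{1..k}. if p \<in> snd ` S then 1 else real m - arc_depth S p)"
proof (induction k)
  case 0
  have "{c \<in> {1..0} \<rightarrow>\<^sub>E {..<m}. respects_arcs S 0 c} = {\<lambda>_. undefined}"
    by (auto simp: respects_arcs_def)
  then show ?case by simp
next
  case (Suc k)
  define Z where "Z = {c \<in> {1..k} \<rightarrow>\<^sub>E {..<m}. respects_arcs S k c}"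
  define W where "W = (\<lambda>c. {v\<in>{..<m}. \<forall>(i, j)\<in>S. (Suc k = j \<longrightarrow> v = c i) \<and> (i < Suc k \<and> Suc k < j \<longrightarrow> v \<noteq> c i)})"
  have finZ: "finite Z" unfolding Z_def by (rule finite_colourings)
  have ins: "{1..Suc k} = insert (Suc k) {1..k}" by auto
  have "bij_betw (\<lambda>(c, v). c(Suc k := v)) (SIGMA c:Z. W c)
      {c \<in> {1..Suc k} \<rightarrow>\<^sub>E {..<m}. respects_arcs S (Suc k) c}"
  proof (rule bij_betw_byWitness[where f' = "\<lambda>c. (c(Suc k := undefined), c (Suc k))"], goal_cases)
    case 1
    then show ?case by (auto simp: Z_def PiE_iff extensional_def)
  next
    case 2
    then show ?case by auto
  next
    case 3
    then show ?case
    proof clarify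
      fix c v assume cv: "c \<in> Z" "v \<in> W c"
      then have "respects_arcs S (Suc k) (c(Suc k := v))"
        unfolding respects_arcs_Suc[OF S] Z_def W_def by auto
      moreover have "c(Suc k := v) \<in> {1..Suc k} \<rightarrow>\<^sub>E {..<m}"
        using cv unfolding ins by (auto simp: Z_def W_def PiE_iff extensional_def)
      ultimately show "c(Suc k := v) \<in> {1..Suc k} \<rightarrow>\<^sub>E {..<m} \<and> respects_arcs S (Suc k) (c(Suc k := v))"
        by simp
    qed
  next
    case 4
    then show ?case
    proof clarify
      fix c assume c: "c \<in> {1..Suc k} \<rightarrow>\<^sub>E {..<m}" "respects_arcs S (Suc k) c"
      define c' where "c' = c(Suc k := undefined)"
      have "c = c'(Suc k := c (Suc k))" by (simp add: c'_def)
      with c(2) have "respects_arcs S (Suc k) (c'(Suc k := c (Suc k)))" by simp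
      then have r: "respects_arcs S k c'" "\<forall>(i, j)\<in>S. (Suc k = j \<longrightarrow> c (Suc k) = c' i) \<and>
          (i < Suc k \<and> Suc k < j \<longrightarrow> c (Suc k) \<noteq> c' i)"
        unfolding respects_arcs_Suc[OF S] by auto
      have "c' \<in> {1..k} \<rightarrow>\<^sub>E {..<m}" "c (Suc k) < m"
        using c(1) unfolding c'_def ins by (auto simp: PiE_iff extensional_def)
      with r show "c(Suc k := undefined) \<in> Z \<and> c (Suc k) \<in> W (c(Suc k := undefined))"
        unfolding Z_def W_def c'_def[symmetric] by auto
    qed
  qed
  then have "card {c \<in> {1..Suc k} \<rightarrow>\<^sub>E {..<m}. respects_arcs S (Suc k) c} = card (SIGMA c:Z. W c)"
    by (simp add: bij_betw_same_card)
  also have "\<dots> = (\<Sum>c\<in>Z. card (W c))"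
    using finZ by (intro card_SigmaI) (auto simp: W_def)
  finally have "real (card {c \<in> {1..Suc k} \<rightarrow>\<^sub>E {..<m}. respects_arcs S (Suc k) c})
      = (\<Sum>c\<in>Z. real (card (W c)))" by simp
  also have "\<dots> = (\<Sum>c\<in>Z. if Suc k \<in> snd ` S then 1 else real m - arc_depth S (Suc k))"
    unfolding W_def by (intro sum.cong refl card_colour_choices[OF S comp]) (auto simp: Z_def)
  also have "\<dots> = real (card Z) * (if Suc k \<in> snd ` S then 1 else real m - arc_depth S (Suc k))"
    by simp
  finally show ?case unfolding Z_def Suc.IH ins by (simp add: mult.commute)
qed

section \<open>Kernels of colourings and Dobinski's formula\<close>

lemma partition_on_colour_kernel: "partition_on {1..n} (colour_kernel n c)"
  unfolding colour_kernel_def by (rule partition_onI) (auto simp: disjnt_def)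

lemma has_arc_colour_kernel:
  assumes "(i, j) \<in> arc_indices n"
  shows "has_arc (colour_kernel n c) i j \<longleftrightarrow> c j = c i \<and> (\<forall>p. i < p \<and> p < j \<longrightarrow> c p \<noteq> c i)"
proof -
  have ij: "1 \<le> i" "i < j" "j \<le> n" using assms by (auto simp: arc_indices_def)
  define B where "B = {y\<in>{1..n}. c y = c i}"
  have "B \<in> colour_kernel n c" using ij by (auto simp: colour_kernel_def B_def)
  moreover have "X = B" if "X \<in> colour_kernel n c" "i \<in> X" for X
    using that by (auto simp: colour_kernel_def B_def)
  ultimately have "has_arc (colour_kernel n c) i j \<longleftrightarrow> i \<in> B \<and> j \<in> B \<and> (\<forall>k\<in>B. i < k \<longrightarrow> j \<le> k)"
    using ij(2) unfolding has_arc_def by blast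
  also have "\<dots> \<longleftrightarrow> c j = c i \<and> (\<forall>p. i < p \<and> p < j \<longrightarrow> c p \<noteq> c i)"
    using ij by (auto simp: B_def not_le[symmetric]) (meson not_le less_imp_le order_trans)+
  finally show ?thesis .
qed

lemma respects_arcs_iff_has_arc:
  assumes S: "S \<subseteq> arc_indices n"
  shows "respects_arcs S n c \<longleftrightarrow> (\<forall>(i, j)\<in>S. has_arc (colour_kernel n c) i j)"
proof -
  define A where "A = (\<lambda>i j. \<forall>p\<in>{1..n}. (p = j \<longrightarrow> c p = c i) \<and> (i < p \<and> p < j \<longrightarrow> c p \<noteq> c i))"
  have *: "A i j \<longleftrightarrow> has_arc (colour_kernel n c) i j" if "(i, j) \<in> S" for i j
  proof -
    have ij: "(i, j) \<in> arc_indices n" using that S by auto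
    then have "1 \<le> i" "i < j" "j \<le> n" by (auto simp: arc_indices_def)
    then show ?thesis unfolding has_arc_colour_kernel[OF ij] A_def by auto
  qed
  have "respects_arcs S n c \<longleftrightarrow> (\<forall>(i, j)\<in>S. A i j)"
    by (simp only: respects_arcs_def A_def)
  also have "\<dots> \<longleftrightarrow> (\<forall>(i, j)\<in>S. has_arc (colour_kernel n c) i j)"
    using * by fast
  finally show ?thesis .
qed

lemma has_arc_functional:
  assumes P: "partition_on A P" and "has_arc P i j" "has_arc P i' j'"
  shows "i = i' \<longleftrightarrow> j = j'"
proof -
  obtain B B' where B: "B \<in> P" "i \<in> B" "j \<in> B" "\<forall>k\<in>B. i < k \<longrightarrow> j \<le> k" "i < j"
    and B': "B' \<in> P" "i' \<in> B'" "j' \<in> B'" "\<forall>k\<in>B'. i' < k \<longrightarrow> j' \<le> k" "i' < j'"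
    using assms(2,3) by (auto simp: has_arc_def)
  have "B = B'" if "B \<inter> B' \<noteq> {}"
    using P B(1) B'(1) that unfolding partition_on_def disjoint_def by metis
  then have "B = B'" if "i = i' \<or> j = j'" using that B B' by blast
  then show ?thesis using B B' by (metis le_antisym less_le_not_le linorder_neqE_nat not_less)
qed

text \<open>Such colourings correspond to injections from the blocks of \<open>P\<close> to the
  colours. With fewer colours than blocks one of the factors \<open>m - i\<close> is zero.\<close>

lemma card_colourings_of_kernel:
  assumes P: "partition_on {1..n} P"
  shows "card {c \<in> {1..n} \<rightarrow>\<^sub>E {..<m}. colour_kernel n c = P} = (\<Prod>i\<in>{0..<card P}. m - i)"
proof -
  have finP: "finite P" using P finite_elements by blast
  define blk where "blk = (\<lambda>x. THE B. B \<in> P \<and> x \<in> B)"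
  have blk: "blk x = B" if "B \<in> P" "x \<in> B" for x B
    unfolding blk_def
  proof (rule the_equality)
    fix B' assume "B' \<in> P \<and> x \<in> B'"
    then show "B' = B" using that P unfolding partition_on_def disjoint_def by blast
  qed (use that in auto)
  have blkP: "blk x \<in> P" "x \<in> blk x" if "x \<in> {1..n}" for x
  proof -
    have "x \<in> \<Union>P" using that P by (simp add: partition_on_def)
    then obtain B where "B \<in> P" "x \<in> B" by blast
    then show "blk x \<in> P" "x \<in> blk x" using blk by auto
  qed
  have subP: "B \<subseteq> {1..n}" if "B \<in> P" for B
    using that P unfolding partition_on_def by blast
  have ne: "\<exists>x\<in>{1..n}. x \<in> B" if "B \<in> P" for B
  proof -
    have "B \<noteq> {}" using that P by (auto simp: partition_on_def)
    then show ?thesis using subP[OF that] by blast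
  qed
  define f :: "(nat set \<Rightarrow> nat) \<Rightarrow> nat \<Rightarrow> nat" where "f = (\<lambda>g. restrict (\<lambda>x. g (blk x)) {1..n})"
  have "bij_betw f {g \<in> P \<rightarrow>\<^sub>E {..<m}. inj_on g P} {c \<in> {1..n} \<rightarrow>\<^sub>E {..<m}. colour_kernel n c = P}"
  proof (rule bij_betw_imageI)
    show "inj_on f {g \<in> P \<rightarrow>\<^sub>E {..<m}. inj_on g P}"
    proof (rule inj_onI, clarify)
      fix g g' assume g: "g \<in> P \<rightarrow>\<^sub>E {..<m}" "g' \<in> P \<rightarrow>\<^sub>E {..<m}" and eq: "f g = f g'"
      show "g = g'"
      proof (rule PiE_ext[OF g])
        fix B assume B: "B \<in> P"
        then obtain x where x: "x \<in> {1..n}" "x \<in> B" using ne by blast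
        then show "g B = g' B" using fun_cong[OF eq, of x] blk[OF B] by (simp add: f_def)
      qed
    qed
    show "f ` {g \<in> P \<rightarrow>\<^sub>E {..<m}. inj_on g P} = {c \<in> {1..n} \<rightarrow>\<^sub>E {..<m}. colour_kernel n c = P}"
    proof (intro equalityI subsetI)
      fix c assume "c \<in> f ` {g \<in> P \<rightarrow>\<^sub>E {..<m}. inj_on g P}"
      then obtain g where g: "g \<in> P \<rightarrow>\<^sub>E {..<m}" "inj_on g P" "c = f g" by auto
      have "c \<in> {1..n} \<rightarrow>\<^sub>E {..<m}"
        unfolding g(3) f_def using PiE_mem[OF g(1)] blkP(1) by (intro restrict_PiE_iff[THEN iffD2]) blast
      moreover have eqv: "{y\<in>{1..n}. c y = c x} = blk x" if "x \<in> {1..n}" for x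
      proof -
        have "c y = c x \<longleftrightarrow> y \<in> blk x" if "y \<in> {1..n}" for y
        proof -
          have "c y = c x \<longleftrightarrow> blk y = blk x"
            using inj_on_eq_iff[OF g(2) blkP(1)[OF that] blkP(1)[OF \<open>x \<in> {1..n}\<close>]] that \<open>x \<in> {1..n}\<close>
            by (simp add: g(3) f_def)
          also have "\<dots> \<longleftrightarrow> y \<in> blk x"
            using blk[OF blkP(1)[OF \<open>x \<in> {1..n}\<close>], of y] blkP(2)[OF that] by auto
          finally show ?thesis .
        qed
        then show ?thesis using subP[OF blkP(1)[OF that]] by blast
      qed
      moreover have "colour_kernel n c = P"
      proof (intro equalityI subsetI)
        fix B assume "B \<in> colour_kernel n c"
        then show "B \<in> P" using eqv blkP by (auto simp: colour_kernel_def)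
      next
        fix B assume B: "B \<in> P"
        then obtain x where x: "x \<in> {1..n}" "x \<in> B" using ne by blast
        then show "B \<in> colour_kernel n c"
          unfolding colour_kernel_def using eqv[OF x(1)] blk[OF B x(2)] by (auto intro!: image_eqI[of _ _ x])
      qed
      ultimately show "c \<in> {c \<in> {1..n} \<rightarrow>\<^sub>E {..<m}. colour_kernel n c = P}" by simp
    next
      fix c assume "c \<in> {c \<in> {1..n} \<rightarrow>\<^sub>E {..<m}. colour_kernel n c = P}"
      then have c: "c \<in> {1..n} \<rightarrow>\<^sub>E {..<m}" "colour_kernel n c = P" by auto
      have same: "c y = c x" if "B \<in> P" "x \<in> B" "y \<in> B" for B x y
        using that c(2) by (auto simp: colour_kernel_def)
      have diff: "B = B'" if B: "B \<in> P" "B' \<in> P" "x \<in> B" "y \<in> B'" "c y = c x" for B B' x y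
      proof -
        obtain z z' where "B = {y\<in>{1..n}. c y = c z}" "B' = {y\<in>{1..n}. c y = c z'}"
          using B(1,2) c(2) by (auto simp: colour_kernel_def)
        then show ?thesis using B(3-5) by auto
      qed
      define g where "g = restrict (\<lambda>B. c (SOME x. x \<in> B)) P"
      have pick: "(SOME x. x \<in> B) \<in> B" if "B \<in> P" for B
        using ne[OF that] by (auto intro: someI)
      have "g \<in> P \<rightarrow>\<^sub>E {..<m}"
        using pick subP c(1) by (fastforce simp: g_def PiE_iff)
      moreover have "inj_on g P"
        using diff pick by (intro inj_onI) (metis g_def restrict_apply')
      moreover have "c = f g"
      proof
        fix x
        show "c x = f g x"
        proof (cases "x \<in> {1..n}")
          case True
          then have "f g x = c (SOME y. y \<in> blk x)" using blkP by (simp add: f_def g_def)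
          then show ?thesis using same[OF blkP(1)[OF True] pick[OF blkP(1)[OF True]] blkP(2)[OF True]] by simp
        next
          case False
          then have "f g x = undefined" unfolding f_def restrict_def by (simp only: if_False)
          then show ?thesis using PiE_arb[OF c(1) False] by simp
        qed
      qed
      ultimately show "c \<in> f ` {g \<in> P \<rightarrow>\<^sub>E {..<m}. inj_on g P}" by blast
    qed
  qed
  then have "card {c \<in> {1..n} \<rightarrow>\<^sub>E {..<m}. colour_kernel n c = P} = card {g \<in> P \<rightarrow>\<^sub>E {..<m}. inj_on g P}"
    by (simp add: bij_betw_same_card)
  also have "\<dots> = (\<Prod>i\<in>{0..<card P}. m - i)"
    using card_inj_on_subset_funcset[OF finP finite_lessThan, of P m] by simp
  finally show ?thesis .
qed

text \<open>The terms below \<open>k\<close> vanish, and shifting by \<open>k\<close> leaves the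
  exponential series. The value is independent of \<open>k\<close>: this is why weights
  \<open>1 / fact m\<close> on the number of colours give every partition the same total weight,
  whatever its number of blocks.\<close>

lemma sums_falling_factorial:
  "(\<lambda>m. real (\<Prod>i\<in>{0..<k}. m - i) / fact m) sums exp 1"
proof -
  have ff: "real (\<Prod>i\<in>{0..<k}. (m + k) - i) / fact (m + k) = 1 / fact m" for m
  proof -
    have "(\<Prod>i\<in>{0..<k}. (m + k) - i) * fact m = (fact (m + k) :: nat)"
    proof (induction k)
      case (Suc k)
      have "(\<Prod>i\<in>{0..<Suc k}. (m + Suc k) - i) = (m + Suc k) * (\<Prod>i\<in>{0..<k}. (m + k) - i)"
        by (simp only: prod.atLeast0_lessThan_Suc_shift o_def) simp
      then show ?case using Suc by (simp only: mult.assoc add_Suc_right fact_Suc of_nat_id)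
    qed simp
    then have "real (\<Prod>i\<in>{0..<k}. (m + k) - i) * fact m = fact (m + k)"
      by (metis of_nat_fact of_nat_mult)
    then show ?thesis by (simp add: field_simps del: of_nat_prod)
  qed
  have "(\<lambda>m. 1 / fact m) sums exp (1::real)" using exp_converges[of "1::real"] by (simp add: field_simps)
  then have "(\<lambda>m. real (\<Prod>i\<in>{0..<k}. (m + k) - i) / fact (m + k)) sums exp 1"
    by (simp only: ff)
  moreover have "(\<Sum>m<k. real (\<Prod>i\<in>{0..<k}. m - i) / fact m) = 0"
    by (intro sum.neutral) (auto simp: prod_zero_iff simp del: of_nat_prod)
  ultimately show ?thesis by (subst (asm) sums_iff_shift[of _ k]) simp
qed

lemma dobinski:
  assumes "Q \<subseteq> {P. partition_on {1..n} P}"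
  shows "(\<lambda>m. real (card {c \<in> {1..n} \<rightarrow>\<^sub>E {..<m}. colour_kernel n c \<in> Q}) / fact m) sums (exp 1 * real (card Q))"
proof -
  have fin: "finite Q" using assms finitely_many_partition_on[of "{1..n}"] finite_subset by auto
  have "(\<lambda>m. \<Sum>P\<in>Q. real (\<Prod>i\<in>{0..<card P}. m - i) / fact m) sums (\<Sum>P\<in>Q. exp 1)"
    by (intro sums_sum sums_falling_factorial)
  moreover have "real (card {c \<in> {1..n} \<rightarrow>\<^sub>E {..<m}. colour_kernel n c \<in> Q}) / fact m
      = (\<Sum>P\<in>Q. real (\<Prod>i\<in>{0..<card P}. m - i) / fact m)" for m
  proof -
    have "{c \<in> {1..n} \<rightarrow>\<^sub>E {..<m}. colour_kernel n c \<in> Q}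
        = (\<Union>P\<in>Q. {c \<in> {1..n} \<rightarrow>\<^sub>E {..<m}. colour_kernel n c = P})" by auto
    then have "card {c \<in> {1..n} \<rightarrow>\<^sub>E {..<m}. colour_kernel n c \<in> Q}
        = (\<Sum>P\<in>Q. card {c \<in> {1..n} \<rightarrow>\<^sub>E {..<m}. colour_kernel n c = P})"
      using fin finite_colourings by (simp only:) (rule card_UN_disjoint, auto)
    also have "\<dots> = (\<Sum>P\<in>Q. \<Prod>i\<in>{0..<card P}. m - i)"
      using assms by (intro sum.cong refl card_colourings_of_kernel) auto
    finally show ?thesis by (simp add: sum_divide_distrib)
  qed
  ultimately show ?thesis by (simp add: mult.commute)
qed

section \<open>The number of urns\<close>

definition bell :: "nat \<Rightarrow> nat" where
  "bell n = card {P. partition_on {1..n} P}"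

text \<open>The law of the number of urns in Stam's construction of a uniform set partition.\<close>

definition urn_law :: "nat \<Rightarrow> nat \<Rightarrow> real" where
  "urn_law n m = real m ^ n / (fact m * exp 1 * bell n)"

text \<open>
  The probability of seeing all arcs in \<open>S\<close> in the kernel of a uniformly random colouring with
  \<open>z\<close> colours, continued to complex \<open>z\<close>.
\<close>

definition arcs_prob :: "nat \<Rightarrow> (nat \<times> nat) set \<Rightarrow> complex \<Rightarrow> complex" where
  "arcs_prob n S z = (if compatible_arcs S
     then inverse z ^ card S * (\<Prod>p\<in>{1..n} - snd ` S. 1 - of_nat (arc_depth S p) / z) else 0)"

lemma bell_pos: "0 < bell n"
proof -
  have "(\<lambda>x. {x}) ` {1..n} \<in> {P. partition_on {1..n} P}"
    using partition_on_singletons by simp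
  then show ?thesis
    using finitely_many_partition_on[of "{1..n}"] unfolding bell_def by (auto simp: card_gt_0_iff)
qed

lemma urn_law_nonneg: "0 \<le> urn_law n m"
  by (simp add: urn_law_def)

lemma powers_over_fact_sums: "(\<lambda>m. real m ^ n / fact m) sums (exp 1 * bell n)"
proof -
  have eq: "{c \<in> {1..n} \<rightarrow>\<^sub>E {..<m}. colour_kernel n c \<in> {P. partition_on {1..n} P}} = {1..n} \<rightarrow>\<^sub>E {..<m}" for m
    using partition_on_colour_kernel by auto
  have "card ({1..n} \<rightarrow>\<^sub>E {..<m}) = m ^ n" for m
    by (subst card_funcsetE) auto
  then show ?thesis
    using dobinski[of "{P. partition_on {1..n} P}" n] unfolding eq bell_def by simp
qed

lemma urn_law_sums: "urn_law n sums 1"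
proof -
  have "(\<lambda>m. real m ^ n / fact m * (1 / (exp 1 * bell n))) sums (exp 1 * bell n * (1 / (exp 1 * bell n)))"
    by (intro sums_mult2 powers_over_fact_sums)
  then show ?thesis using bell_pos[of n] by (simp add: urn_law_def[abs_def] mult.assoc)
qed

lemma arcs_prob_colourings:
  assumes S: "S \<subseteq> arc_indices n" and comp: "compatible_arcs S" and m: "m \<ge> 1"
  shows "arcs_prob n S (of_nat m) = of_real (real (card {c \<in> {1..n} \<rightarrow>\<^sub>E {..<m}. respects_arcs S n c}) / real m ^ n)"
proof -
  have sub: "snd ` S \<subseteq> {1..n}" using S by (force simp: arc_indices_def)
  have cS: "card (snd ` S) = card S" using comp by (intro card_image) (simp add: compatible_arcs_def)
  have split: "(\<Prod>p\<in>{1..n}. if p \<in> snd ` S then a else f p) = a ^ card S * (\<Prod>p\<in>{1..n} - snd ` S. f p)"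
    for a :: real and f
  proof -
    have "(\<Prod>p\<in>{1..n}. if p \<in> snd ` S then a else f p)
        = (\<Prod>p\<in>snd ` S. if p \<in> snd ` S then a else f p) * (\<Prod>p\<in>{1..n} - snd ` S. if p \<in> snd ` S then a else f p)"
      using prod.subset_diff[OF sub, of "\<lambda>p. if p \<in> snd ` S then a else f p"] by (simp add: mult.commute)
    also have "\<dots> = (\<Prod>p\<in>snd ` S. a) * (\<Prod>p\<in>{1..n} - snd ` S. f p)"
      by (intro arg_cong2[where f = "(*)"] prod.cong) auto
    finally show ?thesis by (simp add: cS)
  qed
  have "real (card {c \<in> {1..n} \<rightarrow>\<^sub>E {..<m}. respects_arcs S n c}) / real m ^ n
      = (\<Prod>p\<in>{1..n}. (if p \<in> snd ` S then 1 else real m - arc_depth S p) / real m)"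
    unfolding card_respecting_colourings[OF S comp] by (simp add: prod_dividef)
  also have "\<dots> = (\<Prod>p\<in>{1..n}. if p \<in> snd ` S then inverse (real m) else 1 - arc_depth S p / real m)"
    using m by (intro prod.cong refl) (auto simp: field_simps)
  also have "\<dots> = inverse (real m) ^ card S * (\<Prod>p\<in>{1..n} - snd ` S. 1 - arc_depth S p / real m)"
    by (rule split)
  finally show ?thesis using comp by (simp add: arcs_prob_def)
qed

lemma norm_arcs_prob_le_1:
  assumes S: "S \<subseteq> arc_indices n" and m: "m \<ge> 1"
  shows "norm (arcs_prob n S (of_nat m)) \<le> 1"
proof (cases "compatible_arcs S")
  case True
  have "card {c \<in> {1..n} \<rightarrow>\<^sub>E {..<m}. respects_arcs S n c} \<le> card ({1..n} \<rightarrow>\<^sub>E {..<m})"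
    by (intro card_mono) (auto intro: finite_PiE)
  also have "card ({1..n} \<rightarrow>\<^sub>E {..<m}) = m ^ n" by (subst card_funcsetE) auto
  finally have "real (card {c \<in> {1..n} \<rightarrow>\<^sub>E {..<m}. respects_arcs S n c}) \<le> real m ^ n"
    by (metis of_nat_le_iff of_nat_power)
  then show ?thesis
    unfolding arcs_prob_colourings[OF S True m] norm_of_real using m by simp
qed (simp add: arcs_prob_def)

text \<open>Averaging over the number of urns turns colourings into uniform partitions. For
  incompatible arcs both sides are zero, because two arcs of one partition that share a start or an
  end coincide.\<close>

lemma arcs_prob_sums:
  assumes S: "S \<subseteq> arc_indices n" and n: "n \<ge> 1"
  shows "(\<lambda>m. of_real (urn_law n m) * arcs_prob n S (of_nat m)) sums
    of_real (real (card {P. partition_on {1..n} P \<and> (\<forall>(i, j)\<in>S. has_arc P i j)}) / bell n)"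
proof (cases "compatible_arcs S")
  case True
  define Q where "Q = {P. partition_on {1..n} P \<and> (\<forall>(i, j)\<in>S. has_arc P i j)}"
  have "{c \<in> {1..n} \<rightarrow>\<^sub>E {..<m}. colour_kernel n c \<in> Q} = {c \<in> {1..n} \<rightarrow>\<^sub>E {..<m}. respects_arcs S n c}" for m
    using partition_on_colour_kernel respects_arcs_iff_has_arc[OF S] by (auto simp: Q_def)
  then have "(\<lambda>m. real (card {c \<in> {1..n} \<rightarrow>\<^sub>E {..<m}. respects_arcs S n c}) / fact m) sums (exp 1 * real (card Q))"
    using dobinski[of Q n] by (auto simp: Q_def)
  then have "(\<lambda>m. real (card {c \<in> {1..n} \<rightarrow>\<^sub>E {..<m}. respects_arcs S n c}) / fact m * (1 / (exp 1 * bell n)))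
      sums (exp 1 * real (card Q) * (1 / (exp 1 * bell n)))"
    by (rule sums_mult2)
  then have "(\<lambda>m. complex_of_real (real (card {c \<in> {1..n} \<rightarrow>\<^sub>E {..<m}. respects_arcs S n c}) / fact m * (1 / (exp 1 * bell n))))
      sums of_real (exp 1 * real (card Q) * (1 / (exp 1 * bell n)))"
    by (rule sums_of_real)
  moreover have "complex_of_real (real (card {c \<in> {1..n} \<rightarrow>\<^sub>E {..<m}. respects_arcs S n c}) / fact m * (1 / (exp 1 * bell n)))
      = of_real (urn_law n m) * arcs_prob n S (of_nat m)" for m
  \<comment> \<open>Division by zero gives \<open>arcs_prob\<close> a default value at 0, which the
    zero mass of \<open>urn_law\<close> there suppresses.\<close>
  proof (cases "m = 0")
    case True
    have "{1..n} \<rightarrow>\<^sub>E {..<0::nat} = {}" using n by (auto simp: PiE_eq_empty_iff)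
    then show ?thesis using True n by (simp add: urn_law_def)
  next
    case False
    then show ?thesis
      unfolding of_real_mult[symmetric]
      by (subst arcs_prob_colourings[OF S \<open>compatible_arcs S\<close>])
        (auto simp: urn_law_def field_simps simp del: of_real_mult simp flip: of_real_mult of_real_divide)
  qed
  ultimately show ?thesis using bell_pos[of n] by (simp add: Q_def)
next
  case False
  have e: "{P. partition_on {1..n} P \<and> (\<forall>(i, j)\<in>S. has_arc P i j)} = {}"
  proof (rule ccontr)
    assume "\<not> ?thesis"
    then obtain P where P: "partition_on {1..n} P" "\<forall>(i, j)\<in>S. has_arc P i j" by blast
    have "a = b" if "a \<in> S" "b \<in> S" "fst a = fst b \<or> snd a = snd b" for a b
    proof -
      have "has_arc P (fst a) (snd a)" "has_arc P (fst b) (snd b)" using P(2) that by auto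
      from has_arc_functional[OF P(1) this] that(3) show ?thesis by (auto simp: prod_eq_iff)
    qed
    then have "compatible_arcs S" unfolding compatible_arcs_def inj_on_def by blast
    with False show False by simp
  qed
  show ?thesis unfolding e using False by (simp add: arcs_prob_def)
qed

lemma expectation_arcs:
  assumes B: "finite B" "a ` B \<subseteq> arc_indices n"
  shows "(\<integral>P. (\<Prod>i\<in>B. arc_var (a i) P) \<partial>measure_pmf (random_set_partition n))
    = real (card {P. partition_on {1..n} P \<and> (\<forall>(i, j)\<in>a ` B. has_arc P i j)}) / bell n"
proof -
  have fin: "finite {P. partition_on {1..n::nat} P}" by (rule finitely_many_partition_on) simp
  have ne: "{P. partition_on {1..n::nat} P} \<noteq> {}" 
  proof
    assume "{P. partition_on {1..n::nat} P} = {}"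
    then have "bell n = 0" unfolding bell_def by (simp only: card.empty)
    then show False using bell_pos[of n] by simp
  qed
  have "(\<Prod>i\<in>B. arc_var (a i) P) = (if \<forall>(i, j)\<in>a ` B. has_arc P i j then 1 else 0)" for P
    using B(1)
  proof (induction B rule: finite_induct)
    case (insert x F)
    obtain i j where "a x = (i, j)" by fastforce
    then show ?case using insert by (simp add: arc_var_def)
  qed simp
  then have "(\<integral>P. (\<Prod>i\<in>B. arc_var (a i) P) \<partial>measure_pmf (random_set_partition n))
      = (\<Sum>P | partition_on {1..n} P. if \<forall>(i, j)\<in>a ` B. has_arc P i j then 1 else 0) / bell n"
    unfolding random_set_partition_def bell_def by (simp only: integral_pmf_of_set[OF ne fin])
  also have "(\<Sum>P | partition_on {1..n} P. if \<forall>(i, j)\<in>a ` B. has_arc P i j then 1 else (0::real))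
      = real (card {P \<in> {P. partition_on {1..n} P}. \<forall>(i, j)\<in>a ` B. has_arc P i j})"
    by (subst sum.inter_filter[OF fin, symmetric]) simp
  finally show ?thesis by simp
qed

section \<open>Touchard polynomials and the generating functions of the urn law\<close>

fun touchard :: "nat \<Rightarrow> complex poly" where
  "touchard 0 = 1"
| "touchard (Suc n) = [:0, 1:] * (touchard n + pderiv (touchard n))"

text \<open>Multiplying the coefficients by \<open>m\<close> means applying
  \<open>u * d / du\<close>. Applied to \<open>exp u * T u\<close> this yields
  \<open>exp u * u * (T u + T' u)\<close>, which is the recursion for
  \<open>touchard\<close>.\<close>

lemma touchard_sums: "(\<lambda>m. of_nat m ^ n / fact m * u ^ m) sums (exp u * poly (touchard n) u)"
proof (induction n arbitrary: u)
  case 0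
  show ?case using exp_converges[of u] by (simp add: scaleR_conv_of_real field_simps)
next
  case (Suc n)
  define c where "c = (\<lambda>m. of_nat m ^ n / fact m :: complex)"
  have sm: "summable (\<lambda>m. c m * y ^ m)" for y
    using Suc.IH[of y] by (simp add: c_def sums_summable)
  have "(\<lambda>x. \<Sum>m. c m * x ^ m) = (\<lambda>x. exp x * poly (touchard n) x)"
    using Suc.IH by (intro ext sums_unique[symmetric]) (simp add: c_def)
  moreover have "((\<lambda>x. exp x * poly (touchard n) x) has_field_derivative
      (exp u * (poly (touchard n) u + poly (pderiv (touchard n)) u))) (at u)"
    by (auto intro!: derivative_eq_intros simp: algebra_simps)
  moreover have "((\<lambda>x. \<Sum>m. c m * x ^ m) has_field_derivative (\<Sum>m. diffs c m * u ^ m)) (at u)"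
    by (rule termdiffs_strong_converges_everywhere[OF sm])
  ultimately have "(\<Sum>m. diffs c m * u ^ m) = exp u * (poly (touchard n) u + poly (pderiv (touchard n)) u)"
    by (metis DERIV_unique)
  then have "(\<lambda>m. diffs c m * u ^ m) sums (exp u * (poly (touchard n) u + poly (pderiv (touchard n)) u))"
    using summable_sums[OF termdiff_converges_all[OF sm, of u]] by simp
  then have "(\<lambda>m. u * (diffs c m * u ^ m)) sums (u * (exp u * (poly (touchard n) u + poly (pderiv (touchard n)) u)))"
    by (rule sums_mult)
  moreover have "u * (diffs c m * u ^ m) = of_nat (Suc m) ^ Suc n / fact (Suc m) * u ^ Suc m" for m
    by (simp add: diffs_def c_def del: fact_Suc)
  ultimately have "(\<lambda>m. of_nat (Suc m) ^ Suc n / fact (Suc m) * u ^ Suc m) sums (exp u * poly (touchard (Suc n)) u)"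
    by (simp add: algebra_simps del: fact_Suc)
  then show ?case by (subst (asm) sums_Suc_iff) simp
qed

lemma prod_linear_poly:
  fixes A :: "complex multiset"
  shows "lead_coeff (\<Prod>x\<in>#A. [:-x, 1:]) = 1" "degree (\<Prod>x\<in>#A. [:-x, 1:]) = size A"
    "(\<Prod>x\<in>#A. [:-x, 1:]) \<noteq> 0"
    "poly (\<Prod>x\<in>#A. [:-x, 1:]) z = (\<Prod>x\<in>#A. z - x)"
proof -
  show 1: "lead_coeff (\<Prod>x\<in>#A. [:-x, 1:]) = 1" for A :: "complex multiset"
    by (induction A) (simp_all add: lead_coeff_mult del: mult_pCons_left)
  show 2: "(\<Prod>x\<in>#A. [:-x, 1:]) \<noteq> 0" for A :: "complex multiset"
    using 1[of A] by auto
  show "degree (\<Prod>x\<in>#A. [:-x, 1:]) = size A"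
  proof (induction A)
    case (add x A)
    have "degree ([:-x, 1:] * (\<Prod>x\<in>#A. [:-x, 1:])) = degree [:-x, 1:] + degree (\<Prod>x\<in>#A. [:-x, 1:])"
      using 2[of A] by (intro degree_mult_eq) auto
    then show ?case using add by (simp del: mult_pCons_left)
  qed simp
  show "poly (\<Prod>x\<in>#A. [:-x, 1:]) z = (\<Prod>x\<in>#A. z - x)"
    by (induction A) (simp_all add: algebra_simps)
qed

lemma Re_log_derivative_nonneg:
  fixes A :: "complex multiset"
  assumes "\<forall>x\<in>#A. Re x \<le> 0" "Re z > 0"
  defines "p \<equiv> (\<Prod>x\<in>#A. [:-x, 1:])"
  shows "poly p z \<noteq> 0 \<and> 0 \<le> Re (poly (pderiv p) z / poly p z)"
  unfolding p_def using assms(1)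
proof (induction A)
  case empty
  then show ?case by simp
next
  case (add x A)
  define q where "q = (\<Prod>x\<in>#A. [:-x, 1:])"
  have q: "poly q z \<noteq> 0" "0 \<le> Re (poly (pderiv q) z / poly q z)" using add by (auto simp: q_def)
  have zx: "Re (z - x) > 0" using add.prems assms(2) by auto
  then have zx0: "z - x \<noteq> 0" by auto
  have eq: "(\<Prod>x\<in>#add_mset x A. [:-x, 1:]) = [:-x, 1:] * q" by (simp add: q_def)
  have d: "poly (pderiv ([:-x, 1:] * q)) z = (z - x) * poly (pderiv q) z + poly q z"
    unfolding pderiv_mult by (simp add: pderiv_pCons algebra_simps)
  have p: "poly ([:-x, 1:] * q) z = (z - x) * poly q z"
    unfolding poly_mult by simp
  have "poly (pderiv ([:-x, 1:] * q)) z / poly ([:-x, 1:] * q) z = poly (pderiv q) z / poly q z + 1 / (z - x)"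
    unfolding d p using zx0 q(1) by (simp add: field_simps)
  moreover have "0 \<le> Re (1 / (z - x))" using zx by (simp add: Re_divide)
  ultimately show ?case unfolding eq using q zx0 p by simp
qed

text \<open>
  The Touchard polynomials have no roots in the open right half-plane: there \<open>p' / p\<close> is a sum of
  numbers \<open>1 / (z - x)\<close> with positive real part, so it is not \<open>-1\<close>.
\<close>

lemma touchard_factorization:
  "\<exists>A. size A = n \<and> (\<forall>x\<in>#A. Re x \<le> 0) \<and> touchard n = (\<Prod>x\<in>#A. [:-x, 1:])"
proof (induction n)
  case 0
  show ?case by (rule exI[of _ "{#}"]) simp
next
  case (Suc n)
  then obtain A where A: "size A = n" "\<forall>x\<in>#A. Re x \<le> 0" "touchard n = (\<Prod>x\<in>#A. [:-x, 1:])" by blast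
  define p where "p = touchard n"
  define q where "q = p + pderiv p"
  have p: "lead_coeff p = 1" "degree p = n"
    using prod_linear_poly[of A] A by (simp_all add: p_def)
  have q: "lead_coeff q = 1 \<and> degree q = n"
  proof (cases "n = 0")
    case True
    then have "pderiv p = 0" using p by (simp add: pderiv_eq_0_iff)
    then show ?thesis using p by (simp add: q_def)
  next
    case False
    then have "degree (pderiv p) < degree p" using p by (simp add: degree_pderiv)
    then show ?thesis using p degree_add_eq_left[of "pderiv p" p]
      by (auto simp: q_def coeff_eq_0)
  qed
  then have "q \<noteq> 0" by auto
  then obtain B where B: "size B = degree q" "q = smult (lead_coeff q) (\<Prod>x\<in>#B. [:-x, 1:])"
    using alg_closed_imp_factorization[of q] by auto
  then have qB: "q = (\<Prod>x\<in>#B. [:-x, 1:])" using q by (metis smult_1_left)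
  have "Re x \<le> 0" if "x \<in># B" for x
  proof (rule ccontr)
    assume x: "\<not> Re x \<le> 0"
    have "poly q x = 0"
      unfolding qB prod_linear_poly(4) using that by (auto simp: prod_mset_zero_iff)
    moreover have px: "poly p x \<noteq> 0" "0 \<le> Re (poly (pderiv p) x / poly p x)"
      using Re_log_derivative_nonneg[OF A(2), of x] x A(3) by (simp_all add: p_def)
    ultimately have "poly (pderiv p) x / poly p x = -1"
      by (simp add: q_def field_simps eq_neg_iff_add_eq_0 add.commute)
    then show False using px by simp
  qed
  moreover have "touchard (Suc n) = (\<Prod>x\<in>#add_mset 0 B. [:-x, 1:])"
    using qB by (simp add: q_def p_def)
  ultimately show ?case
    using B(1) q by (intro exI[of _ "add_mset 0 B"]) auto
qed

text \<open>A root \<open>x\<close> of the Touchard polynomial becomes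
  \<open>q = 1 / (1 - x)\<close>, because \<open>(u - x) / (1 - x) = 1 + q * (u - 1)\<close>. As
  \<open>1 - x\<close> has real part at least 1, \<open>q\<close> lies in the unit disc. This
  uniform bound on all \<open>n\<close> factors is what the location of the roots is needed
  for.\<close>

lemma urn_law_mgf:
  "\<exists>A :: complex multiset. size A = n \<and> (\<forall>q\<in>#A. norm q \<le> 1) \<and>
    (\<forall>v. (\<lambda>m. of_real (urn_law n m) * exp (v * of_nat m)) sums
      (exp (exp v - 1) * (\<Prod>q\<in>#A. 1 + q * (exp v - 1))))"
proof -
  obtain A where A: "size A = n" "\<forall>x\<in>#A. Re x \<le> 0" "touchard n = (\<Prod>x\<in>#A. [:-x, 1:])"
    using touchard_factorization by blast
  have one: "Re (1 - x) \<ge> 1" "1 - x \<noteq> 0" if "x \<in># A" for x using A(2) that by auto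
  have T1: "poly (touchard n) 1 \<noteq> 0"
    using Re_log_derivative_nonneg[OF A(2), of 1] A(3) by simp
  have e1: "exp 1 * poly (touchard n) 1 = of_real (exp 1 * bell n)"
  proof (rule sums_unique2)
    show "(\<lambda>m. of_real (real m ^ n / fact m)) sums (complex_of_real (exp 1 * bell n))"
      by (intro sums_of_real powers_over_fact_sums)
    show "(\<lambda>m. of_real (real m ^ n / fact m)) sums (exp 1 * poly (touchard n) 1)"
      using touchard_sums[of n 1] by simp
  qed
  have "(\<lambda>m. of_real (urn_law n m) * exp (v * of_nat m)) sums
      (exp (exp v - 1) * (\<Prod>x\<in>#A. 1 + 1 / (1 - x) * (exp v - 1)))" for v
  proof -
    have "(\<lambda>m. of_nat m ^ n / fact m * exp v ^ m * (1 / of_real (exp 1 * bell n))) sums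
        (exp (exp v) * poly (touchard n) (exp v) * (1 / of_real (exp 1 * bell n)))"
      by (intro sums_mult2 touchard_sums)
    moreover have "of_nat m ^ n / fact m * exp v ^ m * (1 / of_real (exp 1 * bell n))
        = of_real (urn_law n m) * exp (v * of_nat m)" for m
      by (simp add: urn_law_def exp_of_nat2_mult mult.commute)
    moreover have "exp (exp v) * poly (touchard n) (exp v) * (1 / of_real (exp 1 * bell n))
        = exp (exp v - 1) * (poly (touchard n) (exp v) / poly (touchard n) 1)"
      unfolding e1[symmetric] using T1 by (simp add: exp_diff field_simps)
    moreover have "poly (touchard n) (exp v) / poly (touchard n) 1 = (\<Prod>x\<in>#A. 1 + 1 / (1 - x) * (exp v - 1))"
    proof -
      have "(\<Prod>x\<in>#A. w - x) / (\<Prod>x\<in>#A. 1 - x) = (\<Prod>x\<in>#A. 1 + 1 / (1 - x) * (w - 1))" for w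
        using one
      proof (induction A)
        case (add x A)
        have "1 - x \<noteq> 0" using add.prems by auto
        then have "(w - x) / (1 - x) = 1 + 1 / (1 - x) * (w - 1)" by (simp add: field_simps)
        then show ?case using add by (simp add: times_divide_times_eq[symmetric])
      qed simp
      then show ?thesis unfolding A(3) prod_linear_poly(4) by simp
    qed
    ultimately show ?thesis by simp
  qed
  moreover have "norm (1 / (1 - x)) \<le> 1" if "x \<in># A" for x
  proof -
    have "1 \<le> norm (1 - x)" using one(1)[OF that] complex_Re_le_cmod[of "1 - x"] by simp
    then show ?thesis using frac_le[of 1 1 1 "norm (1 - x)"] by (simp add: norm_divide)
  qed
  ultimately show ?thesis
    using A(1) by (intro exI[of _ "image_mset (\<lambda>x. 1 / (1 - x)) A"]) (auto simp: multiset.map_comp o_def)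
qed

lemma norm_exp_minus_1_le_third:
  fixes v :: complex
  assumes "norm v \<le> 1 / 4"
  shows "norm (exp v - 1) \<le> 1 / 3"
proof -
  have s: "(\<lambda>n. v ^ Suc n /\<^sub>R fact (Suc n)) sums (exp v - 1)"
    using exp_converges[of v] by (subst sums_Suc_iff) simp
  have t: "(\<lambda>n. 1 / 4 * (1 / 4) ^ n) sums (1 / 4 * (1 / (1 - 1 / 4 :: real)))"
    by (intro sums_mult geometric_sums) simp
  have "norm (exp v - 1) \<le> 1 / 4 * (1 / (1 - 1 / 4 :: real))"
  proof (rule norm_sums_le[OF s t])
    fix n
    have c: "1 \<le> (fact (Suc n) :: real)" by (rule fact_ge_1)
    have b: "norm v ^ Suc n \<le> (1 / 4) ^ Suc n" by (intro power_mono assms) simp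
    have a: "0 \<le> (1 / 4 :: real) ^ Suc n" by simp
    have "norm v ^ Suc n / fact (Suc n) \<le> (1 / 4) ^ Suc n / 1"
      by (rule frac_le[OF a b zero_less_one c])
    moreover have "norm (v ^ Suc n /\<^sub>R fact (Suc n)) = norm v ^ Suc n / fact (Suc n)"
      by (simp add: norm_power divide_inverse_commute del: fact_Suc power_Suc)
    ultimately show "norm (v ^ Suc n /\<^sub>R fact (Suc n)) \<le> 1 / 4 * (1 / 4) ^ n"
      by (simp only: power_Suc[symmetric] div_by_1)
  qed
  then show ?thesis by simp
qed

text \<open>The radius 1/4 keeps every \<open>q * (exp v - 1)\<close> within 1/3 of zero, so the
  principal logarithm of each factor is holomorphic and of norm at most 1. The bound counts 1 for
  each of the \<open>n\<close> factors and 1 for \<open>exp v - 1\<close>.\<close>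

lemma urn_law_cgf:
  "\<exists>\<Phi>. \<Phi> holomorphic_on cball 0 (1 / 4) \<and> \<Phi> 0 = 0 \<and>
    (\<forall>v\<in>cball 0 (1 / 4). norm (\<Phi> v) \<le> real n + 1 \<and>
      (\<lambda>m. of_real (urn_law n m) * exp (v * of_nat m)) sums exp (\<Phi> v))"
proof -
  obtain A :: "complex multiset" where A: "size A = n" "\<forall>q\<in>#A. norm q \<le> 1" and
    mgf: "\<And>v. (\<lambda>m. of_real (urn_law n m) * exp (v * of_nat m)) sums
      (exp (exp v - 1) * (\<Prod>q\<in>#A. 1 + q * (exp v - 1)))"
    using urn_law_mgf[of n] by blast
  define \<Phi> where "\<Phi> = (\<lambda>v. exp v - 1 + (\<Sum>q\<in>#A. Ln (1 + q * (exp v - 1))))"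
  have small: "norm (q * (exp v - 1)) \<le> 1 / 3" if "q \<in># A" "v \<in> cball 0 (1 / 4)" for q v
  proof -
    have "norm q * norm (exp v - 1) \<le> 1 * (1 / 3)"
      using that A(2) by (intro mult_mono norm_exp_minus_1_le_third) auto
    then show ?thesis by (simp add: norm_mult)
  qed
  have nonpos: "1 + w \<notin> \<real>\<^sub>\<le>\<^sub>0" "1 + w \<noteq> 0" "norm (Ln (1 + w)) \<le> 1" if "norm w \<le> 1 / 3" for w :: complex
  proof -
    have "Re (1 + w) > 0" using that abs_Re_le_cmod[of w] by (simp add: abs_le_iff)
    then show "1 + w \<notin> \<real>\<^sub>\<le>\<^sub>0" by (auto simp: complex_nonpos_Reals_iff)
    then show "1 + w \<noteq> 0" by auto
    show "norm (Ln (1 + w)) \<le> 1" using norm_Ln_le[of w] that by simp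
  qed
  have "(\<lambda>v. \<Sum>q\<in>#B. Ln (1 + q * (exp v - 1))) holomorphic_on cball 0 (1 / 4)" if "B \<subseteq># A" for B
    using that
  proof (induction B)
    case (add q B)
    then have q: "q \<in># A" "B \<subseteq># A"
      by (auto dest: mset_subset_eq_insertD intro: subset_mset.less_imp_le)
    have "(\<lambda>v. Ln (1 + q * (exp v - 1))) holomorphic_on cball 0 (1 / 4)"
      by (intro holomorphic_intros nonpos(1) small q)
    then show ?case using add.IH[OF q(2)] by (auto intro: holomorphic_intros)
  qed (auto intro: holomorphic_intros)
  then have "\<Phi> holomorphic_on cball 0 (1 / 4)"
    unfolding \<Phi>_def by (auto intro!: holomorphic_intros)
  moreover have "\<Phi> 0 = 0" by (simp add: \<Phi>_def)
  moreover have "norm (\<Phi> v) \<le> real n + 1" if v: "v \<in> cball 0 (1 / 4)" for v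
  proof -
    have "norm (\<Sum>q\<in>#B. Ln (1 + q * (exp v - 1))) \<le> size B" if "set_mset B \<subseteq> set_mset A" for B
      using that
    proof (induction B)
      case (add q B)
      then have "norm (Ln (1 + q * (exp v - 1))) \<le> 1" by (intro nonpos(3) small v) auto
      then show ?case using add norm_triangle_mono by fastforce
    qed simp
    then have "norm (\<Sum>q\<in>#A. Ln (1 + q * (exp v - 1))) \<le> n" using A(1) by blast
    moreover have "norm (exp v - 1) \<le> 1" using norm_exp_minus_1_le_third[of v] v by simp
    ultimately show ?thesis unfolding \<Phi>_def using norm_triangle_mono by fastforce
  qed
  moreover have "exp (\<Phi> v) = exp (exp v - 1) * (\<Prod>q\<in>#A. 1 + q * (exp v - 1))" if v: "v \<in> cball 0 (1 / 4)" for v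
  proof -
    have "exp (\<Sum>q\<in>#B. Ln (1 + q * (exp v - 1))) = (\<Prod>q\<in>#B. 1 + q * (exp v - 1))" if "set_mset B \<subseteq> set_mset A" for B
      using that
    proof (induction B)
      case (add q B)
      then have "exp (Ln (1 + q * (exp v - 1))) = 1 + q * (exp v - 1)"
        by (intro exp_Ln nonpos(2) small v) auto
      then show ?case using add by (simp add: exp_add)
    qed simp
    then show ?thesis by (simp add: \<Phi>_def exp_add)
  qed
  ultimately show ?thesis using mgf by (intro exI[of _ \<Phi>]) auto
qed

text \<open>The growth condition says that the weights at least double from \<open>m\<close> to
  \<open>m + 1\<close>, for every \<open>m\<close> from 1 to \<open>k\<close>. So the mass up to
  \<open>k\<close> is at most half the mass of the range shifted by one; there is no mass at
  0.\<close>

lemma urn_law_lower_tail: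
  assumes n: "n \<ge> 1" and growth: "\<And>m. 1 \<le> m \<Longrightarrow> m \<le> k \<Longrightarrow> 2 * (real m + 1) * real m ^ n \<le> (real m + 1) ^ n"
  shows "(\<Sum>m\<le>k. urn_law n m) \<le> 1 / 2"
proof -
  have fin: "sum (urn_law n) K \<le> 1" if "finite K" for K
  proof -
    have "sum (urn_law n) K \<le> suminf (urn_law n)"
      by (rule sum_le_suminf[OF sums_summable[OF urn_law_sums] that]) (rule urn_law_nonneg)
    also have "\<dots> = 1" by (rule sums_unique[OF urn_law_sums, symmetric])
    finally show ?thesis .
  qed
  have step: "urn_law n m \<le> urn_law n (Suc m) / 2" if m: "1 \<le> m" "m \<le> k" for m
  proof -
    have "2 * (real m + 1) * real m ^ n / ((real m + 1) * fact m) \<le> (real m + 1) ^ n / ((real m + 1) * fact m)"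
      by (intro divide_right_mono growth m) simp
    moreover have "real m + 1 \<noteq> 0" by linarith
    then have "2 * (real m + 1) * real m ^ n / ((real m + 1) * fact m) = 2 * (real m ^ n / fact m)"
      by (simp add: divide_simps)
    moreover have "(real m + 1) * fact m = fact (Suc m)" by (simp add: add.commute)
    ultimately have "2 * (real m ^ n / fact m) \<le> (real m + 1) ^ n / fact (Suc m)"
      by metis
    then have "real m ^ n / fact m \<le> (real m + 1) ^ n / fact (Suc m) / 2"
      by (simp del: fact_Suc)
    then have "real m ^ n / fact m / (exp 1 * bell n) \<le> (real m + 1) ^ n / fact (Suc m) / 2 / (exp 1 * bell n)"
      by (intro divide_right_mono) auto
    then show ?thesis by (simp add: urn_law_def mult_ac add.commute del: fact_Suc)
  qed
  have "(\<Sum>m\<le>k. urn_law n m) = (\<Sum>m\<in>{1..k}. urn_law n m)"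
    by (rule sum.mono_neutral_right) (use n in \<open>auto simp: urn_law_def not_le\<close>)
  also have "\<dots> \<le> (\<Sum>m\<in>{1..k}. urn_law n (Suc m) / 2)"
    by (intro sum_mono step) auto
  also have "\<dots> = (\<Sum>m\<in>Suc ` {1..k}. urn_law n m) / 2"
    by (subst sum.reindex) (auto simp: sum_divide_distrib)
  also have "\<dots> \<le> 1 / 2" using fin[of "Suc ` {1..k}"] by simp
  finally show ?thesis .
qed

section \<open>Arc probabilities for a fixed number of urns\<close>

text \<open>One complex number \<open>z\<close> of urns is fixed. \<open>comp\<close> may be any
  labelling that is constant on arcs sharing a start or an end. In the application \<open>W\<close>
  is \<open>1 / n\<close> up to logarithms; the bound 1/8 keeps the arguments of all logarithms near
  1, and \<open>disc\<close> keeps a product of \<open>n\<close> factors below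
  \<open>exp 1\<close>.\<close>

context
  fixes n :: nat and a :: "nat \<Rightarrow> nat \<times> nat" and comp :: "nat \<Rightarrow> nat" and I :: "nat set"
    and z :: complex and W :: real
  assumes I: "finite I" "I \<noteq> {}" and a: "a ` I \<subseteq> arc_indices n" and n: "n \<ge> 1"
    and comp: "\<And>i i'. i \<in> I \<Longrightarrow> i' \<in> I \<Longrightarrow> fst (a i) = fst (a i') \<or> snd (a i) = snd (a i') \<Longrightarrow> comp i = comp i'"
    and z: "norm (inverse z) \<le> W" and W: "real (card I) * W \<le> 1 / 8" "W \<le> 1"
    and disc: "\<And>d. d \<le> card I \<Longrightarrow> norm (1 - of_nat d / z) \<le> 1 + 1 / real n"
begin

private definition section_of where "section_of S X = {i\<in>S. comp i \<in> X}"
private definition dep where "dep S p = arc_depth (a ` S) p"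
private definition ends where "ends S = snd ` a ` S"
private definition logprob where "logprob S = (\<Sum>p\<in>{1..n} - ends S. Ln (1 - of_nat (dep S p) / z))"
private definition coef where "coef S = (if compatible_arcs (a ` S) then inverse z ^ card (a ` S) else 0)"
text \<open>Moebius inversion over sets of components: the share of the log-probability that
  involves the components in \<open>D\<close> jointly. Singletons reproduce the log-probabilities of
  single components, which go into \<open>G\<close>.\<close>

private definition \<tau> where "\<tau> D S = (-1) ^ card D * (\<Sum>X\<in>Pow D. (-1) ^ card X * logprob (section_of S X))"
private definition G where "G S = coef S * exp (\<Sum>s\<in>comp ` I. logprob (section_of S {s}))"

private lemma W0: "0 \<le> W"
  using z norm_ge_zero order_trans by blast

private lemma section_sub: "S \<subseteq> I \<Longrightarrow> section_of S X \<subseteq> I"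
  by (auto simp: section_of_def)

private lemma dep_le: "S \<subseteq> I \<Longrightarrow> dep S p \<le> card I"
proof -
  assume S: "S \<subseteq> I"
  then have "finite S" using I finite_subset by blast
  then have "dep S p \<le> card (a ` S)" unfolding dep_def arc_depth_def by (intro card_mono) auto
  also have "\<dots> \<le> card S" using \<open>finite S\<close> by (rule card_image_le)
  also have "\<dots> \<le> card I" using I S by (intro card_mono)
  finally show ?thesis .
qed

private lemma dep_z: "S \<subseteq> I \<Longrightarrow> norm (of_nat (dep S p) / z) \<le> 1 / 8"
proof -
  assume S: "S \<subseteq> I"
  have "norm (of_nat (dep S p) / z) = real (dep S p) * norm (inverse z)"
    by (simp add: norm_mult norm_inverse divide_inverse)
  also have "\<dots> \<le> real (card I) * W"
    using dep_le[OF S, of p] z W0 by (intro mult_mono) auto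
  finally show ?thesis using W by simp
qed

private lemma one_minus: "norm x \<le> 1 / 4 \<Longrightarrow> 1 - x \<notin> \<real>\<^sub>\<le>\<^sub>0 \<and> 1 - x \<noteq> 0 \<and> norm (Ln (1 - x)) \<le> 1" for x :: complex
proof -
  assume x: "norm x \<le> 1 / 4"
  have "Re (1 - x) > 0" using x abs_Re_le_cmod[of x] by (simp add: abs_le_iff)
  then have "1 - x \<notin> \<real>\<^sub>\<le>\<^sub>0" "1 - x \<noteq> 0" by (auto simp: complex_nonpos_Reals_iff)
  moreover have "norm (Ln (1 - x)) \<le> 1" using norm_Ln_le[of "-x"] x by simp
  ultimately show ?thesis by simp
qed

private lemma exp_logprob:
  assumes S: "S \<subseteq> I"
  shows "exp (logprob S) = (\<Prod>p\<in>{1..n} - ends S. 1 - of_nat (dep S p) / z)"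
proof -
  have "exp (Ln (1 - of_nat (dep S p) / z)) = 1 - of_nat (dep S p) / z" for p
    using one_minus[of "of_nat (dep S p) / z"] dep_z[OF S, of p] by (intro exp_Ln) simp
  then show ?thesis unfolding logprob_def by (simp add: exp_sum)
qed

private lemma norm_exp_logprob:
  assumes S: "S \<subseteq> I"
  shows "norm (exp (logprob S)) \<le> exp 1"
proof -
  have "norm (exp (logprob S)) \<le> (\<Prod>p\<in>{1..n} - ends S. 1 + 1 / real n)"
    unfolding exp_logprob[OF S] prod_norm[symmetric]
    using disc[OF dep_le[OF S]] by (intro prod_mono) auto
  also have "\<dots> = (1 + 1 / real n) ^ card ({1..n} - ends S)" by simp
  also have "\<dots> \<le> (1 + 1 / real n) ^ n"
    using card_mono[of "{1..n}" "{1..n} - ends S"] by (intro power_increasing) auto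
  also have "\<dots> \<le> exp (1 / real n) ^ n" by (intro power_mono exp_ge_add_one_self) auto
  also have "\<dots> = exp 1" using n by (simp flip: exp_of_nat_mult)
  finally show ?thesis .
qed

private lemma logprob_empty: "logprob {} = 0"
  by (simp add: logprob_def dep_def arc_depth_def)

private lemma arcs_prob_eq:
  assumes S: "S \<subseteq> I"
  shows "arcs_prob n (a ` S) z = coef S * exp (logprob S)"
  unfolding exp_logprob[OF S] by (simp add: arcs_prob_def coef_def dep_def ends_def)

private lemma disjoint_arcs:
  assumes "S \<subseteq> I" "X \<inter> Y = {}"
  shows "a ` section_of S X \<inter> a ` section_of S Y = {}"
proof (rule ccontr)
  assume "a ` section_of S X \<inter> a ` section_of S Y \<noteq> {}"
  then obtain i j where ij: "i \<in> section_of S X" "j \<in> section_of S Y" "a i = a j" by blast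
  then have "comp i = comp j" using assms(1) by (intro comp) (auto simp: section_of_def)
  then show False using ij assms(2) by (auto simp: section_of_def)
qed

text \<open>Equal arcs have equal labels, so different components have disjoint sets of arcs even if
  the enumeration repeats arcs; hence depths add up.\<close>

private lemma dep_section:
  assumes S: "S \<subseteq> I" and X: "finite X"
  shows "dep (section_of S X) p = (\<Sum>s\<in>X. dep (section_of S {s}) p)"
proof -
  have finS: "finite S" using S I finite_subset by blast
  define E where "E = (\<lambda>T. {(i, j) \<in> a ` T. i < p \<and> p < j})"
  have "E (section_of S X) = (\<Union>s\<in>X. E (section_of S {s}))" by (auto simp: E_def section_of_def)
  then have "card (E (section_of S X)) = card (\<Union>s\<in>X. E (section_of S {s}))" by simp
  also have "\<dots> = (\<Sum>s\<in>X. card (E (section_of S {s})))"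
  proof (rule card_UN_disjoint[OF X])
    show "\<forall>s\<in>X. finite (E (section_of S {s}))"
      using finS by (auto simp: E_def section_of_def intro: finite_subset[of _ "a ` S"])
    show "\<forall>s\<in>X. \<forall>t\<in>X. s \<noteq> t \<longrightarrow> E (section_of S {s}) \<inter> E (section_of S {t}) = {}"
    proof (intro ballI impI)
      fix s t assume "s \<in> X" "t \<in> X" "s \<noteq> t"
      then have "a ` section_of S {s} \<inter> a ` section_of S {t} = {}" by (intro disjoint_arcs[OF S]) auto
      then show "E (section_of S {s}) \<inter> E (section_of S {t}) = {}" by (auto simp: E_def)
    qed
  qed
  finally show ?thesis by (simp add: E_def dep_def arc_depth_def)
qed

private lemma logprob_expansion:
  assumes S: "S \<subseteq> I"
  shows "logprob S = (\<Sum>s\<in>comp ` I. logprob (section_of S {s})) +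
    (\<Sum>D | D \<subseteq> comp ` I \<and> 2 \<le> card D. \<tau> D S)"
proof -
  define C where "C = comp ` I"
  have finC: "finite C" using I by (simp add: C_def)
  have "section_of S C = S" using S by (auto simp: section_of_def C_def)
  then have "logprob S = logprob (section_of S C)" by simp
  also have "\<dots> = (\<Sum>D\<in>Pow C. (-1) ^ card D * (\<Sum>X\<in>Pow D. (-1) ^ card X * logprob (section_of S X)))"
    by (rule inclusion_exclusion_symmetric[OF refl finC])
  also have "\<dots> = (\<Sum>D\<in>Pow C. \<tau> D S)" by (simp add: \<tau>_def)
  also have "Pow C = insert {} ((\<lambda>s. {s}) ` C) \<union> {D. D \<subseteq> C \<and> 2 \<le> card D}"
  proof -
    have "D = {} \<or> (\<exists>s\<in>C. D = {s})" if "D \<subseteq> C" "\<not> 2 \<le> card D" for D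
    proof -
      have "finite D" using that finC finite_subset by blast
      moreover have "card D = 0 \<or> card D = 1" using that by linarith
      ultimately show ?thesis using that(1) by (auto simp: card_1_singleton_iff)
    qed
    then show ?thesis by auto
  qed
  also have "(\<Sum>D\<in>insert {} ((\<lambda>s. {s}) ` C) \<union> {D. D \<subseteq> C \<and> 2 \<le> card D}. \<tau> D S)
      = (\<Sum>D\<in>insert {} ((\<lambda>s. {s}) ` C). \<tau> D S) + (\<Sum>D | D \<subseteq> C \<and> 2 \<le> card D. \<tau> D S)"
    by (rule sum.union_disjoint) (use finC in \<open>auto intro: finite_subset[of _ "Pow C"]\<close>)
  also have "(\<Sum>D\<in>insert {} ((\<lambda>s. {s}) ` C). \<tau> D S) = \<tau> {} S + (\<Sum>s\<in>C. \<tau> {s} S)"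
    using finC by (subst sum.insert) (auto simp: sum.reindex)
  also have "\<tau> {} S = 0" by (simp add: \<tau>_def section_of_def logprob_empty)
  also have "(\<Sum>s\<in>C. \<tau> {s} S) = (\<Sum>s\<in>C. logprob (section_of S {s}))"
  proof (rule sum.cong[OF refl])
    fix s :: nat
    have "Pow {s} = {{}, {s}}" by auto
    then show "\<tau> {s} S = logprob (section_of S {s})"
      by (simp add: \<tau>_def section_of_def logprob_empty)
  qed
  finally show ?thesis by (simp add: C_def)
qed

text \<open>Since depths are additive, this is an iterated difference of \<open>Ln (1 - x)\<close>
  with steps of total size at most \<open>card I * W\<close>. The 8 is 2 from counting subsets times
  4 from the radius 1/4.\<close>

private lemma alternating_Ln_bound:
  assumes S: "S \<subseteq> I" and D: "finite D"
  shows "norm (\<Sum>X\<in>Pow D. (-1) ^ card X * Ln (1 - of_nat (dep (section_of S X) p) / z))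
    \<le> 2 * (8 * (card I * W)) ^ card D"
proof -
  define b where "b = card I * W"
  define d where "d = (\<lambda>s. of_nat (dep (section_of S {s}) p) / z)"
  have "(\<Sum>X\<in>Pow D. (-1) ^ card X * Ln (1 - of_nat (dep (section_of S X) p) / z))
      = (\<Sum>X\<in>Pow D. (-1) ^ card X * Ln (1 - (\<Sum>s\<in>X. d s)))"
  proof (rule sum.cong[OF refl])
    fix X assume "X \<in> Pow D"
    then have fX: "finite X" using D finite_subset by auto
    show "(-1) ^ card X * Ln (1 - of_nat (dep (section_of S X) p) / z) = (-1) ^ card X * Ln (1 - (\<Sum>s\<in>X. d s))"
      using dep_section[OF S fX, of p] by (simp add: d_def sum_divide_distrib)
  qed
  also have "norm \<dots> \<le> 2 ^ (card D + 1) * 1 * (b / (1 / 4)) ^ card D"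
  proof (rule alternating_sum_holomorphic_bound[where f = "\<lambda>x. Ln (1 - x)" and R = "1 / 4"])
    show "(\<lambda>x. Ln (1 - x)) holomorphic_on cball 0 (1 / 4)"
      by (intro holomorphic_intros) (use one_minus in auto)
    show "norm (Ln (1 - y)) \<le> 1" if "y \<in> cball 0 (1 / 4)" for y using that one_minus by simp
    have "(\<Sum>s\<in>D. norm (d s)) = real (dep (section_of S D) p) * norm (inverse z)"
      using dep_section[OF S D, of p]
      by (simp add: d_def norm_mult norm_inverse divide_inverse sum_distrib_right)
    also have "\<dots> \<le> b"
      unfolding b_def using dep_le[OF section_sub[OF S]] z W0 by (intro mult_mono) auto
    finally show "(\<Sum>s\<in>D. norm (d s)) \<le> b" .
    show "b \<le> 1 / 4 / 2" using W by (simp add: b_def)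
  qed (use D in auto)
  also have "\<dots> = 2 * (8 * b) ^ card D"
  proof -
    have "(8 * b) ^ card D = 2 ^ card D * (b / (1 / 4)) ^ card D"
      by (simp only: power_mult_distrib[symmetric]) simp
    then show ?thesis by (simp only: power_add power_one_right mult_1_right mult_ac)
  qed
  finally show ?thesis by (simp add: b_def)
qed

text \<open>At a position that ends no arc, the components in \<open>D\<close> act through the depth
  only, which gives a difference of full order \<open>card D\<close>. A position \<open>p\<close>
  that ends an arc is missing from the product for the sets \<open>X\<close> containing the
  component of that arc; this costs one order, but there are at most \<open>card I\<close> such
  positions, against \<open>n\<close> in total.\<close>

private lemma \<tau>_bound:
  fixes b :: real
  assumes S: "S \<subseteq> I" and D: "D \<subseteq> comp ` I" "2 \<le> card D"
  defines "b \<equiv> 8 * (card I * W)"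
  shows "norm (\<tau> D S) \<le> 2 * (b * (b * n + card I)) ^ (card D - 1)"
proof -
  have finD: "finite D" using D I finite_subset by blast
  have b: "0 \<le> b" "b \<le> 1" using W W0 by (auto simp: b_def)
  define Z where "Z = (\<lambda>p. {s\<in>D. p \<in> ends (section_of S {s})})"
  define f where "f = (\<lambda>p X. (-1) ^ card X * Ln (1 - of_nat (dep (section_of S X) p) / z))"
  define l where "l = card D"
  have Zsub: "Z p \<subseteq> D" for p by (auto simp: Z_def)
  have ends_iff: "p \<notin> ends (section_of S X) \<longleftrightarrow> X \<subseteq> D - Z p" if "X \<in> Pow D" for p X
    using that by (auto simp: ends_def section_of_def Z_def)
  have Z1: "s = t" if "s \<in> Z p" "t \<in> Z p" for s t p
  proof -
    from that(1) obtain i where "i \<in> S" "comp i = s" "snd (a i) = p"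
      by (auto simp: Z_def ends_def section_of_def)
    moreover from that(2) obtain j where "j \<in> S" "comp j = t" "snd (a j) = p"
      by (auto simp: Z_def ends_def section_of_def)
    ultimately show ?thesis using comp[of i j] S by auto
  qed
  have swap: "(\<Sum>X\<in>Pow D. (-1) ^ card X * logprob (section_of S X))
      = (\<Sum>p\<in>{1..n}. \<Sum>X\<in>Pow (D - Z p). f p X)"
  proof -
    have "(-1) ^ card X * logprob (section_of S X) = (\<Sum>p\<in>{1..n}. if X \<subseteq> D - Z p then f p X else 0)"
      if X: "X \<in> Pow D" for X
    proof -
      have "{1..n} - ends (section_of S X) = {p\<in>{1..n}. X \<subseteq> D - Z p}" using ends_iff[OF X] by auto
      then show ?thesis
        by (simp only: logprob_def sum_distrib_left f_def sum.inter_filter[symmetric] finite_atLeastAtMost)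
    qed
    then have "(\<Sum>X\<in>Pow D. (-1) ^ card X * logprob (section_of S X))
        = (\<Sum>p\<in>{1..n}. \<Sum>X\<in>Pow D. if X \<subseteq> D - Z p then f p X else 0)"
      by (subst sum.swap) simp
    also have "\<dots> = (\<Sum>p\<in>{1..n}. \<Sum>X\<in>Pow (D - Z p). f p X)"
    proof (rule sum.cong[OF refl])
      fix p
      have "{X\<in>Pow D. X \<subseteq> D - Z p} = Pow (D - Z p)" by auto
      then show "(\<Sum>X\<in>Pow D. if X \<subseteq> D - Z p then f p X else 0) = (\<Sum>X\<in>Pow (D - Z p). f p X)"
        using sum.inter_filter[of "Pow D" "f p" "\<lambda>X. X \<subseteq> D - Z p"] finD by simp
    qed
    finally show ?thesis .
  qed
  have each: "norm (\<Sum>X\<in>Pow (D - Z p). f p X) \<le> 2 * b ^ l + (if Z p = {} then 0 else 2 * b ^ (l - 1))" for p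
  proof (cases "Z p = {}")
    case True
    then show ?thesis using alternating_Ln_bound[OF S finD, of p] by (simp add: f_def b_def l_def)
  next
    case False
    then obtain s where "Z p = {s}" using Z1 by blast
    moreover from this have "s \<in> D" using Zsub by blast
    ultimately have "card (D - Z p) = l - 1" using finD by (simp add: l_def)
    then have "norm (\<Sum>X\<in>Pow (D - Z p). f p X) \<le> 2 * b ^ (l - 1)"
      using alternating_Ln_bound[OF S, of "D - Z p" p] finD by (simp add: f_def b_def)
    moreover have "0 \<le> b ^ l" using b by simp
    ultimately show ?thesis using False by simp
  qed
  have cardZ: "card {p\<in>{1..n}. Z p \<noteq> {}} \<le> card I"
  proof -
    have "{p\<in>{1..n}. Z p \<noteq> {}} \<subseteq> (\<lambda>i. snd (a i)) ` I"
      using S by (auto simp: Z_def ends_def section_of_def)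
    then have "card {p\<in>{1..n}. Z p \<noteq> {}} \<le> card ((\<lambda>i. snd (a i)) ` I)"
      using I by (intro card_mono) auto
    also have "\<dots> \<le> card I" using I(1) by (rule card_image_le)
    finally show ?thesis .
  qed
  have "norm (\<tau> D S) = norm (\<Sum>p\<in>{1..n}. \<Sum>X\<in>Pow (D - Z p). f p X)"
    by (simp add: \<tau>_def swap norm_mult norm_power)
  also have "\<dots> \<le> (\<Sum>p\<in>{1..n}. 2 * b ^ l + (if Z p = {} then 0 else 2 * b ^ (l - 1)))"
    by (intro sum_norm_le each)
  also have "\<dots> = n * (2 * b ^ l) + card {p\<in>{1..n}. Z p \<noteq> {}} * (2 * b ^ (l - 1))"
  proof -
    have "(\<Sum>p\<in>{1..n}. if Z p = {} then 0 else 2 * b ^ (l - 1))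
        = (\<Sum>p\<in>{p\<in>{1..n}. Z p \<noteq> {}}. 2 * b ^ (l - 1))"
      by (subst sum.inter_filter) (auto intro: sum.cong)
    then show ?thesis by (simp add: sum.distrib)
  qed
  also have "\<dots> \<le> n * (2 * b ^ l) + card I * (2 * b ^ (l - 1))"
    using cardZ b by (intro add_mono mult_right_mono) auto
  also have "\<dots> = 2 * b ^ (l - 1) * (b * n + card I)"
  proof -
    have "b ^ l = b * b ^ (l - 1)" using D by (simp add: l_def flip: power_Suc)
    then show ?thesis by (simp add: algebra_simps)
  qed
  \<comment> \<open>The surplus factor is at least 1 and \<open>l\<close> is at least 2, so it can
    be raised to the power that the cluster bound asks for.\<close>
  also have "\<dots> \<le> 2 * b ^ (l - 1) * (b * n + card I) ^ (l - 1)"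
  proof (intro mult_left_mono)
    have "1 \<le> card I" using I by (simp add: card_gt_0_iff Suc_le_eq)
    then have "1 \<le> b * n + card I" using b by (simp add: add_increasing)
    then show "b * n + card I \<le> (b * n + card I) ^ (l - 1)"
      using D by (intro self_le_power) (auto simp: l_def)
  qed (use b in auto)
  finally show ?thesis by (simp add: l_def power_mult_distrib mult_ac)
qed

text \<open>Compatibility splits because arcs with different labels share neither start nor end; the
  power of \<open>inverse z\<close> splits because the sets of arcs are disjoint.\<close>

private lemma G_mult:
  assumes S: "S \<subseteq> I"
  shows "G S = G {i\<in>S. comp i \<in> A} * G {i\<in>S. comp i \<notin> A}"
proof -
  have finS: "finite S" using S I finite_subset by blast
  define S1 where "S1 = section_of S A"
  define S2 where "S2 = section_of S (- A)"
  have un: "a ` S = a ` S1 \<union> a ` S2" by (auto simp: S1_def S2_def section_of_def)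
  have dis: "a ` S1 \<inter> a ` S2 = {}" unfolding S1_def S2_def by (rule disjoint_arcs[OF S]) auto
  have cross: "fst x \<noteq> fst y \<and> snd x \<noteq> snd y" if xy: "x \<in> a ` S1" "y \<in> a ` S2" for x y
  proof -
    obtain i j where ij: "i \<in> S1" "j \<in> S2" "x = a i" "y = a j" using xy by blast
    then have "i \<in> I" "j \<in> I" "comp i \<noteq> comp j" using S by (auto simp: S1_def S2_def section_of_def)
    then show ?thesis using comp[of i j] ij by auto
  qed
  have comp_iff: "compatible_arcs (a ` S) \<longleftrightarrow> compatible_arcs (a ` S1) \<and> compatible_arcs (a ` S2)"
    unfolding compatible_arcs_def un inj_on_Un using cross by blast
  have "card (a ` S) = card (a ` S1) + card (a ` S2)"
    unfolding un using dis finS by (intro card_Un_disjoint) (auto simp: S1_def S2_def section_of_def)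
  then have coef: "coef S = coef S1 * coef S2"
    unfolding coef_def using comp_iff by (simp add: power_add)
  have "logprob (section_of S {s}) = logprob (section_of S1 {s}) + logprob (section_of S2 {s})" for s
  proof (cases "s \<in> A")
    case True
    then have "section_of S1 {s} = section_of S {s}" "section_of S2 {s} = {}" by (auto simp: S1_def S2_def section_of_def)
    then show ?thesis by (simp add: logprob_empty)
  next
    case False
    then have "section_of S2 {s} = section_of S {s}" "section_of S1 {s} = {}" by (auto simp: S1_def S2_def section_of_def)
    then show ?thesis by (simp add: logprob_empty)
  qed
  then have "G S = G S1 * G S2" unfolding G_def coef by (simp add: sum.distrib exp_add)
  moreover have "S1 = {i\<in>S. comp i \<in> A}" "S2 = {i\<in>S. comp i \<notin> A}" by (auto simp: S1_def S2_def section_of_def)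
  ultimately show ?thesis by simp
qed

private lemma norm_G:
  assumes S: "S \<subseteq> I"
  shows "norm (G S) \<le> W ^ card (a ` S) * exp (card I)"
proof -
  have "norm (coef S) \<le> W ^ card (a ` S)"
    using z W0 by (auto simp: coef_def norm_power intro!: power_mono)
  moreover have "norm (exp (\<Sum>s\<in>comp ` I. logprob (section_of S {s}))) \<le> exp (card I)"
  proof -
    have "norm (exp (\<Sum>s\<in>comp ` I. logprob (section_of S {s}))) \<le> (\<Prod>s\<in>comp ` I. exp 1)"
      using I norm_exp_logprob[OF section_sub[OF S]]
      by (simp only: exp_sum finite_imageI prod_norm[symmetric]) (intro prod_mono, auto)
    also have "\<dots> = exp (card (comp ` I))" by (simp flip: exp_of_nat_mult)
    also have "\<dots> \<le> exp (card I)" using card_image_le[OF I(1), of comp] by simp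
    finally show ?thesis .
  qed
  ultimately show ?thesis
    unfolding G_def norm_mult using W0 by (intro mult_mono) auto
qed

text \<open>An instance of the cluster bound with \<eta> equal to
  \<open>b * (b * n + card I)\<close>, which is \<open>1 / n\<close> up to logarithms when
  \<open>W\<close> is. Since \<open>W\<close> is at most 1, an arc repeated in several blocks only
  improves the bound, so the power of \<open>W\<close> counts distinct arcs.\<close>

lemma norm_cumulant_arcs_prob:
  fixes b :: real
  defines "b \<equiv> 8 * (card I * W)"
  assumes \<eta>: "b * (b * n + card I) \<le> 1"
  shows "norm (cumulant (\<lambda>S. arcs_prob n (a ` S) z) I) \<le>
    moebius_mass I * (W ^ card (a ` I) * exp (card I) ^ card I) * cluster_const (card I) 2
      * (b * (b * n + card I)) ^ (card (comp ` I) - 1)"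
proof (rule cumulant_cluster_bound[where G = G and \<tau> = \<tau>])
  show "G {} = 1" by (simp add: G_def coef_def section_of_def logprob_empty compatible_arcs_def)
  show "0 \<le> b * (b * n + card I)" using W0 by (simp add: b_def)
  fix S assume S: "S \<subseteq> I"
  show "arcs_prob n (a ` S) z = G S * exp (\<Sum>D | D \<subseteq> comp ` I \<and> 2 \<le> card D. \<tau> D S)"
    unfolding arcs_prob_eq[OF S] G_def by (subst logprob_expansion[OF S]) (simp add: exp_add)
  fix D assume "D \<in> {D. D \<subseteq> comp ` I \<and> 2 \<le> card D}"
  then show "norm (\<tau> D S) \<le> 2 * (b * (b * n + card I)) ^ (card D - 1)"
    using \<tau>_bound[OF S] by (simp add: b_def)
  have "section_of {i\<in>S. comp i \<in> D} X = section_of S X" if "X \<in> Pow D" for X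
    using that by (auto simp: section_of_def)
  then show "\<tau> D S = \<tau> D {i\<in>S. comp i \<in> D}" by (simp add: \<tau>_def)
next
  fix D :: "nat set"
  show "\<tau> D {} = 0" by (simp add: \<tau>_def section_of_def logprob_empty)
next
  fix P assume P: "partition_on I P"
  have finP: "finite P" using I P finite_elements by blast
  have sub: "B \<subseteq> I" if "B \<in> P" for B using that P partition_onD1[OF P] by blast
  have "(\<Prod>B\<in>P. norm (G B)) \<le> (\<Prod>B\<in>P. W ^ card (a ` B) * exp (card I))"
    using norm_G[OF sub] by (intro prod_mono) auto
  also have "\<dots> = W ^ (\<Sum>B\<in>P. card (a ` B)) * exp (card I) ^ card P"
    by (simp add: prod.distrib power_sum)
  also have "\<dots> \<le> W ^ card (a ` I) * exp (card I) ^ card I"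
  proof (intro mult_mono)
    have "a ` I = (\<Union>B\<in>P. a ` B)" using partition_onD1[OF P] by auto
    then have "card (a ` I) \<le> (\<Sum>B\<in>P. card (a ` B))" using card_UN_le[OF finP, of "\<lambda>B. a ` B"] by simp
    then show "W ^ (\<Sum>B\<in>P. card (a ` B)) \<le> W ^ card (a ` I)"
      using W0 W(2) by (rule power_decreasing)
    show "exp (real (card I)) ^ card P \<le> exp (real (card I)) ^ card I"
      using card_partition_le[OF I(1) P] by (rule power_increasing) simp
  qed (use W0 in auto)
  finally show "(\<Prod>B\<in>P. norm (G B)) \<le> W ^ card (a ` I) * exp (card I) ^ card I" .
qed (use I G_mult \<eta> in auto)

end

section \<open>Cumulants of functions of the number of urns\<close>

definition urn_mean :: "nat \<Rightarrow> (nat \<Rightarrow> complex) \<Rightarrow> complex" where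
  "urn_mean n g = (\<Sum>m. of_real (urn_law n m) * g m)"

text \<open>A qualitative condition for summability. Rates up to 1/8 are admissible, since the
  moment generating function of the urn law is under control there.\<close>

definition exp_growth :: "real \<Rightarrow> (nat \<Rightarrow> complex) \<Rightarrow> bool" where
  "exp_growth c g \<longleftrightarrow> (\<exists>C. \<forall>m. norm (g m) \<le> C * exp (c * real m))"

text \<open>The first summand collects the Taylor errors on the bulk of the law, the second the
  tails, with \<open>exp 256\<close> from the exponential moments in
  \<open>urn_exp_tail\<close>.\<close>

definition approx_const :: "nat \<Rightarrow> nat \<Rightarrow> real \<Rightarrow> real" where
  "approx_const l K Q = 2 * Q * l * (3 * Q) ^ l + 4 * exp 256 * (Q * K * 2 ^ K) ^ l"

lemma exp_growth_mono: "exp_growth c g \<Longrightarrow> c \<le> d \<Longrightarrow> exp_growth d g"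
  unfolding exp_growth_def
proof (elim exE)
  fix C assume C: "\<forall>m. norm (g m) \<le> C * exp (c * real m)" and cd: "c \<le> d"
  have "norm (g m) \<le> \<bar>C\<bar> * exp (d * real m)" for m
  proof -
    have "norm (g m) \<le> \<bar>C\<bar> * exp (c * real m)"
      using C[rule_format, of m] mult_right_mono[OF abs_ge_self[of C] exp_ge_zero[of "c * real m"]]
      by (rule order_trans)
    also have "\<dots> \<le> \<bar>C\<bar> * exp (d * real m)"
      using cd by (intro mult_left_mono) (auto intro: mult_right_mono)
    finally show ?thesis .
  qed
  then show "\<exists>C. \<forall>m. norm (g m) \<le> C * exp (d * real m)" by blast
qed

lemma exp_growth_mult:
  assumes "exp_growth c g" "exp_growth d h"
  shows "exp_growth (c + d) (\<lambda>m. g m * h m)"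
proof -
  obtain C D where C: "\<And>m. norm (g m) \<le> C * exp (c * real m)" and D: "\<And>m. norm (h m) \<le> D * exp (d * real m)"
    using assms unfolding exp_growth_def by blast
  have "norm (g m * h m) \<le> (C * D) * exp ((c + d) * real m)" for m
  proof -
    have "norm (g m * h m) \<le> (C * exp (c * real m)) * (D * exp (d * real m))"
      unfolding norm_mult using order_trans[OF norm_ge_zero C[of m]] by (intro mult_mono C D) auto
    moreover have "exp ((c + d) * real m) = exp (c * real m) * exp (d * real m)"
      by (simp add: exp_add distrib_right)
    ultimately show ?thesis by (simp only: mult_ac)
  qed
  then show ?thesis unfolding exp_growth_def by blast
qed

lemma exp_growth_sum:
  assumes "finite I" "\<And>i. i \<in> I \<Longrightarrow> exp_growth c (g i)"
  shows "exp_growth c (\<lambda>m. \<Sum>i\<in>I. g i m)"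
  using assms
proof (induction I rule: finite_induct)
  case empty
  show ?case unfolding exp_growth_def by (intro exI[of _ 0]) simp
next
  case (insert x I)
  then obtain C D where C: "\<And>m. norm (g x m) \<le> C * exp (c * real m)"
    and D: "\<And>m. norm (\<Sum>i\<in>I. g i m) \<le> D * exp (c * real m)"
    unfolding exp_growth_def by blast
  have "norm (\<Sum>i\<in>insert x I. g i m) \<le> (C + D) * exp (c * real m)" for m
    using insert.hyps norm_triangle_mono[OF C[of m] D[of m]] by (simp add: distrib_right)
  then show ?case unfolding exp_growth_def by blast
qed

lemma exp_growth_cmult: "exp_growth c g \<Longrightarrow> exp_growth c (\<lambda>m. b * g m)"
  unfolding exp_growth_def
proof (elim exE)
  fix C assume "\<forall>m. norm (g m) \<le> C * exp (c * real m)"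
  then have "norm (b * g m) \<le> (norm b * C) * exp (c * real m)" for m
    by (simp add: norm_mult mult.assoc mult_left_mono)
  then show "\<exists>C. \<forall>m. norm (b * g m) \<le> C * exp (c * real m)" by blast
qed

lemma exp_growth_prod:
  fixes c :: real
  assumes "finite I" "\<And>i. i \<in> I \<Longrightarrow> exp_growth c (g i)"
  shows "exp_growth (card I * c) (\<lambda>m. \<Prod>i\<in>I. g i m)"
  using assms
proof (induction I rule: finite_induct)
  case empty
  show ?case unfolding exp_growth_def by (intro exI[of _ 1]) simp
next
  case (insert x I)
  then have "exp_growth (c + card I * c) (\<lambda>m. g x m * (\<Prod>i\<in>I. g i m))"
    by (intro exp_growth_mult) auto
  then show ?case using insert.hyps by (simp add: algebra_simps)
qed

lemma exp_growth_bounded: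
  assumes "\<And>m. m \<ge> 1 \<Longrightarrow> norm (g m) \<le> C"
  shows "exp_growth 0 g"
  unfolding exp_growth_def
proof (intro exI allI)
  fix m
  show "norm (g m) \<le> max C (norm (g 0)) * exp (0 * real m)"
    using assms[of m] by (cases "m = 0") auto
qed

lemma norm_prod_diff_le:
  fixes x y :: "'b \<Rightarrow> complex" and M e :: real
  assumes "finite b" "\<And>B. B \<in> b \<Longrightarrow> norm (x B) \<le> M" "\<And>B. B \<in> b \<Longrightarrow> norm (y B) \<le> M"
    "\<And>B. B \<in> b \<Longrightarrow> norm (x B - y B) \<le> e" "1 \<le> M" "0 \<le> e"
  shows "norm ((\<Prod>B\<in>b. x B) - (\<Prod>B\<in>b. y B)) \<le> card b * M ^ card b * e"
  using assms(1-4)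
proof (induction b rule: finite_induct)
  case (insert B b)
  have pw: "norm (\<Prod>B\<in>b. x B) \<le> M ^ card b"
    using insert.prems(1) prod_mono[of b "\<lambda>B. norm (x B)" "\<lambda>_. M"] by (simp add: prod_norm)
  have "(\<Prod>B\<in>insert B b. x B) - (\<Prod>B\<in>insert B b. y B)
      = (x B - y B) * (\<Prod>B\<in>b. x B) + y B * ((\<Prod>B\<in>b. x B) - (\<Prod>B\<in>b. y B))"
    using insert.hyps by (simp add: algebra_simps)
  also have "norm \<dots> \<le> e * M ^ card b + M * (card b * M ^ card b * e)"
    unfolding norm_mult[symmetric]
    using insert assms(5,6) pw
    by (intro norm_triangle_mono) (auto simp: norm_mult intro!: mult_mono)
  also have "\<dots> \<le> M * (e * M ^ card b) + M * (card b * M ^ card b * e)"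
    using mult_right_mono[OF assms(5), of "e * M ^ card b"] assms(5,6) by simp
  also have "\<dots> = card (insert B b) * M ^ card (insert B b) * e"
    using insert.hyps by (simp add: algebra_simps)
  finally show ?case .
qed simp

text \<open>Here \<Phi> is the cumulant generating function of the urn law, so \<mu> is the mean,
  written as a real part because \<Phi> is complex-valued.\<close>

locale urn_transform =
  fixes n :: nat and \<Phi> :: "complex \<Rightarrow> complex" and \<mu> :: real
  assumes n: "n \<ge> 1"
    and \<Phi>: "\<Phi> holomorphic_on cball 0 (1 / 4)" "\<Phi> 0 = 0"
    and \<Phi>_bound: "\<And>v. v \<in> cball 0 (1 / 4) \<Longrightarrow> norm (\<Phi> v) \<le> real n + 1"
    and mgf: "\<And>v. v \<in> cball 0 (1 / 4) \<Longrightarrow> (\<lambda>m. of_real (urn_law n m) * exp (v * of_nat m)) sums exp (\<Phi> v)"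
    and \<mu>: "\<mu> = Re (deriv \<Phi> 0)"
begin

lemma exp_mult_exp_minus: "exp x * exp (- y) = exp (x - y)" for x y :: complex
  by (simp add: exp_diff exp_minus divide_inverse)

text \<open>Centring cancels the linear Taylor term of \<Phi>, and the remainder
  \<open>2 * (n + 1) * (4 * v)^2\<close> gives a sub-Gaussian bound with variance of order
  \<open>n\<close>.\<close>

lemma real_mgf:
  assumes "\<bar>v\<bar> \<le> 1 / 8"
  shows "(\<lambda>m. urn_law n m * exp (v * (real m - \<mu>))) sums Re (exp (\<Phi> (of_real v) - of_real (v * \<mu>)))"
    "norm (exp (\<Phi> (of_real v) - of_real (v * \<mu>))) \<le> exp (32 * (real n + 1) * v\<^sup>2)"
proof -
  have "(\<lambda>m. of_real (urn_law n m) * exp (of_real v * of_nat m) * exp (- of_real (v * \<mu>)))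
      sums (exp (\<Phi> (of_real v)) * exp (- of_real (v * \<mu>)))"
    using assms by (intro sums_mult2 mgf) simp
  moreover have "of_real (urn_law n m) * exp (of_real v * of_nat m) * exp (- of_real (v * \<mu>))
      = complex_of_real (urn_law n m * exp (v * (real m - \<mu>)))" for m
  proof -
    have "exp (complex_of_real v * of_nat m) * exp (- of_real (v * \<mu>)) = of_real (exp (v * (real m - \<mu>)))"
      unfolding exp_mult_exp_minus exp_of_real[symmetric] by (simp add: algebra_simps)
    then show ?thesis by (simp only: mult.assoc of_real_mult)
  qed
  ultimately have "(\<lambda>m. complex_of_real (urn_law n m * exp (v * (real m - \<mu>)))) sums
      exp (\<Phi> (of_real v) - of_real (v * \<mu>))"
    by (simp only: exp_mult_exp_minus)
  then show "(\<lambda>m. urn_law n m * exp (v * (real m - \<mu>))) sums Re (exp (\<Phi> (of_real v) - of_real (v * \<mu>)))"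
    by (drule_tac sums_Re) simp
  have "norm (\<Phi> (of_real v) - (\<Sum>j<2. (deriv ^^ j) \<Phi> 0 / fact j * of_real v ^ j))
      \<le> 2 * (real n + 1) * (norm (complex_of_real v) / (1 / 4)) ^ 2"
    using assms by (intro taylor_remainder_bound(2)[OF \<Phi>(1) _ \<Phi>_bound]) auto
  also have "(\<Sum>j<2. (deriv ^^ j) \<Phi> 0 / fact j * of_real v ^ j) = deriv \<Phi> 0 * of_real v"
    by (simp add: numeral_2_eq_2 \<Phi>(2))
  also have "2 * (real n + 1) * (norm (complex_of_real v) / (1 / 4)) ^ 2 = 32 * (real n + 1) * v\<^sup>2"
    by (simp add: power_mult_distrib)
  finally have "Re (\<Phi> (of_real v) - deriv \<Phi> 0 * of_real v) \<le> 32 * (real n + 1) * v\<^sup>2"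
    by (rule order_trans[OF complex_Re_le_cmod])
  then show "norm (exp (\<Phi> (of_real v) - of_real (v * \<mu>))) \<le> exp (32 * (real n + 1) * v\<^sup>2)"
    by (simp add: norm_exp_eq_Re \<mu> mult.commute)
qed

text \<open>The rate \<open>2 * \<theta>\<close> is twice what the approximants need: one half pays
  for their growth, the other half leaves the decay \<open>exp (- \<theta> * \<delta>)\<close>
  outside a window of size \<delta>. With \<open>v = 2 * \<theta>\<close> the sub-Gaussian exponent
  is \<open>128 * ((n + 1) * \<theta>^2)\<close>, hence 256.\<close>

lemma urn_exp_tail:
  assumes "0 < \<theta>" "\<theta> \<le> 1 / 16" "(real n + 1) * \<theta>\<^sup>2 \<le> 2"
  shows "\<exists>H. (\<lambda>m. urn_law n m * (exp (2 * \<theta> * (real m - \<mu>)) + exp (- (2 * \<theta>) * (real m - \<mu>)))) sums H \<and>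
    H \<le> 2 * exp 256"
proof -
  define h where "h = (\<lambda>v. Re (exp (\<Phi> (of_real v) - of_real (v * \<mu>))))"
  have h: "(\<lambda>m. urn_law n m * exp (v * (real m - \<mu>))) sums h v \<and> h v \<le> exp 256" if "\<bar>v\<bar> = 2 * \<theta>" for v
  proof
    show "(\<lambda>m. urn_law n m * exp (v * (real m - \<mu>))) sums h v"
      unfolding h_def by (rule real_mgf(1)) (use that assms in auto)
    have "v\<^sup>2 = 4 * \<theta>\<^sup>2" using that by (metis power2_abs power_mult_distrib four_x_squared)
    then have "32 * (real n + 1) * v\<^sup>2 = 128 * ((real n + 1) * \<theta>\<^sup>2)" by simp
    then have "32 * (real n + 1) * v\<^sup>2 \<le> 256" using assms(3) by linarith
    moreover have "h v \<le> exp (32 * (real n + 1) * v\<^sup>2)"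
      unfolding h_def by (rule order_trans[OF complex_Re_le_cmod real_mgf(2)]) (use that assms in auto)
    ultimately show "h v \<le> exp 256" by (meson exp_le_cancel_iff order_trans)
  qed
  from h[of "2 * \<theta>"] h[of "- (2 * \<theta>)"] assms(1) show ?thesis
    by (intro exI[of _ "h (2 * \<theta>) + h (- (2 * \<theta>))"])
      (auto simp: distrib_left intro!: sums_add add_mono)
qed

lemma urn_summable:
  assumes "exp_growth c g" "c \<le> 1 / 8"
  shows "summable (\<lambda>m. norm (of_real (urn_law n m) * g m))"
proof -
  obtain C where C: "\<And>m. norm (g m) \<le> C * exp (1 / 8 * real m)"
    using exp_growth_mono[OF assms] unfolding exp_growth_def by blast
  have "summable (\<lambda>m. C * exp (\<mu> / 8) * (urn_law n m * exp (1 / 8 * (real m - \<mu>))))"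
    using real_mgf(1)[of "1 / 8"] by (intro summable_mult) (auto simp: sums_iff)
  moreover have "norm (norm (of_real (urn_law n m) * g m)) \<le> C * exp (\<mu> / 8) * (urn_law n m * exp (1 / 8 * (real m - \<mu>)))" for m
  proof -
    have "norm (norm (of_real (urn_law n m) * g m)) \<le> urn_law n m * (C * exp (1 / 8 * real m))"
      using urn_law_nonneg[of n m] C[of m] by (simp add: norm_mult mult_left_mono)
    also have "exp (1 / 8 * real m) = exp (\<mu> / 8) * exp (1 / 8 * (real m - \<mu>))"
      by (simp add: exp_add[symmetric] field_simps)
    finally show ?thesis by (simp only: mult_ac)
  qed
  ultimately show ?thesis by (rule summable_comparison_test'[where N = 0])
qed

lemma urn_mean_linear:
  assumes "finite I" "\<And>i. i \<in> I \<Longrightarrow> exp_growth c (g i)" "c \<le> 1 / 8"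
  shows "urn_mean n (\<lambda>m. \<Sum>i\<in>I. b i * g i m) = (\<Sum>i\<in>I. b i * urn_mean n (g i))"
proof -
  have s: "summable (\<lambda>m. of_real (urn_law n m) * g i m)" if "i \<in> I" for i
    using urn_summable[OF assms(2)[OF that] assms(3)] by (rule summable_norm_cancel)
  have "urn_mean n (\<lambda>m. \<Sum>i\<in>I. b i * g i m) = (\<Sum>m. \<Sum>i\<in>I. b i * (of_real (urn_law n m) * g i m))"
    unfolding urn_mean_def by (simp add: sum_distrib_left mult_ac)
  also have "\<dots> = (\<Sum>i\<in>I. \<Sum>m. b i * (of_real (urn_law n m) * g i m))"
    by (rule suminf_sum) (intro summable_mult s)
  also have "\<dots> = (\<Sum>i\<in>I. b i * urn_mean n (g i))"
    unfolding urn_mean_def by (intro sum.cong refl suminf_mult s)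
  finally show ?thesis .
qed

lemma urn_mean_diff:
  assumes "exp_growth c g" "exp_growth c h" "c \<le> 1 / 8"
  shows "urn_mean n (\<lambda>m. g m - h m) = urn_mean n g - urn_mean n h"
proof -
  have "summable (\<lambda>m. of_real (urn_law n m) * g m)"
    using urn_summable[OF assms(1,3)] by (rule summable_norm_cancel)
  moreover have "summable (\<lambda>m. of_real (urn_law n m) * h m)"
    using urn_summable[OF assms(2,3)] by (rule summable_norm_cancel)
  ultimately show ?thesis
    unfolding urn_mean_def right_diff_distrib by (rule suminf_diff[symmetric])
qed

lemma norm_urn_mean_le:
  assumes "\<And>m. m \<ge> 1 \<Longrightarrow> norm (g m) \<le> h m" "(\<lambda>m. urn_law n m * h m) sums H"
  shows "norm (urn_mean n g) \<le> H"
proof -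
  have le: "norm (of_real (urn_law n m) * g m) \<le> urn_law n m * h m" for m
  proof (cases "m = 0")
    case True
    moreover have "urn_law n 0 = 0" using n by (simp add: urn_law_def power_0_left)
    ultimately show ?thesis by simp
  next
    case False
    then show ?thesis
      using urn_law_nonneg[of n m] assms(1)[of m] by (simp add: norm_mult mult_left_mono)
  qed
  have "summable (\<lambda>m. norm (of_real (urn_law n m) * g m))"
    by (rule summable_comparison_test'[OF sums_summable[OF assms(2)], where N = 0]) (use le in auto)
  then have "(\<lambda>m. of_real (urn_law n m) * g m) sums urn_mean n g"
    unfolding urn_mean_def by (rule summable_sums[OF summable_norm_cancel])
  then show ?thesis using assms(2) le by (rule norm_sums_le)
qed

text \<open>Cumulants are multilinear: \<open>B0\<close> lies in exactly one block of each
  partition, so every product of moments is linear in \<open>q B0\<close>. The growth bounds allow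
  the mean to be taken termwise.\<close>

lemma cumulant_urn_linear:
  fixes q :: "'b \<Rightarrow> nat \<Rightarrow> complex" and c :: real
  assumes L: "finite L" "B0 \<in> L"
    and q: "\<And>m. q B0 m = (\<Sum>i\<in>J. \<beta> i * e i m)" and J: "finite J"
    and growth: "\<And>B. B \<in> L \<Longrightarrow> exp_growth c (q B)" "\<And>i. i \<in> J \<Longrightarrow> exp_growth c (e i)"
    and c: "0 \<le> c" "card L * c \<le> 1 / 8"
  shows "cumulant (\<lambda>b. urn_mean n (\<lambda>m. \<Prod>B\<in>b. q B m)) L
    = (\<Sum>i\<in>J. \<beta> i * cumulant (\<lambda>b. urn_mean n (\<lambda>m. \<Prod>B\<in>b. (q(B0 := e i)) B m)) L)"
proof -
  define U where "U = (\<lambda>q b. urn_mean n (\<lambda>m. \<Prod>B\<in>b. (q :: 'b \<Rightarrow> nat \<Rightarrow> complex) B m))"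
  have "(\<Prod>b\<in>P. U q b) = (\<Sum>i\<in>J. \<beta> i * (\<Prod>b\<in>P. U (q(B0 := e i)) b))" if P: "partition_on L P" for P
  proof -
    have finP: "finite P" using P L finite_elements by blast
    from P L(2) obtain b0 where b0: "b0 \<in> P" "B0 \<in> b0" by (auto simp: partition_on_def)
    have b0L: "b0 \<subseteq> L" using P b0(1) by (auto simp: partition_on_def)
    then have finb: "finite b0" using L finite_subset by blast
    have other: "U (q(B0 := e i)) b = U q b" if "b \<in> P - {b0}" for b i
    proof -
      have "b \<inter> b0 = {}" using P b0(1) that by (auto simp: partition_on_def disjoint_def)
      then have "B0 \<notin> b" using b0 by auto
      then have "(\<Prod>B\<in>b. (q(B0 := e i)) B m) = (\<Prod>B\<in>b. q B m)" for m
        by (intro prod.cong) auto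
      then show ?thesis by (simp add: U_def)
    qed
    have "(\<Prod>B\<in>b0. q B m) = (\<Sum>i\<in>J. \<beta> i * (\<Prod>B\<in>b0. (q(B0 := e i)) B m))" for m
    proof -
      have "(\<Prod>B\<in>b0. (q(B0 := e i)) B m) = e i m * (\<Prod>B\<in>b0 - {B0}. q B m)" for i
        using prod.remove[OF finb b0(2), of "\<lambda>B. (q(B0 := e i)) B m"] by simp
      then show ?thesis
        using prod.remove[OF finb b0(2), of "\<lambda>B. q B m"] by (simp add: q sum_distrib_right mult.assoc)
    qed
    then have "U q b0 = urn_mean n (\<lambda>m. \<Sum>i\<in>J. \<beta> i * (\<Prod>B\<in>b0. (q(B0 := e i)) B m))"
      by (simp add: U_def)
    also have "\<dots> = (\<Sum>i\<in>J. \<beta> i * U (q(B0 := e i)) b0)"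
      unfolding U_def
    proof (rule urn_mean_linear[OF J])
      show "exp_growth (card b0 * c) (\<lambda>m. \<Prod>B\<in>b0. (q(B0 := e i)) B m)" if "i \<in> J" for i
        by (intro exp_growth_prod finb) (use growth b0L that in auto)
      have "card b0 * c \<le> card L * c"
        using b0L L(1) c by (intro mult_right_mono) (auto intro: card_mono)
      then show "card b0 * c \<le> 1 / 8" using c by simp
    qed
    finally have "U q b0 = (\<Sum>i\<in>J. \<beta> i * U (q(B0 := e i)) b0)" .
    then show ?thesis
      using prod.remove[OF finP b0(1), of "U q"] prod.remove[OF finP b0(1), of "U (q(B0 := e i))" for i] other
      by (simp add: sum_distrib_right mult.assoc)
  qed
  then have "cumulant (U q) L = (\<Sum>i\<in>J. \<beta> i * cumulant (U (q(B0 := e i))) L)"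
    unfolding cumulant_def sum_distrib_left
    by (subst sum.swap) (intro sum.cong refl, simp add: sum_distrib_left mult_ac)
  then show ?thesis by (simp add: U_def)
qed

text \<open>Joint moments are \<open>exp (\<psi> (v b))\<close> with \<open>v\<close> additive, so
  the cluster bound applies with every index as its own component. A coupling of \<open>D\<close> is
  an iterated difference of a function of size \<open>n\<close> with steps of total size
  \<open>c\<close>, hence of order \<open>n * c ^ card D\<close>. As \<open>n * c\<close> is not
  small and \<open>card D\<close> is at least 2, this is bounded by the power
  \<open>card D - 1\<close> of a multiple of \<open>n * c^2\<close>.\<close>

lemma cumulant_urn_exponentials:
  fixes \<iota> :: "'b \<Rightarrow> nat" and c \<rho> :: real
  assumes L: "finite L" "L \<noteq> {}" and \<iota>: "\<And>B. B \<in> L \<Longrightarrow> \<iota> B < K" and \<rho>: "0 < \<rho>"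
  defines "c \<equiv> real (card L) * real K / \<rho>"
  assumes c: "c \<le> 1 / 8" "1 \<le> (real n + 1) * (8 * c)" "64 * c\<^sup>2 * (real n + 1) \<le> 1"
  shows "norm (cumulant (\<lambda>b. urn_mean n (\<lambda>m. \<Prod>B\<in>b. exp (of_real (\<iota> B * ((real m - \<mu>) / \<rho>))))) L)
    \<le> moebius_mass L * exp (real (card L)) * cluster_const (card L) 2 * (64 * c\<^sup>2 * (real n + 1)) ^ (card L - 1)"
proof -
  define d where "d = (\<lambda>B. complex_of_real (\<iota> B / \<rho>))"
  define \<psi> where "\<psi> = (\<lambda>v. \<Phi> v - of_real \<mu> * v)"
  define v where "v = (\<lambda>b. \<Sum>B\<in>b. d B)"
  define F where "F = (\<lambda>b. urn_mean n (\<lambda>m. \<Prod>B\<in>b. exp (complex_of_real (\<iota> B * ((real m - \<mu>) / \<rho>)))))"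
  \<comment> \<open>The linear centring term of \<psi> drops out of couplings of two or more
    indices, so \<Phi> with its bound can be used here.\<close>
  define \<tau> where "\<tau> = (\<lambda>D b. (-1) ^ card D * (\<Sum>X\<in>Pow D. (-1) ^ card X * \<Phi> (v (X \<inter> b))))"
  define G where "G = (\<lambda>b. \<Prod>B\<in>b. exp (\<psi> (d B)))"
  have c0: "0 \<le> c" using \<rho> by (simp add: c_def)
  have dsum: "(\<Sum>B\<in>b. norm (d B)) \<le> c" if "b \<subseteq> L" for b
  proof -
    have "(\<Sum>B\<in>b. norm (d B)) \<le> (\<Sum>B\<in>L. norm (d B))" using that L by (intro sum_mono2) auto
    also have "\<dots> \<le> (\<Sum>B\<in>L. real K / \<rho>)"
      using \<iota> \<rho> by (intro sum_mono) (auto simp: d_def norm_divide less_imp_le intro!: divide_right_mono)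
    finally show ?thesis by (simp add: c_def)
  qed
  have vb: "norm (v b) \<le> c" if "b \<subseteq> L" for b
    using norm_sum[of d b] dsum[OF that] by (simp add: v_def)
  have F: "F b = exp (\<psi> (v b))" if b: "b \<subseteq> L" for b
  proof -
    have finb: "finite b" using b L finite_subset by blast
    have "(\<lambda>m. of_real (urn_law n m) * exp (v b * of_nat m) * exp (- (of_real \<mu> * v b))) sums
        (exp (\<Phi> (v b)) * exp (- (of_real \<mu> * v b)))"
      using vb[OF b] c by (intro sums_mult2 mgf) simp
    moreover have "of_real (urn_law n m) * exp (v b * of_nat m) * exp (- (of_real \<mu> * v b))
        = of_real (urn_law n m) * (\<Prod>B\<in>b. exp (complex_of_real (\<iota> B * ((real m - \<mu>) / \<rho>))))" for m
    proof -
      have "(\<Sum>B\<in>b. complex_of_real (\<iota> B * ((real m - \<mu>) / \<rho>))) = v b * of_nat m - of_real \<mu> * v b"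
        by (simp add: v_def d_def sum_distrib_left sum_distrib_right right_diff_distrib
          diff_divide_distrib sum_subtractf mult_ac)
      then show ?thesis by (simp only: exp_sum[OF finb, symmetric] mult.assoc exp_mult_exp_minus)
    qed
    ultimately have "(\<lambda>m. of_real (urn_law n m) * (\<Prod>B\<in>b. exp (complex_of_real (\<iota> B * ((real m - \<mu>) / \<rho>)))))
        sums exp (\<psi> (v b))"
      by (simp only: exp_mult_exp_minus \<psi>_def)
    then show ?thesis unfolding F_def urn_mean_def by (rule sums_unique[symmetric])
  qed
  have "norm (cumulant F L) \<le> moebius_mass L * exp (real (card L)) * cluster_const (card L) 2
      * (64 * c\<^sup>2 * (real n + 1)) ^ (card ((\<lambda>B. B) ` L) - 1)"
  proof (rule cumulant_cluster_bound[where G = G and \<tau> = \<tau>])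
    show "G {} = 1" by (simp add: G_def)
    show "0 \<le> 64 * c\<^sup>2 * (real n + 1)" by simp
    fix b assume b: "b \<subseteq> L"
    have finb: "finite b" using b L finite_subset by blast
    show "G b = G {i\<in>b. i \<in> A} * G {i\<in>b. i \<notin> A}" for A
    proof -
      have "{i\<in>b. i \<in> A} \<union> {i\<in>b. i \<notin> A} = b" by auto
      moreover have "G ({i\<in>b. i \<in> A} \<union> {i\<in>b. i \<notin> A}) = G {i\<in>b. i \<in> A} * G {i\<in>b. i \<notin> A}"
        unfolding G_def by (rule prod.union_disjoint) (use finb in auto)
      ultimately show ?thesis by simp
    qed
    show "F b = G b * exp (\<Sum>D | D \<subseteq> (\<lambda>B. B) ` L \<and> 2 \<le> card D. \<tau> D b)"
    proof -
      have "\<Phi> (v b) = \<Phi> (v (L \<inter> b))" using b by (simp add: Int_absorb1)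
      also have "\<dots> = (\<Sum>D\<in>Pow L. (-1) ^ card D * (\<Sum>X\<in>Pow D. (-1) ^ card X * \<Phi> (v (X \<inter> b))))"
        by (rule inclusion_exclusion_symmetric[OF refl L(1), where f = "\<lambda>X. \<Phi> (v (X \<inter> b))"])
      also have "\<dots> = (\<Sum>D\<in>Pow L. \<tau> D b)" by (simp add: \<tau>_def)
      also have "Pow L = insert {} ((\<lambda>s. {s}) ` L) \<union> {D. D \<subseteq> L \<and> 2 \<le> card D}"
      proof -
        have "D = {} \<or> (\<exists>s\<in>L. D = {s})" if "D \<subseteq> L" "\<not> 2 \<le> card D" for D
        proof -
          have "finite D" using that L finite_subset by blast
          moreover have "card D = 0 \<or> card D = 1" using that by linarith
          ultimately show ?thesis using that(1) by (auto simp: card_1_singleton_iff)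
        qed
        then show ?thesis by auto
      qed
      also have "(\<Sum>D\<in>insert {} ((\<lambda>s. {s}) ` L) \<union> {D. D \<subseteq> L \<and> 2 \<le> card D}. \<tau> D b)
          = (\<Sum>D\<in>insert {} ((\<lambda>s. {s}) ` L). \<tau> D b) + (\<Sum>D | D \<subseteq> L \<and> 2 \<le> card D. \<tau> D b)"
        by (rule sum.union_disjoint) (use L in \<open>auto intro: finite_subset[of _ "Pow L"]\<close>)
      also have "(\<Sum>D\<in>insert {} ((\<lambda>s. {s}) ` L). \<tau> D b) = \<tau> {} b + (\<Sum>s\<in>L. \<tau> {s} b)"
        using L by (subst sum.insert) (auto simp: sum.reindex)
      also have "\<tau> {} b = 0" by (simp add: \<tau>_def v_def \<Phi>(2))
      also have "(\<Sum>s\<in>L. \<tau> {s} b) = (\<Sum>s\<in>b. \<Phi> (d s))"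
      proof -
        have "\<tau> {s} b = (if s \<in> b then \<Phi> (d s) else 0)" for s
        proof -
          have "Pow {s} = {{}, {s}}" by auto
          then show ?thesis by (simp add: \<tau>_def v_def \<Phi>(2))
        qed
        then have "(\<Sum>s\<in>L. \<tau> {s} b) = (\<Sum>s\<in>{s\<in>L. s \<in> b}. \<Phi> (d s))"
          using sum.inter_filter[OF L(1), of "\<lambda>s. \<Phi> (d s)" "\<lambda>s. s \<in> b"] by simp
        also have "{s\<in>L. s \<in> b} = b" using b by auto
        finally show ?thesis .
      qed
      finally have "\<psi> (v b) = (\<Sum>s\<in>b. \<psi> (d s)) + (\<Sum>D | D \<subseteq> L \<and> 2 \<le> card D. \<tau> D b)"
        by (simp add: \<psi>_def v_def sum_subtractf sum_distrib_left)
      then show ?thesis unfolding F[OF b] G_def by (simp add: exp_add exp_sum finb)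
    qed
    fix D assume "D \<in> {D. D \<subseteq> (\<lambda>B. B) ` L \<and> 2 \<le> card D}"
    then have D: "D \<subseteq> L" "2 \<le> card D" by auto
    have "X \<inter> {i\<in>b. i \<in> D} = X \<inter> b" if "X \<in> Pow D" for X using that by auto
    then show "\<tau> D b = \<tau> D {i\<in>b. i \<in> D}" by (simp add: \<tau>_def)
    have finD: "finite D" using D L finite_subset by blast
    have "norm (\<tau> D b) = norm (\<Sum>X\<in>Pow D. (-1) ^ card X * \<Phi> (\<Sum>s\<in>X. if s \<in> b then d s else 0))"
    proof -
      have "v (X \<inter> b) = (\<Sum>s\<in>X. if s \<in> b then d s else 0)" if "X \<in> Pow D" for X
      proof -
        have "finite X" using that finD finite_subset by blast
        then show ?thesis by (simp add: v_def sum.inter_restrict)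
      qed
      then show ?thesis by (simp add: \<tau>_def norm_mult norm_power)
    qed
    also have "\<dots> \<le> 2 ^ (card D + 1) * (real n + 1) * (c / (1 / 4)) ^ card D"
    proof (rule alternating_sum_holomorphic_bound[OF \<Phi>(1) _ \<Phi>_bound finD])
      have "(\<Sum>s\<in>D. norm (if s \<in> b then d s else 0)) \<le> (\<Sum>s\<in>D. norm (d s))"
        by (intro sum_mono) auto
      then show "(\<Sum>s\<in>D. norm (if s \<in> b then d s else 0)) \<le> c" using dsum[OF D(1)] by simp
    qed (use c in auto)
    also have "\<dots> = 2 * ((real n + 1) * (8 * c) ^ card D)"
    proof -
      have "(8 * c) ^ card D = 2 ^ card D * (c / (1 / 4)) ^ card D"
        by (simp only: power_mult_distrib[symmetric]) simp
      then show ?thesis by (simp only: power_add power_one_right mult_ac)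
    qed
    also have "(real n + 1) * (8 * c) ^ card D = (8 * c) ^ (card D - 1) * ((real n + 1) * (8 * c))"
    proof -
      have "Suc (card D - 1) = card D" using D(2) by simp
      then have "(8 * c) ^ card D = (8 * c) * (8 * c) ^ (card D - 1)"
        by (metis power_Suc)
      then show ?thesis by simp
    qed
    also have "2 * ((8 * c) ^ (card D - 1) * ((real n + 1) * (8 * c)))
        \<le> 2 * ((8 * c) ^ (card D - 1) * ((real n + 1) * (8 * c)) ^ (card D - 1))"
      using c c0 D(2) by (intro mult_left_mono self_le_power) auto
    also have "\<dots> = 2 * (64 * c\<^sup>2 * (real n + 1)) ^ (card D - 1)"
      by (simp only: power_mult_distrib[symmetric]) (simp add: power2_eq_square mult_ac)
    finally show "norm (\<tau> D b) \<le> 2 * (64 * c\<^sup>2 * (real n + 1)) ^ (card D - 1)" .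
  next
    fix D :: "'b set"
    have "(\<Sum>X\<in>Pow D. (-1) ^ card X * \<Phi> (v (X \<inter> {}))) = 0" by (simp add: v_def \<Phi>(2))
    then show "\<tau> D {} = 0" by (simp add: \<tau>_def)
  next
    fix P assume P: "partition_on L P"
    have "norm (exp (\<psi> (d B))) \<le> exp 1" if B: "B \<in> L" for B
    proof -
      have dB: "\<iota> B / \<rho> \<le> c" "0 \<le> \<iota> B / \<rho>"
        using dsum[of "{B}"] B \<rho> by (auto simp: d_def norm_divide)
      have "norm (exp (\<psi> (d B))) \<le> exp (32 * (real n + 1) * (\<iota> B / \<rho>)\<^sup>2)"
      proof -
        have "\<bar>\<iota> B / \<rho>\<bar> \<le> 1 / 8" using dB c(1) by linarith
        from real_mgf(2)[OF this] show ?thesis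
          by (simp only: \<psi>_def d_def of_real_mult mult.commute)
      qed
      also have "\<dots> \<le> exp (32 * (real n + 1) * c\<^sup>2)"
        using dB by (simp add: mult_left_mono power_mono)
      also have "\<dots> \<le> exp 1"
      proof -
        have "32 * (real n + 1) * c\<^sup>2 = 64 * c\<^sup>2 * (real n + 1) / 2" by (simp add: algebra_simps)
        then have "32 * (real n + 1) * c\<^sup>2 \<le> 1" using c(3) by linarith
        then show ?thesis by (simp only: exp_le_cancel_iff)
      qed
      finally show ?thesis .
    qed
    then have *: "norm (G b) \<le> exp 1 ^ card b" if "b \<subseteq> L" for b
    proof -
      have "norm (G b) = (\<Prod>B\<in>b. norm (exp (\<psi> (d B))))" by (simp only: G_def prod_norm)
      also have "\<dots> \<le> (\<Prod>B\<in>b. exp 1)"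
        using that \<open>\<And>B. B \<in> L \<Longrightarrow> norm (exp (\<psi> (d B))) \<le> exp 1\<close> by (intro prod_mono) auto
      finally show ?thesis by simp
    qed
    have sub: "b \<subseteq> L" if "b \<in> P" for b using that partition_onD1[OF P] by blast
    have "(\<Prod>b\<in>P. norm (G b)) \<le> (\<Prod>b\<in>P. exp 1 ^ card b)"
      using *[OF sub] by (intro prod_mono) auto
    also have "\<dots> = exp 1 ^ (\<Sum>b\<in>P. card b)" by (simp add: power_sum)
    also have "(\<Sum>b\<in>P. card b) = card L"
      using product_partition[OF P] sub L(1) finite_subset by metis
    finally show "(\<Prod>b\<in>P. norm (G b)) \<le> exp (real (card L))" by (simp flip: exp_of_nat_mult)
  qed (use L c in auto)
  then show ?thesis by (simp add: F_def)
qed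

text \<open>
  On the bulk of the law, \<open>q B\<close> is replaced by a Taylor polynomial in \<open>exp x - 1\<close>, with
  \<open>x = (m - \<mu>) / \<rho>\<close>; this is a combination of exponentials, whose joint moments are values of the
  moment generating function.
\<close>

lemma cumulant_urn_analytic:
  fixes q :: "'b \<Rightarrow> nat \<Rightarrow> complex" and f :: "'b \<Rightarrow> complex \<Rightarrow> complex" and A :: "'b \<Rightarrow> real"
    and Q \<rho> \<delta> \<theta> c M :: real and K :: nat
  assumes L: "finite L" "L \<noteq> {}" and K: "K \<ge> 1" and \<rho>: "0 < \<rho>"
  defines "c \<equiv> real (card L) * real K / \<rho>"
  defines "M \<equiv> Q ^ card L + 2 * approx_const (card L) K Q"
  assumes c: "c \<le> 1 / 8" "1 \<le> (real n + 1) * (8 * c)" "64 * c\<^sup>2 * (real n + 1) \<le> 1"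
    and \<delta>: "0 \<le> \<delta>" "8 * \<delta> \<le> \<rho>"
    and \<theta>: "0 < \<theta>" "\<theta> \<le> 1 / 16" "c \<le> \<theta>" "(real n + 1) * \<theta>\<^sup>2 \<le> 2"
    and Q: "1 \<le> Q"
    and A: "\<And>B. B \<in> L \<Longrightarrow> 0 \<le> A B \<and> A B \<le> Q"
    and f: "\<And>B. B \<in> L \<Longrightarrow> f B holomorphic_on cball (of_real \<mu>) \<rho>"
      "\<And>B z. B \<in> L \<Longrightarrow> z \<in> cball (of_real \<mu>) \<rho> \<Longrightarrow> norm (f B z) \<le> A B"
    and qf: "\<And>B m. B \<in> L \<Longrightarrow> m \<ge> 1 \<Longrightarrow> \<bar>real m - \<mu>\<bar> \<le> \<delta> \<Longrightarrow> q B m = f B (of_nat m)"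
    and qb: "\<And>B m. B \<in> L \<Longrightarrow> m \<ge> 1 \<Longrightarrow> norm (q B m) \<le> Q"
  shows "norm (cumulant (\<lambda>b. urn_mean n (\<lambda>m. \<Prod>B\<in>b. q B m)) L)
    \<le> moebius_mass L * exp (real (card L)) * cluster_const (card L) 2 * (64 * c\<^sup>2 * (real n + 1)) ^ (card L - 1)
        * (\<Prod>B\<in>L. real K ^ 2 * 4 ^ K * A B)
      + moebius_mass L * (card L * M ^ card L * (approx_const (card L) K Q * ((4 * \<delta> / \<rho>) ^ K + exp (- \<theta> * \<delta>))))"
proof -
  define l where "l = card L"
  define x where "x = (\<lambda>m. (real m - \<mu>) / \<rho>)"
  define y where "y = (\<lambda>m. complex_of_real (exp (x m) - 1))"
  define ex where "ex = (\<lambda>i m. exp (complex_of_real (real i * ((real m - \<mu>) / \<rho>))))"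
  \<comment> \<open>The substitution \<open>w = exp x - 1\<close>. At \<open>w = y m\<close> the
    argument of \<open>f B\<close> is \<open>m\<close>; and for \<open>norm w\<close> at most 1/2
    the logarithm has norm at most 1, so the argument stays in the disc of radius \<rho>.\<close>
  define F where "F = (\<lambda>B w. f B (of_real \<mu> + of_real \<rho> * Ln (1 + w)))"
  define a where "a = (\<lambda>B j. (deriv ^^ j) (F B) 0 / fact j)"
  define u where "u = (\<lambda>B m. \<Sum>j<K. a B j * y m ^ j)"
  define U where "U = (\<lambda>q b. urn_mean n (\<lambda>m. \<Prod>B\<in>b. (q :: 'b \<Rightarrow> nat \<Rightarrow> complex) B m))"
  define \<beta> where "\<beta> = (\<lambda>B i. \<Sum>j<K. if i \<le> j then a B j * (of_nat (j choose i) * (-1) ^ (j - i)) else 0)"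
  define X where "X = moebius_mass L * exp (real (card L)) * cluster_const (card L) 2 * (64 * c\<^sup>2 * (real n + 1)) ^ (card L - 1)"
  define s1 where "s1 = (4 * \<delta> / \<rho>) ^ K"
  define QK where "QK = Q * K * 2 ^ K"
  have l1: "1 \<le> l" using L by (simp add: l_def card_gt_0_iff Suc_le_eq)
  have Ln_arg: "1 + w \<notin> \<real>\<^sub>\<le>\<^sub>0 \<and> norm (Ln (1 + w)) \<le> 1" if "norm w \<le> 1 / 2" for w :: complex
  proof
    have re: "Re (1 + w) \<ge> 1 / 2" using that abs_Re_le_cmod[of w] by (simp add: abs_le_iff)
    then show "1 + w \<notin> \<real>\<^sub>\<le>\<^sub>0" by (auto simp: complex_nonpos_Reals_iff)
    show "norm (Ln (1 + w)) \<le> 1"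
    proof (cases "norm w < 1 / 2")
      case True
      then show ?thesis using norm_Ln_le[of w] by simp
    next
      case False
      \<comment> \<open>The estimate of the logarithm is for the open disc; the boundary follows by
        continuity along the ray to \<open>w\<close>.\<close>
      define g where "g = (\<lambda>t::real. norm (Ln (1 + of_real t * w)))"
      have "(g \<longlongrightarrow> g 1) (at_left 1)"
      proof -
        have "isCont g 1" unfolding g_def using \<open>1 + w \<notin> \<real>\<^sub>\<le>\<^sub>0\<close>
          by (intro continuous_intros) auto
        then show ?thesis using continuous_at_imp_continuous_at_within continuous_within by blast
      qed
      moreover have "eventually (\<lambda>t. g t \<le> 1) (at_left (1::real))"
      proof -
        have "g t \<le> 1" if "t \<in> {0<..<1}" for t
        proof -
          have "norm (of_real t * w) < 1 / 2"
          proof -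
            have "t * norm w \<le> t * (1 / 2)" using that \<open>norm w \<le> 1 / 2\<close> by (intro mult_left_mono) auto
            moreover have "norm (of_real t * w) = t * norm w" using that by (simp add: norm_mult)
            moreover have "t < 1" using that by simp
            ultimately show ?thesis by linarith
          qed
          then show ?thesis using norm_Ln_le[of "of_real t * w"] by (simp add: g_def)
        qed
        then show ?thesis by (intro eventually_at_leftI[of "0::real" 1]) auto
      qed
      ultimately have "g 1 \<le> 1" by (rule tendsto_upperbound) simp
      then show ?thesis by (simp add: g_def)
    qed
  qed
  have F: "F B holomorphic_on cball 0 (1 / 2)" "\<And>w. w \<in> cball 0 (1 / 2) \<Longrightarrow> norm (F B w) \<le> A B"
    if B: "B \<in> L" for B
  proof -
    have into: "of_real \<mu> + of_real \<rho> * Ln (1 + w) \<in> cball (of_real \<mu>) \<rho>" if "w \<in> cball 0 (1 / 2)" for w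
    proof -
      have "norm (of_real \<rho> * Ln (1 + w)) \<le> \<rho> * 1"
        unfolding norm_mult using Ln_arg[of w] that \<rho> by (intro mult_mono) auto
      then show ?thesis by (simp add: dist_norm)
    qed
    have "(\<lambda>w. of_real \<mu> + of_real \<rho> * Ln (1 + w)) holomorphic_on cball 0 (1 / 2)"
      by (intro holomorphic_intros) (use Ln_arg in auto)
    then have "(f B \<circ> (\<lambda>w. of_real \<mu> + of_real \<rho> * Ln (1 + w))) holomorphic_on cball 0 (1 / 2)"
      by (rule holomorphic_on_compose_gen[OF _ f(1)[OF B]]) (use into in blast)
    then show "F B holomorphic_on cball 0 (1 / 2)" by (simp add: F_def o_def)
    show "norm (F B w) \<le> A B" if "w \<in> cball 0 (1 / 2)" for w
      unfolding F_def by (rule f(2)[OF B into[OF that]])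
  qed
  have a: "norm (a B j) \<le> A B * 2 ^ j" if B: "B \<in> L" for B j
    using taylor_remainder_bound(1)[OF F(1)[OF B] _ F(2)[OF B], of j]
    by (simp add: a_def power_divide power_one_over)
  have exi: "ex i m = of_real (exp (x m)) ^ i" for i m
    by (simp only: ex_def x_def exp_of_real exp_of_nat_mult of_real_power)
  \<comment> \<open>On the bulk \<open>norm (y m)\<close> is at most
    \<open>2 * \<delta> / \<rho>\<close>; relative to the radius 1/2 this is the ratio
    \<open>4 * \<delta> / \<rho>\<close> in \<open>s1\<close>.\<close>
  have ugood: "norm (q B m - u B m) \<le> 2 * Q * s1"
    if B: "B \<in> L" and m: "m \<ge> 1" "\<bar>real m - \<mu>\<bar> \<le> \<delta>" for B m
  proof -
    have xm: "\<bar>x m\<bar> \<le> \<delta> / \<rho>" using m \<rho> by (simp add: x_def divide_right_mono)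
    have "\<delta> / \<rho> \<le> 1 / 8" using \<delta> \<rho> by (simp add: field_simps)
    then have "\<bar>x m\<bar> \<le> 1 / 2" using xm by linarith
    then have "exp (x m) \<le> 1 + 2 * \<bar>x m\<bar>" using exp_bound_lemma[of "x m"] by simp
    moreover have "1 + x m \<le> exp (x m)" by (rule exp_ge_add_one_self)
    ultimately have "\<bar>exp (x m) - 1\<bar> \<le> 2 * \<bar>x m\<bar>" by linarith
    then have ym: "norm (y m) \<le> 2 * (\<delta> / \<rho>)" using xm by (simp add: y_def del: of_real_diff)
    have "Ln (1 + y m) = of_real (x m)" by (simp add: y_def Ln_of_real)
    then have "F B (y m) = f B (of_nat m)"
      using \<rho> by (simp add: F_def x_def flip: of_real_mult of_real_add)
    then have "q B m = F B (y m)" using qf[OF B m] by simp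
    moreover have "norm (F B (y m) - u B m) \<le> 2 * A B * (norm (y m) / (1 / 2)) ^ K"
      unfolding u_def a_def
    proof (rule taylor_remainder_bound(2)[OF F(1)[OF B] _ F(2)[OF B]])
      show "norm (y m) \<le> 1 / 2 / 2" using ym \<open>\<delta> / \<rho> \<le> 1 / 8\<close> by linarith
    qed auto
    moreover have "2 * A B * (norm (y m) / (1 / 2)) ^ K \<le> 2 * Q * s1"
      unfolding s1_def using A[OF B] ym by (intro mult_mono power_mono) auto
    ultimately show ?thesis by simp
  qed
  have ubad: "norm (u B m) \<le> QK * exp (K * \<bar>x m\<bar>)" if B: "B \<in> L" for B m
  proof -
    have y: "norm (y m) \<le> exp \<bar>x m\<bar>"
    proof -
      have "exp (x m) \<le> exp \<bar>x m\<bar>" "0 < exp (x m)" "1 \<le> exp \<bar>x m\<bar>" by auto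
      then have "\<bar>exp (x m) - 1\<bar> \<le> exp \<bar>x m\<bar>" by linarith
      then show ?thesis by (simp add: y_def del: of_real_diff)
    qed
    have "norm (u B m) \<le> (\<Sum>j<K. Q * 2 ^ K * exp (K * \<bar>x m\<bar>))"
      unfolding u_def
    proof (rule sum_norm_le)
      fix j assume "j \<in> {..<K}"
      then have j: "j \<le> K" by simp
      have "norm (y m) ^ j \<le> exp \<bar>x m\<bar> ^ j" using y by (intro power_mono) auto
      also have "\<dots> \<le> exp \<bar>x m\<bar> ^ K" using j by (intro power_increasing) auto
      also have "\<dots> = exp (K * \<bar>x m\<bar>)" by (simp add: exp_of_nat_mult)
      finally have 1: "norm (y m) ^ j \<le> exp (K * \<bar>x m\<bar>)" .
      have "norm (a B j) \<le> Q * 2 ^ K"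
        using a[OF B, of j] A[OF B] j Q mult_mono[of "A B" Q "2 ^ j" "2 ^ K"] power_increasing[of j K "2::real"] by simp
      then show "norm (a B j * y m ^ j) \<le> Q * 2 ^ K * exp (K * \<bar>x m\<bar>)"
        unfolding norm_mult norm_power using 1 Q by (intro mult_mono) auto
    qed
    then show ?thesis by (simp add: QK_def mult_ac)
  qed
  have uexp: "u B m = (\<Sum>i<K. \<beta> B i * ex i m)" for B m
  proof -
    have "y m ^ j = (\<Sum>i\<le>j. of_nat (j choose i) * ex i m * (-1) ^ (j - i))" for j
      using binomial_ring[of "of_real (exp (x m))" "-1::complex" j] by (simp add: y_def exi)
    then have "u B m = (\<Sum>j<K. \<Sum>i<K. if i \<le> j then a B j * (of_nat (j choose i) * (-1) ^ (j - i)) * ex i m else 0)"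
      unfolding u_def
    proof (intro sum.cong refl)
      fix j assume j: "j \<in> {..<K}"
      have "{i\<in>{..<K}. i \<le> j} = {..j}" using j by auto
      then have "(\<Sum>i<K. if i \<le> j then a B j * (of_nat (j choose i) * (-1) ^ (j - i)) * ex i m else 0)
          = (\<Sum>i\<le>j. a B j * (of_nat (j choose i) * (-1) ^ (j - i)) * ex i m)"
        using sum.inter_filter[of "{..<K}" "\<lambda>i. a B j * (of_nat (j choose i) * (-1) ^ (j - i)) * ex i m" "\<lambda>i. i \<le> j"] by simp
      moreover assume "\<And>j. y m ^ j = (\<Sum>i\<le>j. of_nat (j choose i) * ex i m * (-1) ^ (j - i))"
      ultimately show "a B j * y m ^ j = (\<Sum>i<K. if i \<le> j then a B j * (of_nat (j choose i) * (-1) ^ (j - i)) * ex i m else 0)"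
        by (simp add: sum_distrib_left mult_ac)
    qed
    also have "\<dots> = (\<Sum>i<K. \<beta> B i * ex i m)"
      unfolding \<beta>_def by (subst sum.swap) (auto simp: sum_distrib_right intro!: sum.cong)
    finally show ?thesis .
  qed
  \<comment> \<open>The factor \<open>A B\<close> must survive the expansion, since it carries the
    smallness of the conditional cumulants. The 4 is 2 from the radius 1/2 times 2 from the binomial
    coefficients.\<close>
  have \<beta>: "(\<Sum>i<K. norm (\<beta> B i)) \<le> real K ^ 2 * 4 ^ K * A B" if B: "B \<in> L" for B
  proof -
    have "norm (\<beta> B i) \<le> (\<Sum>j<K. 4 ^ K * A B)" for i
      unfolding \<beta>_def
    proof (rule sum_norm_le)
      fix j assume "j \<in> {..<K}"
      then have j: "j \<le> K" by simp
      have "real (j choose i) \<le> 2 ^ j" if "i \<le> j"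
        using binomial_le_pow2[of j i] by (metis of_nat_le_iff of_nat_numeral of_nat_power)
      then have "norm (if i \<le> j then a B j * (of_nat (j choose i) * (-1) ^ (j - i)) else 0) \<le> (A B * 2 ^ j) * 2 ^ j"
        using a[OF B, of j] A[OF B] by (auto simp: norm_mult norm_power intro!: mult_mono)
      also have "\<dots> = A B * 4 ^ j" by (simp add: power_mult_distrib[symmetric])
      also have "\<dots> \<le> A B * 4 ^ K" using A[OF B] j by (intro mult_left_mono power_increasing) auto
      finally show "norm (if i \<le> j then a B j * (of_nat (j choose i) * (-1) ^ (j - i)) else 0) \<le> 4 ^ K * A B"
        by (simp only: mult.commute)
    qed
    then have "(\<Sum>i<K. norm (\<beta> B i)) \<le> (\<Sum>i<K. \<Sum>j<K. 4 ^ K * A B)" by (intro sum_mono)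
    then show ?thesis by (simp add: power2_eq_square mult_ac)
  qed
  have gex: "exp_growth (K / \<rho>) (ex i)" if "i < K" for i
    unfolding exp_growth_def
  proof (intro exI allI)
    fix m
    have "real i * ((real m - \<mu>) / \<rho>) = (i / \<rho>) * m + - (i / \<rho> * \<mu>)"
      by (simp add: diff_divide_distrib right_diff_distrib)
    also have "\<dots> \<le> (K / \<rho>) * m + - (i / \<rho> * \<mu>)"
      using that \<rho> by (intro add_right_mono mult_right_mono divide_right_mono) auto
    also have "\<dots> \<le> (K / \<rho>) * m + K / \<rho> * \<bar>\<mu>\<bar>"
    proof -
      have "- (i / \<rho> * \<mu>) \<le> i / \<rho> * \<bar>\<mu>\<bar>"
        using \<rho> mult_left_mono[of "- \<mu>" "\<bar>\<mu>\<bar>" "i / \<rho>"] by simp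
      also have "\<dots> \<le> K / \<rho> * \<bar>\<mu>\<bar>" using that \<rho> by (intro mult_right_mono divide_right_mono) auto
      finally show ?thesis by simp
    qed
    finally have "exp (real i * ((real m - \<mu>) / \<rho>)) \<le> exp (K / \<rho> * \<bar>\<mu>\<bar>) * exp (K / \<rho> * m)"
      by (simp add: exp_add[symmetric] add.commute)
    then show "norm (ex i m) \<le> exp (K / \<rho> * \<bar>\<mu>\<bar>) * exp (K / \<rho> * m)"
      by (simp only: ex_def norm_exp_eq_Re Re_complex_of_real)
  qed
  have gu: "exp_growth (K / \<rho>) (u B)" for B
    unfolding uexp[abs_def] by (intro exp_growth_sum exp_growth_cmult gex) auto
  have gq: "exp_growth (K / \<rho>) (q B)" if "B \<in> L" for B
  proof (rule exp_growth_mono)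
    show "exp_growth 0 (q B)" by (rule exp_growth_bounded[where C = Q]) (rule qb[OF that])
  qed (use \<rho> in simp)
  have cK: "card L * (K / \<rho>) \<le> 1 / 8" "0 \<le> K / \<rho>" using c(1) \<rho> by (auto simp: c_def)
  \<comment> \<open>Multilinearity is applied to one index at a time; \<open>H\<close> holds the
    indices whose Taylor polynomial is not yet expanded into exponentials.\<close>
  have main: "norm (cumulant (U q') L) \<le> X * (\<Prod>B\<in>H. real K ^ 2 * 4 ^ K * A B)"
    if "finite H" "H \<subseteq> L" "\<And>B. B \<in> H \<Longrightarrow> q' B = u B" "\<And>B. B \<in> L - H \<Longrightarrow> \<exists>i<K. q' B = ex i" for H q'
    using that
  proof (induction H arbitrary: q' rule: finite_induct)
    case empty
    then have "\<forall>B\<in>L. \<exists>i. i < K \<and> q' B = ex i" by auto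
    then obtain \<iota> where \<iota>: "\<And>B. B \<in> L \<Longrightarrow> \<iota> B < K \<and> q' B = ex (\<iota> B)" using bchoice[of L] by metis
    have "cumulant (U q') L = cumulant (\<lambda>b. urn_mean n (\<lambda>m. \<Prod>B\<in>b. exp (of_real (\<iota> B * ((real m - \<mu>) / \<rho>))))) L"
    proof (rule cumulant_cong)
      fix b assume "b \<subseteq> L"
      then have "(\<Prod>B\<in>b. q' B m) = (\<Prod>B\<in>b. exp (of_real (\<iota> B * ((real m - \<mu>) / \<rho>))))" for m
        using \<iota> by (intro prod.cong) (auto simp: ex_def)
      then show "U q' b = urn_mean n (\<lambda>m. \<Prod>B\<in>b. exp (of_real (\<iota> B * ((real m - \<mu>) / \<rho>))))"
        by (simp only: U_def)
    qed
    then show ?case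
      using cumulant_urn_exponentials[OF L, of \<iota> K \<rho>] \<iota> \<rho> c by (simp add: X_def c_def)
  next
    case (insert B0 H)
    have B0: "B0 \<in> L" using insert.prems by auto
    have growth: "exp_growth (K / \<rho>) (q' B)" if "B \<in> L" for B
      using insert.prems(2)[of B] insert.prems(3)[of B] gu[of B] gex that by (cases "B \<in> insert B0 H") auto
    have "cumulant (U q') L = (\<Sum>i<K. \<beta> B0 i * cumulant (U (q'(B0 := ex i))) L)"
      unfolding U_def
      by (rule cumulant_urn_linear[OF L(1) B0 _ _ growth _ cK(2,1)])
        (use insert.prems(2)[of B0] uexp gex in auto)
    also have "norm \<dots> \<le> (\<Sum>i<K. norm (\<beta> B0 i) * (X * (\<Prod>B\<in>H. real K ^ 2 * 4 ^ K * A B)))"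
    proof (rule sum_norm_le)
      fix i assume i: "i \<in> {..<K}"
      have "norm (cumulant (U (q'(B0 := ex i))) L) \<le> X * (\<Prod>B\<in>H. real K ^ 2 * 4 ^ K * A B)"
      proof (rule insert.IH)
        show "H \<subseteq> L" using insert.prems by auto
        show "(q'(B0 := ex i)) B = u B" if "B \<in> H" for B
          using insert.prems(2)[of B] insert.hyps that by auto
        show "\<exists>j<K. (q'(B0 := ex i)) B = ex j" if "B \<in> L - H" for B
          using insert.prems(3)[of B] i that by (cases "B = B0") auto
      qed
      then show "norm (\<beta> B0 i * cumulant (U (q'(B0 := ex i))) L)
          \<le> norm (\<beta> B0 i) * (X * (\<Prod>B\<in>H. real K ^ 2 * 4 ^ K * A B))"
        unfolding norm_mult by (rule mult_left_mono) simp
    qed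
    also have "\<dots> = (\<Sum>i<K. norm (\<beta> B0 i)) * (X * (\<Prod>B\<in>H. real K ^ 2 * 4 ^ K * A B))"
      by (simp only: sum_distrib_right)
    also have "\<dots> \<le> (real K ^ 2 * 4 ^ K * A B0) * (X * (\<Prod>B\<in>H. real K ^ 2 * 4 ^ K * A B))"
    proof (rule mult_right_mono[OF \<beta>[OF B0]])
      have "0 \<le> X" unfolding X_def
        using moebius_mass_nonneg[of L] cluster_const_pos[of "card L" 2] by simp
      moreover have "0 \<le> (\<Prod>B\<in>H. real K ^ 2 * 4 ^ K * A B)"
        using A insert.prems(1) by (intro prod_nonneg) auto
      ultimately show "0 \<le> X * (\<Prod>B\<in>H. real K ^ 2 * 4 ^ K * A B)" by simp
    qed
    also have "\<dots> = X * (\<Prod>B\<in>insert B0 H. real K ^ 2 * 4 ^ K * A B)"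
      using insert.hyps by simp
    finally show ?case .
  qed
  have cu: "norm (cumulant (U u) L) \<le> X * (\<Prod>B\<in>L. real K ^ 2 * 4 ^ K * A B)"
    by (rule main[OF L(1)]) auto
  have QK1: "Q \<le> QK" "1 \<le> QK"
  proof -
    have "1 \<le> real K * 2 ^ K" using K mult_mono[of 1 "real K" 1 "2 ^ K"] by simp
    then have "Q * 1 \<le> Q * (real K * 2 ^ K)" using Q by (intro mult_left_mono) auto
    then show "Q \<le> QK" by (simp add: QK_def mult.assoc)
    then show "1 \<le> QK" using Q by simp
  qed
  have s1: "0 \<le> s1" "s1 \<le> 1"
  proof -
    have "0 \<le> 4 * \<delta> / \<rho>" "4 * \<delta> / \<rho> \<le> 1" using \<delta> \<rho> by (auto simp: field_simps)
    then show "0 \<le> s1" "s1 \<le> 1" by (auto simp: s1_def power_le_one)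
  qed
  have diff: "norm (U q b - U u b) \<le> approx_const l K Q * (s1 + exp (- \<theta> * \<delta>))" if b: "b \<subseteq> L" for b
  proof -
    have finb: "finite b" using b L finite_subset by blast
    have cb: "card b \<le> l" using b L by (simp add: l_def card_mono)
    define eg where "eg = l * (3 * Q) ^ l * (2 * Q * s1)"
    define eb where "eb = 2 * QK ^ l * exp (- \<theta> * \<delta>)"
    have eg0: "0 \<le> eg" using Q s1 by (simp add: eg_def)
    have eb0: "0 \<le> eb" using QK1 by (simp add: eb_def)
    define W where "W = (\<lambda>m. exp (2 * \<theta> * (real m - \<mu>)) + exp (- (2 * \<theta>) * (real m - \<mu>)))"
    have W0: "0 \<le> W m" for m by (simp add: W_def add_nonneg_nonneg)
    have pt: "norm ((\<Prod>B\<in>b. q B m) - (\<Prod>B\<in>b. u B m)) \<le> eg + eb * W m" if m: "m \<ge> 1" for m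
    proof (cases "\<bar>real m - \<mu>\<bar> \<le> \<delta>")
      case True
      have Qs: "2 * Q * s1 \<le> 2 * Q" using Q s1 by (simp add: mult_left_le)
      have "norm ((\<Prod>B\<in>b. q B m) - (\<Prod>B\<in>b. u B m)) \<le> card b * (3 * Q) ^ card b * (2 * Q * s1)"
      proof (rule norm_prod_diff_le[OF finb])
        fix B assume "B \<in> b"
        then have B: "B \<in> L" using b by auto
        show "norm (q B m) \<le> 3 * Q" using qb[OF B m] Q by simp
        show d: "norm (q B m - u B m) \<le> 2 * Q * s1" by (rule ugood[OF B m True])
        have "norm (u B m) \<le> norm (q B m) + norm (q B m - u B m)"
          using norm_triangle_sub[of "u B m" "q B m"] by (simp add: norm_minus_commute)
        then show "norm (u B m) \<le> 3 * Q" using qb[OF B m] d Qs by linarith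
      qed (use Q s1 in auto)
      also have "\<dots> \<le> eg"
        unfolding eg_def using cb Q s1 by (intro mult_right_mono mult_mono power_increasing) auto
      also have "\<dots> \<le> eg + eb * W m" using eb0 W0[of m] by simp
      finally show ?thesis .
    next
      case False
      define t where "t = \<bar>real m - \<mu>\<bar>"
      have bL: "B \<in> L" if "B \<in> b" for B using that b by auto
      have "norm (\<Prod>B\<in>b. q B m) \<le> QK ^ l"
      proof -
        have "norm (\<Prod>B\<in>b. q B m) \<le> (\<Prod>B\<in>b. QK)"
          unfolding prod_norm[symmetric] using qb[OF bL m] QK1 by (intro prod_mono) (auto intro: order_trans)
        also have "\<dots> \<le> QK ^ l" using cb QK1 by (simp add: power_increasing)
        finally show ?thesis .
      qed
      moreover have "norm (\<Prod>B\<in>b. u B m) \<le> QK ^ l * exp (\<theta> * t)"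
      proof -
        have "norm (\<Prod>B\<in>b. u B m) \<le> (\<Prod>B\<in>b. QK * exp (K * \<bar>x m\<bar>))"
          unfolding prod_norm[symmetric] using ubad[OF bL] by (intro prod_mono) auto
        also have "\<dots> = (QK * exp (K * \<bar>x m\<bar>)) ^ card b" by simp
        also have "\<dots> \<le> (QK * exp (K * \<bar>x m\<bar>)) ^ l"
          using cb QK1 mult_mono[of 1 QK 1 "exp (K * \<bar>x m\<bar>)"] by (intro power_increasing) auto
        also have "\<dots> = QK ^ l * exp (c * t)"
          using \<rho> by (simp add: power_mult_distrib c_def t_def x_def l_def flip: exp_of_nat_mult)
        also have "\<dots> \<le> QK ^ l * exp (\<theta> * t)"
          using \<theta> QK1 by (intro mult_left_mono) (auto simp: t_def intro: mult_right_mono)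
        finally show ?thesis .
      qed
      moreover have "QK ^ l \<le> QK ^ l * exp (\<theta> * t)"
        using QK1 \<theta> by (simp add: t_def mult_le_cancel_left1)
      ultimately have "norm ((\<Prod>B\<in>b. q B m) - (\<Prod>B\<in>b. u B m)) \<le> 2 * (QK ^ l * exp (\<theta> * t))"
        using norm_triangle_ineq4[of "\<Prod>B\<in>b. q B m" "\<Prod>B\<in>b. u B m"] by linarith
      \<comment> \<open>Outside the window \<open>t\<close> exceeds \<delta>, so the growth is
        dominated by the doubled rate in \<open>W\<close>, whose mean is bounded, at a gain of
        \<open>exp (- \<theta> * \<delta>)\<close>.\<close>
      also have "exp (\<theta> * t) \<le> exp (- \<theta> * \<delta>) * W m"
      proof -
        have "\<theta> * \<delta> \<le> \<theta> * t" using False \<theta> by (intro mult_left_mono) (auto simp: t_def)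
        then have "exp (\<theta> * t) \<le> exp (- \<theta> * \<delta>) * exp (2 * \<theta> * t)"
          by (simp flip: exp_add)
        also have "exp (2 * \<theta> * t) \<le> W m"
        proof (cases "real m \<ge> \<mu>")
          case True
          then have "2 * \<theta> * t = 2 * \<theta> * (real m - \<mu>)" by (simp add: t_def)
          then show ?thesis by (simp only: W_def) simp
        next
          case False
          then have "2 * \<theta> * t = - (2 * \<theta>) * (real m - \<mu>)" by (simp add: t_def algebra_simps)
          then show ?thesis by (simp only: W_def) simp
        qed
        finally show ?thesis by simp
      qed
      also have "2 * (QK ^ l * (exp (- \<theta> * \<delta>) * W m)) = eb * W m" by (simp add: eb_def)
      also have "\<dots> \<le> eg + eb * W m" using eg0 by simp
      finally show ?thesis using QK1 by (simp add: mult_left_mono)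
    qed
    obtain H where H: "(\<lambda>m. urn_law n m * W m) sums H" "H \<le> 2 * exp 256"
      using urn_exp_tail[OF \<theta>(1,2,4)] unfolding W_def by blast
    have "(\<lambda>m. urn_law n m * (eg + eb * W m)) sums (1 * eg + eb * H)"
    proof -
      have "(\<lambda>m. urn_law n m * eg + eb * (urn_law n m * W m)) sums (1 * eg + eb * H)"
        by (intro sums_add sums_mult2 sums_mult urn_law_sums H)
      then show ?thesis by (simp add: distrib_left mult_ac)
    qed
    then have "norm (urn_mean n (\<lambda>m. (\<Prod>B\<in>b. q B m) - (\<Prod>B\<in>b. u B m))) \<le> 1 * eg + eb * H"
      using pt by (intro norm_urn_mean_le) auto
    moreover have "urn_mean n (\<lambda>m. (\<Prod>B\<in>b. q B m) - (\<Prod>B\<in>b. u B m)) = U q b - U u b"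
      unfolding U_def
    proof (rule urn_mean_diff)
      show "exp_growth (card b * (K / \<rho>)) (\<lambda>m. \<Prod>B\<in>b. q B m)"
        by (rule exp_growth_prod[OF finb]) (use gq b in auto)
      show "exp_growth (card b * (K / \<rho>)) (\<lambda>m. \<Prod>B\<in>b. u B m)"
        by (rule exp_growth_prod[OF finb gu])
      have "card b * (K / \<rho>) \<le> card L * (K / \<rho>)"
        using cb cK by (intro mult_right_mono) (auto simp: l_def)
      then show "card b * (K / \<rho>) \<le> 1 / 8" using cK by linarith
    qed
    moreover have "1 * eg + eb * H \<le> approx_const l K Q * (s1 + exp (- \<theta> * \<delta>))"
    proof -
      define P1 where "P1 = 2 * Q * l * (3 * Q) ^ l"
      define P2 where "P2 = 4 * exp 256 * QK ^ l"
      have P: "0 \<le> P1" "0 \<le> P2" using Q QK1 by (auto simp: P1_def P2_def)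
      have "eb * H \<le> eb * (2 * exp 256)" using eb0 H(2) by (rule mult_left_mono[rotated])
      also have "\<dots> = P2 * exp (- \<theta> * \<delta>)" by (simp add: eb_def P2_def)
      finally have "1 * eg + eb * H \<le> P1 * s1 + P2 * exp (- \<theta> * \<delta>)"
        by (simp add: eg_def P1_def mult_ac)
      also have "\<dots> \<le> (P1 + P2) * s1 + (P1 + P2) * exp (- \<theta> * \<delta>)"
        using P s1 by (intro add_mono mult_right_mono) auto
      also have "P1 + P2 = approx_const l K Q" by (simp add: approx_const_def P1_def P2_def QK_def)
      finally show ?thesis by (simp add: distrib_left)
    qed
    ultimately show ?thesis by simp
  qed
  have ac0: "0 \<le> approx_const l K Q" using Q QK1 by (simp add: approx_const_def)
  have Uq: "norm (U q b) \<le> Q ^ l" if b: "b \<subseteq> L" for b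
  proof -
    have cb: "card b \<le> l" using b L by (simp add: l_def card_mono)
    have "norm (U q b) \<le> 1 * Q ^ l"
      unfolding U_def
    proof (rule norm_urn_mean_le)
      fix m :: nat assume m: "m \<ge> 1"
      have "norm (\<Prod>B\<in>b. q B m) \<le> (\<Prod>B\<in>b. Q)"
        unfolding prod_norm[symmetric] using qb b m by (intro prod_mono) auto
      also have "\<dots> \<le> Q ^ l" using cb Q by (simp add: power_increasing)
      finally show "norm (\<Prod>B\<in>b. q B m) \<le> Q ^ l" .
    qed (intro sums_mult2 urn_law_sums)
    then show ?thesis by simp
  qed
  \<comment> \<open>A cumulant is a fixed polynomial in the joint moments, so closeness of the
    moments suffices. \<open>M\<close> bounds the moments of \<open>q\<close> and, with the error
    added, those of \<open>u\<close>.\<close>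
  have err: "norm (cumulant (U q) L - cumulant (U u) L)
      \<le> moebius_mass L * (l * M ^ l * (approx_const l K Q * (s1 + exp (- \<theta> * \<delta>))))"
  proof -
    define e where "e = approx_const l K Q * (s1 + exp (- \<theta> * \<delta>))"
    have e0: "0 \<le> e" using ac0 s1 by (simp add: e_def)
    have "exp (- \<theta> * \<delta>) \<le> 1" using \<theta> \<delta> by simp
    then have "s1 + exp (- \<theta> * \<delta>) \<le> 2" using s1 by linarith
    from mult_left_mono[OF this ac0] have e2: "e \<le> 2 * approx_const l K Q"
      by (simp only: e_def mult.commute)
    have M1: "1 \<le> M" using Q ac0 by (simp add: M_def l_def[symmetric] add_increasing2)
    have "norm ((\<Prod>b\<in>P. U q b) - (\<Prod>b\<in>P. U u b)) \<le> l * M ^ l * e" if P: "partition_on L P" for P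
    proof -
      have finP: "finite P" using P L finite_elements by blast
      have sub: "b \<subseteq> L" if "b \<in> P" for b using that partition_onD1[OF P] by blast
      have cP: "card P \<le> l" using card_partition_le[OF L(1) P] by (simp add: l_def)
      have "norm ((\<Prod>b\<in>P. U q b) - (\<Prod>b\<in>P. U u b)) \<le> card P * M ^ card P * e"
      proof (rule norm_prod_diff_le[OF finP _ _ _ M1 e0])
        fix b assume "b \<in> P"
        note bL = sub[OF this]
        show "norm (U q b) \<le> M" using Uq[OF bL] ac0 by (simp add: M_def l_def)
        show d: "norm (U q b - U u b) \<le> e" unfolding e_def by (rule diff[OF bL])
        have "norm (U u b) \<le> norm (U q b) + norm (U q b - U u b)"
          using norm_triangle_sub[of "U u b" "U q b"] by (simp add: norm_minus_commute)
        then show "norm (U u b) \<le> M" using Uq[OF bL] d e2 by (simp add: M_def l_def)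
      qed
      also have "\<dots> \<le> l * M ^ l * e"
        using cP M1 e0 by (intro mult_right_mono mult_mono power_increasing) auto
      finally show ?thesis .
    qed
    then have "norm (\<Sum>P | partition_on L P. of_int (partition_moebius L P {L}) * ((\<Prod>b\<in>P. U q b) - (\<Prod>b\<in>P. U u b)))
        \<le> (\<Sum>P | partition_on L P. \<bar>of_int (partition_moebius L P {L})\<bar> * (l * M ^ l * e))"
      by (intro sum_norm_le) (auto simp: norm_mult intro!: mult_left_mono)
    then show ?thesis
      by (simp add: cumulant_def sum_subtractf right_diff_distrib moebius_mass_def sum_distrib_right e_def)
  qed
  have "norm (cumulant (U q) L) \<le> norm (cumulant (U u) L) + norm (cumulant (U q) L - cumulant (U u) L)"
    using norm_triangle_sub[of "cumulant (U q) L" "cumulant (U u) L"] by simp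
  then show ?thesis using cu err unfolding U_def X_def s1_def l_def by linarith
qed

end

section \<open>Spanning trees\<close>

lemma graph_connected_mono:
  assumes "graph_connected V E" "E \<subseteq> E'"
  shows "graph_connected V E'"
  using assms rtrancl_mono[of "{(x, y). {x, y} \<in> E}" "{(x, y). {x, y} \<in> E'}"]
  unfolding graph_connected_def by blast

text \<open>On a cycle through the new vertex \<open>v\<close>, its predecessor and its successor
  would both be \<open>u\<close>, which is impossible for at least three distinct vertices.\<close>

lemma is_tree_add_leaf:
  assumes tree: "is_tree A T" and T: "\<And>e. e \<in> T \<Longrightarrow> e \<subseteq> A" and u: "u \<in> A" and v: "v \<notin> A"
  shows "is_tree (insert v A) (insert {u, v} T)"
proof -
  define E where "E = insert {u, v} T"
  define R where "R = {(x, y). {x, y} \<in> E}"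
  have sym: "(y, x) \<in> R\<^sup>*" if "(x, y) \<in> R\<^sup>*" for x y
  proof -
    have "sym R" by (auto simp: sym_def R_def insert_commute)
    then show ?thesis using that by (meson sym_rtrancl symD)
  qed
  have uv: "(u, v) \<in> R\<^sup>*" "(v, u) \<in> R\<^sup>*"
    by (auto simp: R_def E_def insert_commute intro!: r_into_rtrancl)
  have A: "(x, y) \<in> R\<^sup>*" if "x \<in> A" "y \<in> A" for x y
  proof -
    have "(x, y) \<in> {(x, y). {x, y} \<in> T}\<^sup>*"
      using tree that by (auto simp: is_tree_def graph_connected_def)
    moreover have "{(x, y). {x, y} \<in> T} \<subseteq> R" by (auto simp: R_def E_def)
    ultimately show ?thesis using rtrancl_mono by blast
  qed
  have conn: "(x, y) \<in> R\<^sup>*" if "x \<in> insert v A" "y \<in> insert v A" for x y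
    using that A u uv by (metis insertE rtrancl.rtrancl_refl rtrancl_trans)
  have "\<not> is_cycle E vs" for vs
  proof
    assume cyc: "is_cycle E vs"
    define L where "L = length vs"
    have L: "L \<ge> 3" "distinct vs" and edge: "\<And>i. i < L \<Longrightarrow> {vs ! i, vs ! (Suc i mod L)} \<in> E"
      using cyc by (auto simp: is_cycle_def L_def)
    show False
    proof (cases "v \<in> set vs")
      case False
      have "{vs ! i, vs ! (Suc i mod L)} \<in> T" if "i < L" for i
      proof -
        have "Suc i mod L < L" using L(1) by simp
        then have "vs ! i \<in> set vs" "vs ! (Suc i mod L) \<in> set vs"
          using that unfolding L_def by (auto intro!: nth_mem simp del: mod_less)
        then have "vs ! i \<noteq> v" "vs ! (Suc i mod L) \<noteq> v" using False by metis+
        then show ?thesis using edge[OF that] by (auto simp: E_def doubleton_eq_iff)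
      qed
      then have "is_cycle T vs" using L by (auto simp: is_cycle_def L_def)
      then show False using tree by (auto simp: is_tree_def)
    next
      case True
      then obtain i where i: "i < L" "vs ! i = v" by (auto simp: in_set_conv_nth L_def)
      have only: "x = u" if "{x, v} \<in> E" for x
        using that T v u by (auto simp: E_def doubleton_eq_iff)
      define j where "j = (if i = 0 then L - 1 else i - 1)"
      have j: "j < L" "Suc j mod L = i" using i L by (auto simp: j_def)
      have next': "Suc i mod L < L" using L by simp
      have "vs ! j = u" using edge[OF j(1)] only i j by simp
      moreover have "vs ! (Suc i mod L) = u"
        using edge[OF i(1)] only i by (simp add: insert_commute)
      ultimately have "j = Suc i mod L"
        using L(2) j(1) next' nth_eq_iff_index_eq[of vs j "Suc i mod L"] by (simp add: L_def)
      then show False using i L j_def by (auto simp: mod_Suc split: if_splits)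
    qed
  qed
  then show ?thesis
    using conn unfolding is_tree_def graph_connected_def E_def R_def by blast
qed

text \<open>Prim's algorithm, phrased with a maximal subtree. If an edge of weight at least 1 leaves
  the subtree, its new endpoint opens no new class. If there is none, \<open>closed\<close> says
  that every outside vertex has a new class, so the bound has room for one more factor
  \<open>b\<close>.\<close>

lemma spanning_tree_with_classes:
  fixes cls :: "'v \<Rightarrow> 'c" and b :: real
  assumes fin: "finite V" and ne: "V \<noteq> {}"
    and closed: "\<And>A x y. A \<subseteq> V \<Longrightarrow> \<forall>x\<in>A. \<forall>y\<in>V - A. w {x, y} < 1 \<Longrightarrow>
      x \<in> A \<Longrightarrow> y \<in> V - A \<Longrightarrow> cls x \<noteq> cls y"
    and same: "\<And>x y. x \<in> V \<Longrightarrow> y \<in> V \<Longrightarrow> w {x, y} \<ge> 1 \<Longrightarrow> cls x = cls y"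
    and w: "\<And>x y. x \<in> V \<Longrightarrow> y \<in> V \<Longrightarrow> b \<le> w {x, y}" and b: "0 < b" "b \<le> 1"
  shows "\<exists>T. finite T \<and> (\<forall>e\<in>T. e \<subseteq> V \<and> card e = 2 \<and> w e > 0) \<and> is_tree V T
    \<and> b ^ (card (cls ` V) - 1) \<le> (\<Prod>e\<in>T. w e)"
proof -
  define Q where "Q = (\<lambda>A. A \<noteq> {} \<and> (\<exists>T. finite T \<and> (\<forall>e\<in>T. e \<subseteq> A \<and> card e = 2 \<and> w e > 0) \<and> is_tree A T
    \<and> b ^ (card (cls ` A) - 1) \<le> (\<Prod>e\<in>T. w e)))"
  obtain x0 where x0: "x0 \<in> V" using ne by blast
  have "is_tree {x0} {}"
    by (auto simp: is_tree_def graph_connected_def is_cycle_def)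
      (metis Suc_le_lessD gr_zeroI not_less_eq_eq numeral_3_eq_3 zero_less_Suc le_0_eq)
  then have "Q {x0}" unfolding Q_def by (intro conjI exI[of _ "{}"]) auto
  then have "finite {A \<in> Pow V. Q A}" "{x0} \<in> {A \<in> Pow V. Q A}" using fin x0 by auto
  then obtain A where A: "A \<subseteq> V" "Q A" and max: "\<And>A'. A' \<subseteq> V \<Longrightarrow> Q A' \<Longrightarrow> A \<subseteq> A' \<Longrightarrow> A = A'"
    using finite_has_maximal2[of "{A \<in> Pow V. Q A}" "{x0}"] by (metis (no_types, lifting) PowD PowI mem_Collect_eq)
  have finA: "finite A" using A fin finite_subset by blast
  obtain T where T: "finite T" "\<forall>e\<in>T. e \<subseteq> A \<and> card e = 2 \<and> w e > 0" "is_tree A T"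
    "b ^ (card (cls ` A) - 1) \<le> (\<Prod>e\<in>T. w e)" and Ane: "A \<noteq> {}"
    using A(2) unfolding Q_def by blast
  have add: "Q (insert v A)"
    if uv: "u \<in> A" "v \<in> V - A" and le: "b ^ (card (cls ` insert v A) - 1) \<le> w {u, v} * b ^ (card (cls ` A) - 1)" for u v
  proof -
    have wuv: "0 < w {u, v}" using w[of u v] uv A b by auto
    have new: "{u, v} \<notin> T" using T(2) uv by auto
    have "b ^ (card (cls ` insert v A) - 1) \<le> w {u, v} * (\<Prod>e\<in>T. w e)"
      using le mult_left_mono[OF T(4), of "w {u, v}"] wuv by linarith
    then have "b ^ (card (cls ` insert v A) - 1) \<le> (\<Prod>e\<in>insert {u, v} T. w e)"
      using T(1) new by simp
    moreover have "is_tree (insert v A) (insert {u, v} T)"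
      using T uv by (intro is_tree_add_leaf) auto
    moreover have "u \<noteq> v" using uv by auto
    ultimately show ?thesis
      unfolding Q_def using T wuv uv by (intro conjI exI[of _ "insert {u, v} T"]) auto
  qed
  have "A = V"
  proof (rule ccontr)
    assume "A \<noteq> V"
    then obtain y where y: "y \<in> V - A" using A by blast
    have "\<exists>v\<in>V - A. Q (insert v A)"
    proof (cases "\<exists>x\<in>A. \<exists>y\<in>V - A. 1 \<le> w {x, y}")
      case True
      then obtain u v where uv: "u \<in> A" "v \<in> V - A" "1 \<le> w {u, v}" by blast
      then have "cls u = cls v" using same[of u v] A by auto
      then have "cls ` insert v A = cls ` A" using uv(1) by (metis image_insert imageI insert_absorb)
      moreover have "0 \<le> b ^ (card (cls ` A) - 1)" using b by simp
      ultimately have "Q (insert v A)"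
        using mult_right_mono[OF uv(3), of "b ^ (card (cls ` A) - 1)"] by (intro add[OF uv(1,2)]) simp
      then show ?thesis using uv by blast
    next
      case False
      obtain u where u: "u \<in> A" using Ane by blast
      have "cls y \<notin> cls ` A"
        using closed[OF A(1) _ _ y] False by (force simp: not_le)
      then have "card (cls ` insert y A) - 1 = Suc (card (cls ` A) - 1)"
        using finA Ane by (simp add: card_gt_0_iff Suc_pred)
      moreover have "b * b ^ (card (cls ` A) - 1) \<le> w {u, y} * b ^ (card (cls ` A) - 1)"
        using w[of u y] u y A b by (intro mult_right_mono) auto
      ultimately have "Q (insert y A)" by (intro add[OF u y]) simp
      then show ?thesis using y by blast
    qed
    then show False using max A by (metis DiffE insert_subset subset_insertI insertI1)
  qed
  then show ?thesis using T by blast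
qed

lemma max_tree_weight_ge:
  assumes fin: "finite V" and T: "\<forall>e\<in>T. e \<subseteq> V \<and> card e = 2 \<and> w e > 0" "is_tree V T"
  shows "(\<Prod>e\<in>T. w e) \<le> max_tree_weight V w"
proof -
  have sub: "T \<subseteq> edges_of V w" using T by (auto simp: edges_of_def)
  have "graph_connected V (edges_of V w)"
    using T(2) graph_connected_mono[OF _ sub] by (simp add: is_tree_def)
  moreover have "finite (spanning_trees V w)"
  proof (rule finite_subset)
    show "spanning_trees V w \<subseteq> Pow (Pow V)" by (auto simp: spanning_trees_def edges_of_def)
  qed (use fin in auto)
  moreover have "T \<in> spanning_trees V w" using sub T by (simp add: spanning_trees_def)
  ultimately show ?thesis
    unfolding max_tree_weight_def by (auto intro!: Max_ge)
qed

section \<open>The bound for large \<open>n\<close>\<close>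

definition block_const :: "nat set \<Rightarrow> real" where
  "block_const B = moebius_mass B * (1 + exp (card B) ^ card B * cluster_const (card B) 2)"

text \<open>A sum in place of the maximum over all blocks, so that it depends on \<open>r\<close>
  alone; the summand 1 makes it admissible as \<open>Q\<close> in the analytic bound.\<close>

definition block_bound :: "nat \<Rightarrow> real" where
  "block_bound r = 1 + (\<Sum>B\<in>Pow {1..r}. block_const B)"

text \<open>The constant of \<open>cumulant_urn_analytic\<close> with Taylor degree
  \<open>8 * r\<close>; the last factor 2 stands for the bulk and the tail error, each at most the
  target power.\<close>

definition partition_const :: "nat \<Rightarrow> nat set set \<Rightarrow> real" where
  "partition_const r P = moebius_mass P * exp (card P) * cluster_const (card P) 2
       * (real (8 * r) ^ 2 * 4 ^ (8 * r) * block_bound r) ^ card P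
     + moebius_mass P * (card P * (block_bound r ^ card P + 2 * approx_const (card P) (8 * r) (block_bound r)) ^ card P
       * (approx_const (card P) (8 * r) (block_bound r) * 2))"

definition arc_const :: "nat \<Rightarrow> real" where
  "arc_const r = (\<Sum>P | partition_on {1..r} P. partition_const r P)"

lemma block_const_nonneg: "0 \<le> block_const B"
  using moebius_mass_nonneg[of B] cluster_const_pos[of "card B" 2] by (simp add: block_const_def)

lemma block_const_le: "B \<subseteq> {1..r} \<Longrightarrow> block_const B \<le> block_bound r"
  unfolding block_bound_def
  using member_le_sum[of B "Pow {1..r}" block_const] block_const_nonneg by simp

lemma block_bound_ge_1: "1 \<le> block_bound r"
  unfolding block_bound_def using block_const_nonneg by (simp add: sum_nonneg)

lemma moebius_mass_le_block_const: "moebius_mass B \<le> block_const B"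
  unfolding block_const_def using moebius_mass_nonneg[of B] cluster_const_pos[of "card B" 2]
  by (simp add: distrib_left)

lemma norm_cumulant_le_mass:
  assumes "finite B" "\<And>S. S \<subseteq> B \<Longrightarrow> norm (f S) \<le> 1"
  shows "norm (cumulant f B) \<le> moebius_mass B"
  unfolding cumulant_def moebius_mass_def
proof (rule sum_norm_le)
  fix P assume P: "P \<in> {P. partition_on B P}"
  have "(\<Prod>b\<in>P. norm (f b)) \<le> (\<Prod>b\<in>P. 1)"
    using assms(2) P by (intro prod_mono) (auto simp: partition_on_def)
  then have "norm (\<Prod>b\<in>P. f b) \<le> 1" by (simp add: prod_norm)
  then have "norm (of_int (partition_moebius B P {B}) :: complex) * norm (\<Prod>b\<in>P. f b)
      \<le> norm (of_int (partition_moebius B P {B}) :: complex) * 1"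
    by (intro mult_left_mono) auto
  then show "norm (of_int (partition_moebius B P {B}) * (\<Prod>b\<in>P. f b)) \<le> \<bar>of_int (partition_moebius B P {B})\<bar>"
    by (simp add: norm_mult)
qed

lemma arcs_prob_empty: "arcs_prob n {} z = 1"
  by (simp add: arcs_prob_def compatible_arcs_def arc_depth_def)

lemma joint_cumulant_eq_cumulant:
  assumes n: "n \<ge> 1" and a: "a ` {1..r} \<subseteq> arc_indices n"
  shows "complex_of_real (joint_cumulant (measure_pmf (random_set_partition n)) r (\<lambda>i. arc_var (a i)))
    = cumulant (\<lambda>S. urn_mean n (\<lambda>m. arcs_prob n (a ` S) (of_nat m))) {1..r}"
proof -
  have "complex_of_real (\<integral>\<omega>. (\<Prod>i\<in>B. arc_var (a i) \<omega>) \<partial>measure_pmf (random_set_partition n))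
      = urn_mean n (\<lambda>m. arcs_prob n (a ` B) (of_nat m))" if B: "B \<subseteq> {1..r}" for B
  proof -
    have "finite B" "a ` B \<subseteq> arc_indices n" using B a finite_subset[OF B] by auto
    then show ?thesis
      unfolding urn_mean_def expectation_arcs[OF \<open>finite B\<close> \<open>a ` B \<subseteq> arc_indices n\<close>]
      by (intro sums_unique arcs_prob_sums n)
  qed
  note eq = this
  show ?thesis
    unfolding joint_cumulant_def cumulant_def of_real_sum
  proof (rule sum.cong[OF refl])
    fix P assume "P \<in> {P. partition_on {1..r} P}"
    then have "B \<subseteq> {1..r}" if "B \<in> P" for B
      using that partition_onD1[of "{1..r}" P] by blast
    then have "(\<Prod>B\<in>P. complex_of_real (\<integral>\<omega>. (\<Prod>i\<in>B. arc_var (a i) \<omega>) \<partial>measure_pmf (random_set_partition n)))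
        = (\<Prod>B\<in>P. urn_mean n (\<lambda>m. arcs_prob n (a ` B) (of_nat m)))"
      by (intro prod.cong refl eq)
    then show "complex_of_real (of_int (partition_moebius {1..r} P {{1..r}}) *
          (\<Prod>B\<in>P. \<integral>\<omega>. (\<Prod>i\<in>B. arc_var (a i) \<omega>) \<partial>measure_pmf (random_set_partition n)))
        = of_int (partition_moebius {1..r} P {{1..r}}) * (\<Prod>B\<in>P. urn_mean n (\<lambda>m. arcs_prob n (a ` B) (of_nat m)))"
      by (simp only: of_real_mult of_real_of_int_eq of_real_prod)
  qed
qed

section \<open>Location of the mean, and conditioning on the number of urns\<close>

context urn_transform
begin

lemma urn_mean_const: "urn_mean n (\<lambda>m. 1) = 1"
  unfolding urn_mean_def using sums_of_real[OF urn_law_sums[of n], where 'a = complex]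
  by (simp add: sums_iff)

text \<open>If \<mu> were smaller, the mass beyond \<open>k\<close>, which is at least one half,
  would lie at distance more than \<delta> from \<mu>, against the bound \<open>2 * exp 256\<close>
  on the exponential moments.\<close>

lemma centre_ge:
  assumes \<theta>: "0 < \<theta>" "\<theta> \<le> 1 / 16" "(real n + 1) * \<theta>\<^sup>2 \<le> 2"
    and k: "(\<Sum>m\<le>k. urn_law n m) \<le> 1 / 2" and \<delta>: "4 * exp 256 < exp (2 * \<theta> * \<delta>)"
  shows "real k - \<delta> \<le> \<mu>"
proof (rule ccontr)
  assume "\<not> ?thesis"
  then have less: "\<mu> < real k - \<delta>" by simp
  define W where "W = (\<lambda>m. exp (2 * \<theta> * (real m - \<mu>)) + exp (- (2 * \<theta>) * (real m - \<mu>)))"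
  define e where "e = exp (2 * \<theta> * \<delta>)"
  obtain H where H: "(\<lambda>m. urn_law n m * W m) sums H" "H \<le> 2 * exp 256"
    using urn_exp_tail[OF \<theta>] unfolding W_def by blast
  have "(\<lambda>m. urn_law n m * e - (if m \<in> {..k} then urn_law n m * e else 0)) sums
      (1 * e - (\<Sum>m\<in>{..k}. urn_law n m * e))"
    by (intro sums_diff sums_mult2 urn_law_sums sums_If_finite_set) simp
  then have "1 * e - (\<Sum>m\<in>{..k}. urn_law n m * e) \<le> H"
  proof (rule sums_le[rotated])
    show "(\<lambda>m. urn_law n m * W m) sums H" by (rule H(1))
    fix m
    show "urn_law n m * e - (if m \<in> {..k} then urn_law n m * e else 0) \<le> urn_law n m * W m"
    proof (cases "m \<le> k")
      case True
      then show ?thesis using urn_law_nonneg[of n m] by (simp add: W_def add_nonneg_nonneg)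
    next
      case False
      then have "\<delta> \<le> real m - \<mu>" using less by linarith
      then have "2 * \<theta> * \<delta> \<le> 2 * \<theta> * (real m - \<mu>)" using \<theta> by (intro mult_left_mono) auto
      then have "e \<le> exp (2 * \<theta> * (real m - \<mu>))" by (simp only: e_def exp_le_cancel_iff)
      moreover have "0 < exp (- (2 * \<theta>) * (real m - \<mu>))" by (rule exp_gt_zero)
      ultimately have "e \<le> W m" unfolding W_def by linarith
      then show ?thesis using False urn_law_nonneg[of n m] by (simp add: mult_left_mono)
    qed
  qed
  moreover have "(\<Sum>m\<in>{..k}. urn_law n m * e) \<le> e / 2"
  proof -
    have "(\<Sum>m\<in>{..k}. urn_law n m * e) = (\<Sum>m\<le>k. urn_law n m) * e" by (simp only: sum_distrib_right)
    also have "\<dots> \<le> 1 / 2 * e" using k by (rule mult_right_mono) (simp add: e_def)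
    finally show ?thesis by simp
  qed
  ultimately have "e \<le> 4 * exp 256" using H(2) by linarith
  then show False using \<delta> by (simp add: e_def)
qed

text \<open>Given \<open>m\<close> urns, the moments of the arcs are sums over partitions of
  products of conditional cumulants. The means of these products are the \<open>g\<close> of
  \<open>cumulant_total\<close>; boundedness of the conditional cumulants allows the mean to be
  taken termwise.\<close>

lemma cumulant_arcs_total:
  fixes r :: nat
  assumes a: "a ` {1..r} \<subseteq> arc_indices n" and r: "r \<ge> 1"
  defines "q \<equiv> (\<lambda>B m. cumulant (\<lambda>S. arcs_prob n (a ` S) (of_nat m)) B)"
  shows "cumulant (\<lambda>S. urn_mean n (\<lambda>m. arcs_prob n (a ` S) (of_nat m))) {1..r}
    = (\<Sum>P | partition_on {1..r} P. cumulant (\<lambda>b. urn_mean n (\<lambda>m. \<Prod>B\<in>b. q B m)) P)"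
proof (rule cumulant_total)
  show "urn_mean n (\<lambda>m. \<Prod>B\<in>{}. q B m) = 1" by (simp add: urn_mean_const)
  fix S assume S: "S \<subseteq> {1..r}"
  then have finS: "finite S" by (rule finite_subset) simp
  have pt: "arcs_prob n (a ` S) (of_nat m) = (\<Sum>P | partition_on S P. 1 * (\<Prod>B\<in>P. q B m))" for m
  proof -
    have "part_sum (\<lambda>B. q B m) S = arcs_prob n (a ` S) (of_nat m)"
    proof (cases "S = {}")
      case True
      then show ?thesis by (simp add: arcs_prob_empty)
    next
      case False
      then show ?thesis unfolding q_def by (rule part_sum_cumulant[OF finS])
    qed
    then show ?thesis by (simp add: part_sum_def)
  qed
  have "urn_mean n (\<lambda>m. arcs_prob n (a ` S) (of_nat m))
      = urn_mean n (\<lambda>m. \<Sum>P | partition_on S P. 1 * (\<Prod>B\<in>P. q B m))"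
    by (simp only: pt)
  also have "\<dots> = (\<Sum>P | partition_on S P. 1 * urn_mean n (\<lambda>m. \<Prod>B\<in>P. q B m))"
  proof (rule urn_mean_linear)
    show "finite {P. partition_on S P}" by (rule finitely_many_partition_on[OF finS])
    fix P assume "P \<in> {P. partition_on S P}"
    then have P: "partition_on S P" by simp
    have "exp_growth 0 (q B)" if "B \<in> P" for B
    proof (rule exp_growth_bounded)
      fix m :: nat assume m: "m \<ge> 1"
      have B: "B \<subseteq> {1..r}" using that P S by (auto simp: partition_on_def)
      then have "finite B" by (rule finite_subset) simp
      then show "norm (q B m) \<le> moebius_mass B"
        unfolding q_def
      proof (rule norm_cumulant_le_mass)
        fix T assume "T \<subseteq> B"
        then have "a ` T \<subseteq> arc_indices n" using B a by blast
        then show "norm (arcs_prob n (a ` T) (of_nat m)) \<le> 1" using m by (rule norm_arcs_prob_le_1)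
      qed
    qed
    then have "exp_growth (real (card P) * 0) (\<lambda>m. \<Prod>B\<in>P. q B m)"
      by (intro exp_growth_prod finite_elements[OF finS P])
    then show "exp_growth 0 (\<lambda>m. \<Prod>B\<in>P. q B m)" by simp
  qed simp
  finally show "urn_mean n (\<lambda>m. arcs_prob n (a ` S) (of_nat m))
      = (\<Sum>P | partition_on S P. urn_mean n (\<lambda>m. \<Prod>B\<in>P. q B m))" by simp
qed (use r in auto)

end

text \<open>\<open>g\<close> is the fourth root of \<open>n\<close>. Constants depending on
  \<open>r\<close> are absorbed in powers of \<open>lg\<close>, and these powers in
  \<open>g\<close>. About the location of \<mu> only a lower bound is required, as it keeps the disc
  around \<mu> away from zero.\<close>

locale large_n = urn_transform +
  fixes r :: nat and lg g :: real
  assumes r: "r \<ge> 1" and lg: "lg = ln n" "10000 * real r ^ 4 \<le> lg"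
    and g: "0 < g" "real n = g ^ 4" "lg ^ 10 \<le> g"
    and centre: "g ^ 4 / (16 * lg) \<le> \<mu>"
begin

text \<open>This is \<open>1 / n\<close> up to a power of the logarithm. The exponent comes from the
  cumulants of functions of the number of urns: their small parameter has \<open>lg ^ 6\<close>, and
  one more \<open>lg\<close> absorbs the constants.\<close>

definition "\<epsilon> = lg ^ 7 / g ^ 4"

lemma r_power_bounds: "1 \<le> real r" "real r \<le> real r ^ 4" "real r ^ 2 \<le> real r ^ 4" "1 \<le> real r ^ 4"
  using r by (auto intro: self_le_power power_increasing)

lemma lg_ge: "10000 \<le> lg" "10000 * real r \<le> lg" "10000 * real r ^ 2 \<le> lg"
  using r_power_bounds lg(2) by linarith+

lemma lg_power_le: "lg ^ i \<le> g" if "i \<le> 10"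
proof -
  have "lg ^ i \<le> lg ^ 10" using that lg_ge(1) by (intro power_increasing) auto
  then show ?thesis using g(3) by simp
qed

lemma g_ge: "10000 \<le> g" using lg_power_le[of 1] lg_ge(1) by simp

lemma g_le_power: "g \<le> g ^ i" if "i \<ge> 1"
  using that g_ge by (intro self_le_power) auto

lemma \<epsilon>_bounds: "0 < \<epsilon>" "\<epsilon> \<le> 1"
proof -
  show "0 < \<epsilon>" using lg_ge(1) g by (simp add: \<epsilon>_def)
  have "lg ^ 7 \<le> g ^ 4" using lg_power_le[of 7] g_le_power[of 4] by simp
  then show "\<epsilon> \<le> 1" using g by (simp add: \<epsilon>_def)
qed

lemma inverse_n_le_\<epsilon>: "1 / real n \<le> \<epsilon>"
proof -
  have "1 \<le> lg ^ 7" using lg_ge(1) by (intro one_le_power) simp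
  then show ?thesis unfolding \<epsilon>_def g(2) using g(1) by (intro divide_right_mono) auto
qed

lemma centre_pos: "0 < \<mu>"
  using centre g lg_ge(1) by (auto intro: less_le_trans[rotated])

text \<open>On the disc \<open>norm z\<close> is at least half of the lower bound for \<mu>. For the
  second claim, \<open>1 - d / \<mu>\<close> lies between 0 and 1, and replacing \<mu> by
  \<open>z\<close> changes it by at most \<open>512 * r / (lg * n)\<close>. The third power of
  \<open>lg\<close> in the radius is what brings this below \<open>1 / n\<close>.\<close>

lemma disc_bounds:
  assumes z: "z \<in> cball (complex_of_real \<mu>) (g ^ 4 / lg ^ 3)"
  shows "norm (inverse z) \<le> lg\<^sup>2 / g ^ 4"
    and "d \<le> r \<Longrightarrow> norm (1 - of_nat d / z) \<le> 1 + 1 / real n"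
    and "z \<noteq> 0"
proof -
  have l0: "0 < lg" using lg_ge(1) by simp
  have l2: "32 \<le> lg\<^sup>2" using lg_ge(1) mult_mono[of 32 lg 1 lg] by (simp add: power2_eq_square)
  have dist: "norm (z - of_real \<mu>) \<le> g ^ 4 / lg ^ 3" using z by (simp add: dist_norm norm_minus_commute)
  have "g ^ 4 / lg ^ 3 \<le> g ^ 4 / (32 * lg)"
  proof (rule divide_left_mono)
    show "32 * lg \<le> lg ^ 3" using mult_right_mono[OF l2, of lg] l0 by (simp add: power3_eq_cube power2_eq_square)
  qed (use l0 g in auto)
  moreover have "\<mu> - norm (z - of_real \<mu>) \<le> norm z"
    using norm_triangle_ineq3[of "of_real \<mu>" "of_real \<mu> - z"] norm_triangle_sub[of "of_real \<mu>" z] centre_pos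
    by (simp add: norm_minus_commute)
  moreover have "g ^ 4 / (16 * lg) = 2 * (g ^ 4 / (32 * lg))" by simp
  ultimately have nz: "g ^ 4 / (32 * lg) \<le> norm z" using dist centre by linarith
  have pos: "0 < g ^ 4 / (32 * lg)" using g l0 by simp
  then show "z \<noteq> 0" using nz by auto
  have inv: "norm (inverse z) \<le> 32 * lg / g ^ 4"
    using le_imp_inverse_le[OF nz pos] by (simp add: norm_inverse)
  also have "\<dots> \<le> lg\<^sup>2 / g ^ 4"
    using lg_ge(1) g by (intro divide_right_mono) (auto simp: power2_eq_square)
  finally show "norm (inverse z) \<le> lg\<^sup>2 / g ^ 4" .
  show "norm (1 - of_nat d / z) \<le> 1 + 1 / real n" if d: "d \<le> r"
  proof -
    have dr: "real d \<le> real r" using d by simp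
    have "real d \<le> \<mu>"
    proof -
      have "real r * (16 * lg) \<le> lg * (16 * lg)" using lg_ge(2) l0 r_power_bounds(1) by (intro mult_right_mono) auto
      also have "\<dots> \<le> lg ^ 3" using lg_ge(1) mult_right_mono[of 16 lg "lg * lg"] by (simp add: power3_eq_cube)
      also have "\<dots> \<le> g ^ 4" using lg_power_le[of 3] g_le_power[of 4] by simp
      finally have "real r \<le> g ^ 4 / (16 * lg)" using l0 by (simp add: field_simps)
      then show ?thesis using dr centre by linarith
    qed
    then have A: "norm (1 - complex_of_nat d / of_real \<mu>) \<le> 1"
    proof -
      have "0 \<le> real d / \<mu>" "real d / \<mu> \<le> 1" using \<open>real d \<le> \<mu>\<close> centre_pos by auto
      moreover have "1 - complex_of_nat d / of_real \<mu> = of_real (1 - real d / \<mu>)" by simp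
      ultimately show ?thesis by (simp only: norm_of_real)
    qed
    have "of_nat d / of_real \<mu> - of_nat d / z = of_nat d * (z - of_real \<mu>) * (inverse z * inverse (of_real \<mu>))"
      using \<open>z \<noteq> 0\<close> centre_pos by (simp add: field_simps)
    then have "norm (of_nat d / of_real \<mu> - of_nat d / z)
        = real d * norm (z - of_real \<mu>) * (norm (inverse z) * norm (inverse (complex_of_real \<mu>)))"
      by (simp only: norm_mult norm_of_nat)
    also have "\<dots> \<le> real r * (g ^ 4 / lg ^ 3) * ((32 * lg / g ^ 4) * (16 * lg / g ^ 4))"
    proof (intro mult_mono dr dist inv)
      have "0 < g ^ 4 / (16 * lg)" using g l0 by simp
      then show "norm (inverse (complex_of_real \<mu>)) \<le> 16 * lg / g ^ 4"
        using le_imp_inverse_le[OF centre] centre_pos by (simp add: norm_inverse)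
    qed (use g l0 in auto)
    also have "\<dots> = (512 * real r / lg) / g ^ 4"
      using l0 g(1) by (simp add: field_simps power3_eq_cube)
    also have "\<dots> \<le> 1 / g ^ 4"
      using lg_ge(2) l0 g(1) r_power_bounds(1) by (intro divide_right_mono) (auto simp: field_simps)
    finally have B: "norm (of_nat d / of_real \<mu> - of_nat d / z) \<le> 1 / real n" by (simp add: g(2))
    have "1 - of_nat d / z = (1 - complex_of_nat d / of_real \<mu>) + (of_nat d / of_real \<mu> - of_nat d / z)" by simp
    then show ?thesis using norm_triangle_mono[OF A B] by metis
  qed
qed

text \<open>With \<open>W = lg^2 / n\<close> the coupling parameter is of order
  \<open>r^2 * lg^4 / n\<close>, hence below \<epsilon>. The exponent counts one for each distinct
  arc and one for each component after the first.\<close>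

lemma norm_cumulant_disc:
  fixes cls :: "nat \<Rightarrow> nat"
  assumes B: "B \<subseteq> {1..r}" "B \<noteq> {}" and a: "a ` {1..r} \<subseteq> arc_indices n"
    and cls: "\<And>i i'. i \<in> {1..r} \<Longrightarrow> i' \<in> {1..r} \<Longrightarrow> fst (a i) = fst (a i') \<or> snd (a i) = snd (a i') \<Longrightarrow> cls i = cls i'"
    and z: "z \<in> cball (complex_of_real \<mu>) (g ^ 4 / lg ^ 3)"
  shows "norm (cumulant (\<lambda>S. arcs_prob n (a ` S) z) B)
    \<le> block_bound r * \<epsilon> ^ (card (a ` B) + (card (cls ` B) - 1))"
proof -
  have finB: "finite B" by (rule finite_subset[OF B(1)]) simp
  have cB: "card B \<le> r" using card_mono[OF _ B(1)] by simp
  have cB1: "1 \<le> card B" using B(2) finB by (simp add: card_gt_0_iff Suc_le_eq)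
  define W where "W = lg\<^sup>2 / g ^ 4"
  define b where "b = 8 * (real (card B) * W)"
  have l0: "0 < lg" using lg_ge(1) by simp
  have W0: "0 \<le> W" by (simp add: W_def)
  have W\<epsilon>: "W \<le> \<epsilon>"
    unfolding W_def \<epsilon>_def using lg_ge(1) g(1) by (intro divide_right_mono power_increasing) auto
  have rW: "8 * (real r * W) * (8 * (real r * W) * real n + real r) \<le> \<epsilon>"
  proof -
    have "8 * (real r * W) * (8 * (real r * W) * real n + real r) = (8 * (real r)\<^sup>2 * lg\<^sup>2 * (8 * lg\<^sup>2 + 1)) / g ^ 4"
      using g(1) unfolding W_def g(2) by (simp add: field_simps power2_eq_square)
    also have "\<dots> \<le> lg ^ 7 / g ^ 4"
    proof (rule divide_right_mono)
      have "8 * lg\<^sup>2 + 1 \<le> 9 * lg\<^sup>2" using lg_ge(1) one_le_power[of lg 2] by simp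
      then have "8 * (real r)\<^sup>2 * lg\<^sup>2 * (8 * lg\<^sup>2 + 1) \<le> 8 * (real r)\<^sup>2 * lg\<^sup>2 * (9 * lg\<^sup>2)"
        by (intro mult_left_mono) auto
      also have "\<dots> = (72 * (real r)\<^sup>2) * lg ^ 4" by (simp add: power2_eq_square power4_eq_xxxx)
      also have "\<dots> \<le> lg * lg ^ 4" using lg_ge(3) l0 by (intro mult_right_mono) auto
      also have "\<dots> = lg ^ 5" by (simp flip: power_Suc)
      also have "\<dots> \<le> lg ^ 7" using lg_ge(1) by (intro power_increasing) auto
      finally show "8 * (real r)\<^sup>2 * lg\<^sup>2 * (8 * lg\<^sup>2 + 1) \<le> lg ^ 7" .
    qed (use g in auto)
    finally show ?thesis by (simp add: \<epsilon>_def)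
  qed
  have b0: "0 \<le> b" using W0 by (simp add: b_def)
  have br: "b \<le> 8 * (real r * W)" unfolding b_def using cB W0 by (intro mult_left_mono mult_right_mono) auto
  have bb: "b * (b * real n + real (card B)) \<le> \<epsilon>"
  proof -
    have "b * (b * real n + real (card B)) \<le> 8 * (real r * W) * (8 * (real r * W) * real n + real r)"
      using br b0 cB W0 by (intro mult_mono add_mono mult_right_mono) auto
    then show ?thesis using rW by linarith
  qed
  have cW: "real (card B) * W \<le> 1 / 8"
  proof -
    have "1 \<le> real (card B)" "0 \<le> b * real n" using cB1 b0 by simp_all
    then have "1 \<le> b * real n + real (card B)" by linarith
    then have "b * 1 \<le> b * (b * real n + real (card B))" using b0 by (rule mult_left_mono)
    then have "b \<le> 1" using bb \<epsilon>_bounds(2) by linarith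
    then show ?thesis by (simp add: b_def)
  qed
  have "norm (cumulant (\<lambda>S. arcs_prob n (a ` S) z) B) \<le>
    moebius_mass B * (W ^ card (a ` B) * exp (card B) ^ card B) * cluster_const (card B) 2
      * (b * (b * n + card B)) ^ (card (cls ` B) - 1)"
    unfolding b_def
  proof (rule norm_cumulant_arcs_prob[OF finB B(2)])
    show "real (card B) * W \<le> 1 / 8" by (rule cW)
    show "a ` B \<subseteq> arc_indices n" using a B by blast
    show "norm (inverse z) \<le> W" unfolding W_def by (rule disc_bounds(1)[OF z])
    show "W \<le> 1" using W\<epsilon> \<epsilon>_bounds(2) by linarith
    show "norm (1 - of_nat d / z) \<le> 1 + 1 / real n" if "d \<le> card B" for d
      using that cB by (intro disc_bounds(2)[OF z]) simp
    show "8 * (real (card B) * W) * (8 * (real (card B) * W) * real n + real (card B)) \<le> 1"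
      using bb \<epsilon>_bounds(2) unfolding b_def by linarith
    show "cls i = cls i'" if "i \<in> B" "i' \<in> B" "fst (a i) = fst (a i') \<or> snd (a i) = snd (a i')" for i i'
      using that B by (intro cls) auto
  qed (use n in auto)
  also have "\<dots> \<le> moebius_mass B * (\<epsilon> ^ card (a ` B) * exp (card B) ^ card B) * cluster_const (card B) 2
      * \<epsilon> ^ (card (cls ` B) - 1)"
    using W0 W\<epsilon> b0 bb \<epsilon>_bounds moebius_mass_nonneg[of B] cluster_const_pos[of "card B" 2]
    by (intro mult_mono power_mono mult_nonneg_nonneg) auto
  also have "\<dots> = (moebius_mass B * (exp (card B) ^ card B * cluster_const (card B) 2))
      * \<epsilon> ^ (card (a ` B) + (card (cls ` B) - 1))"
    by (simp add: power_add mult_ac)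
  also have "\<dots> \<le> block_bound r * \<epsilon> ^ (card (a ` B) + (card (cls ` B) - 1))"
  proof (rule mult_right_mono)
    have "moebius_mass B * (exp (card B) ^ card B * cluster_const (card B) 2) \<le> block_const B"
      unfolding block_const_def using moebius_mass_nonneg[of B] by (intro mult_left_mono) auto
    then show "moebius_mass B * (exp (card B) ^ card B * cluster_const (card B) 2) \<le> block_bound r"
      using block_const_le[OF B(1)] by linarith
  qed (use \<epsilon>_bounds in auto)
  finally show ?thesis .
qed

text \<open>The conditional cumulants are analytic on the scale \<rho>, which is \<open>n\<close> up
  to logarithms, and bounded there by the small numbers \<open>A B\<close>. The remaining
  \<open>card P - 1\<close> powers of \<epsilon> come from \<open>64 * c^2 * (n + 1)\<close>, the
  small parameter for cumulants of functions of the number of urns.\<close>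

lemma cumulant_arcs_partition_bound:
  fixes cls :: "nat \<Rightarrow> nat"
  assumes P: "partition_on {1..r} P" and a: "a ` {1..r} \<subseteq> arc_indices n"
    and cls: "\<And>i i'. i \<in> {1..r} \<Longrightarrow> i' \<in> {1..r} \<Longrightarrow> fst (a i) = fst (a i') \<or> snd (a i) = snd (a i') \<Longrightarrow> cls i = cls i'"
  defines "q \<equiv> (\<lambda>B m. cumulant (\<lambda>S. arcs_prob n (a ` S) (of_nat m)) B)"
  shows "norm (cumulant (\<lambda>b. urn_mean n (\<lambda>m. \<Prod>B\<in>b. q B m)) P)
    \<le> partition_const r P * \<epsilon> ^ (card (a ` {1..r}) + card (cls ` {1..r}) - 1)"
proof -
  \<comment> \<open>The scales are balanced so that both errors are below \<open>n\<close> to the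
    power \<open>- 2 * r\<close>. The rate \<theta> = \<open>1 / sqrt n\<close> still has bounded
    exponential moments, and the window \<delta> = \<open>sqrt n * lg^2\<close> makes
    \<open>exp (- \<theta> * \<delta>) = exp (- lg^2)\<close>. Then
    \<open>4 * \<delta> / \<rho>\<close> is at most \<open>1 / g\<close>, and
    \<open>K = 8 * r\<close> is the degree that turns the fourth root of \<open>1 / n\<close> into
    that power.\<close>
  define K where "K = 8 * r"
  define \<rho> where "\<rho> = g ^ 4 / lg ^ 3"
  define \<delta> where "\<delta> = g\<^sup>2 * lg\<^sup>2"
  define \<theta> where "\<theta> = 1 / g\<^sup>2"
  define Q where "Q = block_bound r"
  define A where "A = (\<lambda>B. Q * \<epsilon> ^ (card (a ` B) + (card (cls ` B) - 1)))"
  define l where "l = card P"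
  define c where "c = real (card P) * real K / \<rho>"
  define D where "D = card (a ` {1..r}) + card (cls ` {1..r}) - 1"
  have l0: "0 < lg" using lg_ge(1) by simp
  have finP: "finite P" using P finite_elements by blast
  have neP: "P \<noteq> {}" using P r by (auto simp: partition_on_def)
  have lr: "1 \<le> l" "l \<le> r"
    using neP finP card_partition_le[OF _ P] by (auto simp: l_def card_gt_0_iff Suc_le_eq)
  have sub: "B \<subseteq> {1..r}" "B \<noteq> {}" if "B \<in> P" for B using that P by (auto simp: partition_on_def)
  have \<rho>0: "0 < \<rho>" using l0 g by (simp add: \<rho>_def)
  have Q1: "1 \<le> Q" unfolding Q_def by (rule block_bound_ge_1)
  have c_eq: "c = 8 * (real l * real r) * lg ^ 3 / g ^ 4"
    using l0 g(1) by (simp add: c_def l_def K_def \<rho>_def field_simps)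
  have lr2: "1 \<le> real l * real r" "real l * real r \<le> (real r)\<^sup>2"
  proof -
    show "1 \<le> real l * real r" using lr r mult_mono[of 1 "real l" 1 "real r"] by simp
    show "real l * real r \<le> (real r)\<^sup>2" using lr by (simp add: power2_eq_square mult_right_mono)
  qed
  have lK: "8 * (real l * real r) * lg ^ 3 \<le> g / 16"
  proof -
    have "8 * (real l * real r) * 16 \<le> lg" using lr2 lg_ge(3) by linarith
    then have "8 * (real l * real r) * 16 * lg ^ 3 \<le> lg * lg ^ 3" using l0 by (intro mult_right_mono) auto
    also have "\<dots> = lg ^ 4" by (simp flip: power_Suc)
    also have "\<dots> \<le> g" by (rule lg_power_le) simp
    finally show ?thesis by simp
  qed
  have g2: "g \<le> g\<^sup>2" "g\<^sup>2 \<le> g ^ 4" using g_le_power[of 2] g_ge by (auto intro: power_increasing)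
  have g4: "g ^ 4 = g\<^sup>2 * g\<^sup>2" by (simp flip: power_add)
  have c\<theta>: "c \<le> \<theta>"
  proof -
    have "c \<le> g / 16 / g ^ 4" unfolding c_eq using lK by (intro divide_right_mono) auto
    also have "\<dots> \<le> g\<^sup>2 / g ^ 4" using g2 g by (intro divide_right_mono) auto
    also have "\<dots> = \<theta>"
      unfolding g4 \<theta>_def by (rule nonzero_divide_mult_cancel_left) (use g(1) in simp)
    finally show ?thesis .
  qed
  have \<theta>: "0 < \<theta>" "\<theta> \<le> 1 / 16" "(real n + 1) * \<theta>\<^sup>2 \<le> 2"
  proof -
    show "0 < \<theta>" using g by (simp add: \<theta>_def)
    have "16 \<le> g\<^sup>2" using g_ge g2 by linarith
    then show "\<theta> \<le> 1 / 16" using g(1) by (simp add: \<theta>_def field_simps)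
    have "\<theta>\<^sup>2 = 1 / g ^ 4" by (simp add: \<theta>_def power_divide flip: power_mult)
    then have "(real n + 1) * \<theta>\<^sup>2 = 1 + 1 / g ^ 4"
      using g(1) by (simp add: g(2) add_divide_distrib)
    also have "\<dots> \<le> 2" using g_ge g_le_power[of 4] g(1) by (simp add: field_simps)
    finally show "(real n + 1) * \<theta>\<^sup>2 \<le> 2" .
  qed
  have c1: "c \<le> 1 / 8" using c\<theta> \<theta> by linarith
  have c2: "1 \<le> (real n + 1) * (8 * c)"
  proof -
    have "1 * 1 \<le> (real l * real r) * lg ^ 3"
      using lr2 lg_ge(1) one_le_power[of lg 3] by (intro mult_mono) auto
    then have "1 \<le> 64 * ((real l * real r) * lg ^ 3)" by linarith
    also have "\<dots> = real n * (8 * c)" using g(1) by (simp add: c_eq g(2))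
    also have "\<dots> \<le> (real n + 1) * (8 * c)" using l0 by (intro mult_right_mono) (auto simp: c_eq)
    finally show ?thesis .
  qed
  have c3: "64 * c\<^sup>2 * (real n + 1) \<le> \<epsilon>"
  proof -
    have "real n + 1 \<le> 2 * g ^ 4" using g_ge g_le_power[of 4] by (simp add: g(2))
    then have "64 * c\<^sup>2 * (real n + 1) \<le> 64 * c\<^sup>2 * (2 * g ^ 4)" by (intro mult_left_mono) auto
    also have "\<dots> = 8192 * (real l * real r)\<^sup>2 * lg ^ 6 / g ^ 4"
    proof -
      define G where "G = g ^ 4"
      define X where "X = 8 * (real l * real r) * lg ^ 3"
      have G: "0 < G" using g(1) by (simp add: G_def)
      have "X\<^sup>2 = 64 * (real l * real r)\<^sup>2 * lg ^ 6"
        by (simp add: X_def power_mult_distrib flip: power_mult)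
      moreover have "64 * (X / G)\<^sup>2 * (2 * G) = 128 * X\<^sup>2 / G"
        using G by (simp add: power2_eq_square)
      ultimately show ?thesis by (simp add: c_eq X_def[symmetric] G_def[symmetric])
    qed
    also have "\<dots> \<le> lg ^ 7 / g ^ 4"
    proof (rule divide_right_mono)
      have "(real l * real r)\<^sup>2 \<le> ((real r)\<^sup>2)\<^sup>2" using lr2 by (intro power_mono) auto
      moreover have "((real r)\<^sup>2)\<^sup>2 = real r ^ 4" by (simp flip: power_mult)
      ultimately have "8192 * (real l * real r)\<^sup>2 \<le> lg" using lg(2) r_power_bounds(4) by linarith
      then have "8192 * (real l * real r)\<^sup>2 * lg ^ 6 \<le> lg * lg ^ 6" using l0 by (intro mult_right_mono) auto
      then show "8192 * (real l * real r)\<^sup>2 * lg ^ 6 \<le> lg ^ 7" by (simp flip: power_Suc)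
    qed (use g in auto)
    finally show ?thesis by (simp add: \<epsilon>_def)
  qed
  have \<delta>\<rho>: "4 * \<delta> / \<rho> \<le> 1 / g"
  proof -
    have "4 * lg ^ 5 \<le> lg * lg ^ 5" using lg_ge(1) l0 by (intro mult_right_mono) auto
    also have "\<dots> = lg ^ 6" by (simp flip: power_Suc)
    also have "\<dots> \<le> g" by (rule lg_power_le) simp
    finally have "4 * lg ^ 5 / g\<^sup>2 \<le> g / g\<^sup>2" by (intro divide_right_mono) auto
    moreover have "4 * \<delta> / \<rho> = 4 * lg ^ 5 / g\<^sup>2"
    proof -
      have e5: "lg ^ 5 = lg\<^sup>2 * lg ^ 3" by (simp flip: power_add)
      show ?thesis unfolding \<delta>_def \<rho>_def g4 e5 using g(1) l0 by (simp add: field_simps)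
    qed
    moreover have "g / g\<^sup>2 = 1 / g" using g(1) by (simp add: power2_eq_square)
    ultimately show ?thesis by simp
  qed
  have \<delta>8: "8 * \<delta> \<le> \<rho>"
  proof -
    have "1 / g \<le> 1 / 2" using g_ge by (simp add: field_simps)
    then have "4 * \<delta> / \<rho> \<le> 1 / 2" using \<delta>\<rho> by linarith
    then have "4 * \<delta> \<le> 1 / 2 * \<rho>" using \<rho>0 by (simp only: divide_le_eq if_True)
    then show ?thesis by linarith
  qed
  have A: "0 \<le> A B \<and> A B \<le> Q" for B
    using Q1 \<epsilon>_bounds by (auto simp: A_def intro!: mult_left_le power_le_one)
  have bound: "norm (cumulant (\<lambda>b. urn_mean n (\<lambda>m. \<Prod>B\<in>b. q B m)) P)
    \<le> moebius_mass P * exp (real (card P)) * cluster_const (card P) 2 * (64 * c\<^sup>2 * (real n + 1)) ^ (card P - 1)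
        * (\<Prod>B\<in>P. real K ^ 2 * 4 ^ K * A B)
      + moebius_mass P * (card P * (Q ^ card P + 2 * approx_const (card P) K Q) ^ card P
         * (approx_const (card P) K Q * ((4 * \<delta> / \<rho>) ^ K + exp (- \<theta> * \<delta>))))"
    unfolding c_def
  proof (rule cumulant_urn_analytic[where f = "\<lambda>B z. cumulant (\<lambda>S. arcs_prob n (a ` S) z) B"])
    show "64 * (real (card P) * real K / \<rho>)\<^sup>2 * (real n + 1) \<le> 1" using c3 \<epsilon>_bounds unfolding c_def by linarith
    fix B assume B: "B \<in> P"
    show "0 \<le> A B \<and> A B \<le> Q" by (rule A)
    show "(\<lambda>z. cumulant (\<lambda>S. arcs_prob n (a ` S) z) B) holomorphic_on cball (of_real \<mu>) \<rho>"
    proof -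
      have "(\<lambda>z. arcs_prob n S z) holomorphic_on cball (of_real \<mu>) \<rho>" for S
      proof (cases "compatible_arcs S")
        case True
        have "(\<lambda>z. inverse z ^ card S * (\<Prod>p\<in>{1..n} - snd ` S. 1 - of_nat (arc_depth S p) / z)) holomorphic_on cball (of_real \<mu>) \<rho>"
          unfolding \<rho>_def using disc_bounds(3) by (intro holomorphic_intros) auto
        then show ?thesis using True by (simp add: arcs_prob_def)
      qed (simp add: arcs_prob_def)
      then show ?thesis unfolding cumulant_def by (intro holomorphic_intros)
    qed
    show "norm (cumulant (\<lambda>S. arcs_prob n (a ` S) z) B) \<le> A B" if "z \<in> cball (of_real \<mu>) \<rho>" for z
      unfolding A_def Q_def using that sub[OF B] by (intro norm_cumulant_disc a cls) (auto simp: \<rho>_def)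
    fix m :: nat assume m: "m \<ge> 1"
    show "q B m = cumulant (\<lambda>S. arcs_prob n (a ` S) (of_nat m)) B" by (simp add: q_def)
    have "norm (q B m) \<le> moebius_mass B"
      unfolding q_def
    proof (rule norm_cumulant_le_mass)
      show "finite B" by (rule finite_subset[OF sub(1)[OF B]]) simp
      fix T assume "T \<subseteq> B"
      then have "a ` T \<subseteq> arc_indices n" using sub[OF B] a by blast
      then show "norm (arcs_prob n (a ` T) (of_nat m)) \<le> 1" using m by (rule norm_arcs_prob_le_1)
    qed
    then show "norm (q B m) \<le> Q"
      using moebius_mass_le_block_const[of B] block_const_le[OF sub(1)[OF B]] unfolding Q_def by linarith
  qed (use finP neP r \<rho>0 c1 c2 c\<theta> \<theta> \<delta>8 Q1 g l0 in \<open>auto simp: K_def \<delta>_def c_def\<close>)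
  \<comment> \<open>The block exponents lose 1 per block, that is \<open>card P\<close> in all, and
    the cumulant over \<open>P\<close> gives back \<open>card P - 1\<close>. The numbers of distinct
    arcs and of labels are subadditive over blocks.\<close>
  have expo: "card (a ` {1..r}) + card (cls ` {1..r}) - 1
      \<le> (card P - 1) + (\<Sum>B\<in>P. card (a ` B) + (card (cls ` B) - 1))"
  proof -
    have U: "{1..r} = \<Union>P" by (rule partition_onD1[OF P])
    have "card (f ` {1..r}) \<le> (\<Sum>B\<in>P. card (f ` B))" for f :: "nat \<Rightarrow> 'z"
    proof -
      have "f ` {1..r} = (\<Union>B\<in>P. f ` B)" unfolding U by auto
      then show ?thesis using card_UN_le[OF finP, of "\<lambda>B. f ` B"] by simp
    qed
    note le = this
    have "(\<Sum>B\<in>P. card (cls ` B)) = (\<Sum>B\<in>P. (card (cls ` B) - 1) + 1)"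
    proof (rule sum.cong[OF refl])
      fix B assume "B \<in> P"
      then have "cls ` B \<noteq> {}" "finite (cls ` B)"
        using sub[OF \<open>B \<in> P\<close>] finite_subset[of B "{1..r}"] by auto
      then have "1 \<le> card (cls ` B)" by (simp add: card_gt_0_iff Suc_le_eq)
      then show "card (cls ` B) = (card (cls ` B) - 1) + 1" by simp
    qed
    also have "\<dots> = (\<Sum>B\<in>P. card (cls ` B) - 1) + card P"
      by (simp only: sum.distrib) simp
    finally have "(\<Sum>B\<in>P. card (cls ` B)) = (\<Sum>B\<in>P. card (cls ` B) - 1) + card P" .
    then show ?thesis using le[of a] le[of cls] lr(1) by (simp add: sum.distrib l_def)
  qed
  have first: "(64 * c\<^sup>2 * (real n + 1)) ^ (card P - 1) * (\<Prod>B\<in>P. real K ^ 2 * 4 ^ K * A B)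
      \<le> (real K ^ 2 * 4 ^ K * Q) ^ card P * \<epsilon> ^ D"
  proof -
    have "(\<Prod>B\<in>P. real K ^ 2 * 4 ^ K * A B)
        = (real K ^ 2 * 4 ^ K * Q) ^ card P * \<epsilon> ^ (\<Sum>B\<in>P. card (a ` B) + (card (cls ` B) - 1))"
      by (simp add: A_def mult.assoc[symmetric] prod.distrib power_sum)
    moreover have "(64 * c\<^sup>2 * (real n + 1)) ^ (card P - 1) \<le> \<epsilon> ^ (card P - 1)"
      using c3 by (intro power_mono) auto
    ultimately have "(64 * c\<^sup>2 * (real n + 1)) ^ (card P - 1) * (\<Prod>B\<in>P. real K ^ 2 * 4 ^ K * A B)
        \<le> \<epsilon> ^ (card P - 1) * ((real K ^ 2 * 4 ^ K * Q) ^ card P * \<epsilon> ^ (\<Sum>B\<in>P. card (a ` B) + (card (cls ` B) - 1)))"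
      using Q1 \<epsilon>_bounds by (simp only:) (intro mult_right_mono, auto)
    also have "\<dots> = (real K ^ 2 * 4 ^ K * Q) ^ card P * \<epsilon> ^ ((card P - 1) + (\<Sum>B\<in>P. card (a ` B) + (card (cls ` B) - 1)))"
      by (simp only: power_add mult_ac)
    also have "\<dots> \<le> (real K ^ 2 * 4 ^ K * Q) ^ card P * \<epsilon> ^ D"
      using expo \<epsilon>_bounds Q1 unfolding D_def by (intro mult_left_mono power_decreasing) auto
    finally show ?thesis .
  qed
  \<comment> \<open>As \<open>D\<close> is at most \<open>2 * r\<close>, it suffices that each error
    is at most \<open>(1 / n) ^ (2 * r)\<close>.\<close>
  have second: "(4 * \<delta> / \<rho>) ^ K + exp (- \<theta> * \<delta>) \<le> 2 * \<epsilon> ^ D"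
  proof -
    have "D \<le> 2 * r"
      using card_image_le[of "{1..r}" a] card_image_le[of "{1..r}" cls] by (simp add: D_def)
    have "(1 / real n) ^ (2 * r) \<le> (1 / real n) ^ D"
      using \<open>D \<le> 2 * r\<close> n by (intro power_decreasing) auto
    also have "\<dots> \<le> \<epsilon> ^ D" using inverse_n_le_\<epsilon> by (intro power_mono) auto
    finally have nD: "(1 / real n) ^ (2 * r) \<le> \<epsilon> ^ D" .
    have "(4 * \<delta> / \<rho>) ^ K \<le> (1 / g) ^ K"
      using \<delta>\<rho> \<rho>0 by (intro power_mono) (auto simp: \<delta>_def)
    also have "\<dots> = (1 / real n) ^ (2 * r)"
      unfolding K_def g(2) by (simp add: power_divide flip: power_mult)
    finally have 1: "(4 * \<delta> / \<rho>) ^ K \<le> \<epsilon> ^ D" using nD by linarith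
    have "\<theta> * \<delta> = lg\<^sup>2" using g(1) by (simp add: \<theta>_def \<delta>_def)
    moreover have "real (2 * r) * lg \<le> lg\<^sup>2"
      unfolding power2_eq_square using lg_ge(2) l0 r_power_bounds(1) by (intro mult_right_mono) auto
    ultimately have "exp (- \<theta> * \<delta>) \<le> exp (- (real (2 * r) * lg))" by simp
    also have "\<dots> = (1 / real n) ^ (2 * r)"
    proof -
      have "exp (- (real (2 * r) * lg)) = exp (- lg) ^ (2 * r)"
        by (simp only: exp_of_nat_mult[symmetric]) simp
      also have "exp (- lg) = 1 / real n" using n by (simp add: lg(1) exp_minus divide_inverse)
      finally show ?thesis .
    qed
    finally have "exp (- \<theta> * \<delta>) \<le> \<epsilon> ^ D" using nD by linarith
    with 1 show ?thesis by linarith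
  qed
  have ac: "0 \<le> approx_const (card P) K Q" using Q1 by (simp add: approx_const_def)
  define E1 where "E1 = moebius_mass P * exp (real (card P)) * cluster_const (card P) 2"
  define E2 where "E2 = moebius_mass P * (card P * (Q ^ card P + 2 * approx_const (card P) K Q) ^ card P * approx_const (card P) K Q)"
  have E: "0 \<le> E1" "0 \<le> E2"
    using moebius_mass_nonneg[of P] cluster_const_pos[of "card P" 2] ac Q1
    by (auto simp: E1_def E2_def intro!: mult_nonneg_nonneg zero_le_power add_nonneg_nonneg)
  have "norm (cumulant (\<lambda>b. urn_mean n (\<lambda>m. \<Prod>B\<in>b. q B m)) P)
    \<le> E1 * ((64 * c\<^sup>2 * (real n + 1)) ^ (card P - 1) * (\<Prod>B\<in>P. real K ^ 2 * 4 ^ K * A B))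
      + E2 * ((4 * \<delta> / \<rho>) ^ K + exp (- \<theta> * \<delta>))"
    using bound unfolding E1_def E2_def by (simp only: mult.assoc)
  also have "\<dots> \<le> E1 * ((real K ^ 2 * 4 ^ K * Q) ^ card P * \<epsilon> ^ D) + E2 * (2 * \<epsilon> ^ D)"
    by (intro add_mono mult_left_mono first second E)
  also have "\<dots> = partition_const r P * \<epsilon> ^ D"
    unfolding partition_const_def E1_def E2_def K_def Q_def by (simp only: mult.assoc distrib_right mult.left_commute)
  finally show ?thesis by (simp only: D_def)
qed

lemma cumulant_arcs_bound:
  fixes cls :: "nat \<Rightarrow> nat"
  assumes a: "a ` {1..r} \<subseteq> arc_indices n"
    and cls: "\<And>i i'. i \<in> {1..r} \<Longrightarrow> i' \<in> {1..r} \<Longrightarrow> fst (a i) = fst (a i') \<or> snd (a i) = snd (a i') \<Longrightarrow> cls i = cls i'"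
  shows "\<bar>joint_cumulant (measure_pmf (random_set_partition n)) r (\<lambda>i. arc_var (a i))\<bar>
    \<le> arc_const r * \<epsilon> ^ (card (a ` {1..r}) + card (cls ` {1..r}) - 1)"
proof -
  have "\<bar>joint_cumulant (measure_pmf (random_set_partition n)) r (\<lambda>i. arc_var (a i))\<bar>
      = norm (cumulant (\<lambda>S. urn_mean n (\<lambda>m. arcs_prob n (a ` S) (of_nat m))) {1..r})"
    unfolding joint_cumulant_eq_cumulant[OF n a, symmetric] by simp
  also have "\<dots> \<le> (\<Sum>P | partition_on {1..r} P. partition_const r P * \<epsilon> ^ (card (a ` {1..r}) + card (cls ` {1..r}) - 1))"
    unfolding cumulant_arcs_total[OF a r]
    by (intro sum_norm_le cumulant_arcs_partition_bound a cls) auto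
  also have "\<dots> = arc_const r * \<epsilon> ^ (card (a ` {1..r}) + card (cls ` {1..r}) - 1)"
    by (simp only: arc_const_def sum_distrib_right)
  finally show ?thesis .
qed

end

section \<open>The weighted dependency graph\<close>

text \<open>What remains is the lower bound on the mean. Up to \<open>k\<close>, about
  \<open>n / (4 * ln n)\<close>, the weights of the urn law at least double, because
  \<open>(m / (m + 1)) ^ n\<close> is at most \<open>exp (- n / (m + 1))\<close>, which is at most
  \<open>1 / n^2\<close>. Concentration then forbids \<mu> to lie more than \<delta> below
  \<open>k\<close>.\<close>

lemma large_n_intro:
  assumes r: "r \<ge> 1" and n: "n \<ge> 1" and lg: "10000 * real r ^ 4 \<le> ln (real n)"
    and growth: "ln (real n) ^ 10 \<le> sqrt (sqrt (real n))"
  shows "\<exists>\<Phi> \<mu> g. large_n n \<Phi> \<mu> r (ln (real n)) g"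
proof -
  obtain \<Phi> where \<Phi>: "\<Phi> holomorphic_on cball 0 (1 / 4)" "\<Phi> 0 = 0"
    "\<And>v. v \<in> cball 0 (1 / 4) \<Longrightarrow> norm (\<Phi> v) \<le> real n + 1"
    "\<And>v. v \<in> cball 0 (1 / 4) \<Longrightarrow> (\<lambda>m. of_real (urn_law n m) * exp (v * of_nat m)) sums exp (\<Phi> v)"
    using urn_law_cgf[of n] by blast
  define \<mu> where "\<mu> = Re (deriv \<Phi> 0)"
  interpret urn_transform n \<Phi> \<mu> by unfold_locales (use n \<Phi> \<mu>_def in auto)
  define l where "l = ln (real n)"
  define g where "g = sqrt (sqrt (real n))"
  have r4: "1 \<le> real r ^ 4" using r by (intro one_le_power) simp
  then have l: "10000 \<le> l" using lg by (simp add: l_def)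
  have g0: "0 < g" using n by (simp add: g_def)
  have lg_g: "l ^ i \<le> g" if "i \<le> 10" for i
  proof -
    have "l ^ i \<le> l ^ 10" using that l by (intro power_increasing) auto
    then show ?thesis using growth by (simp add: l_def g_def)
  qed
  have g1: "10000 \<le> g" using lg_g[of 1] l by simp
  have gg: "g\<^sup>2 * g\<^sup>2 = g ^ 4" by (simp flip: power_add)
  have ng: "real n = g ^ 4"
    unfolding gg[symmetric] using n by (simp add: g_def)
  have g2: "g \<le> g\<^sup>2" "g\<^sup>2 \<le> g ^ 4" "g \<le> g ^ 4" using g1 by (auto intro: self_le_power power_increasing)
  define k where "k = nat \<lfloor>real n / (4 * l)\<rfloor>"
  have nl: "4 \<le> real n / (4 * l)"
  proof -
    have "16 * l \<le> l * l" using l by (intro mult_right_mono) auto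
    also have "\<dots> = l ^ 2" by (simp add: power2_eq_square)
    also have "\<dots> \<le> real n" using lg_g[of 2] g2 by (simp add: ng)
    finally show ?thesis using l by (simp add: field_simps)
  qed
  have k: "real k \<le> real n / (4 * l)" "real n / (4 * l) - 1 \<le> real k"
    using nl by (auto simp: k_def)
  have tail: "(\<Sum>m\<le>k. urn_law n m) \<le> 1 / 2"
  proof (rule urn_law_lower_tail[OF n])
    fix m assume m: "1 \<le> m" "m \<le> k"
    define t where "t = real m + 1"
    have t0: "0 < t" by (simp add: t_def)
    have t: "t \<le> real n / (2 * l)"
    proof -
      have "t \<le> real n / (4 * l) + 1" using m k by (simp add: t_def)
      also have "\<dots> \<le> real n / (4 * l) + real n / (4 * l)" using nl by simp
      also have "\<dots> = real n / (2 * l)" by simp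
      finally show ?thesis .
    qed
    have "real m / t \<le> exp (- (1 / t))"
      using exp_ge_add_one_self[of "- (1 / t)"] t0 by (simp add: t_def field_simps)
    then have "(real m / t) ^ n \<le> exp (- (1 / t)) ^ n" using t0 by (intro power_mono) auto
    also have "\<dots> = exp (- (real n / t))" by (simp flip: exp_of_nat_mult)
    also have "\<dots> \<le> exp (- (2 * l))" using t t0 l by (simp add: field_simps)
    also have "exp (- (2 * l)) = 1 / real n ^ 2"
    proof -
      have "exp (- (2 * l)) = exp (- l) ^ 2" by (simp flip: exp_of_nat_mult)
      also have "exp (- l) = 1 / real n" using n by (simp add: l_def exp_minus divide_inverse)
      finally show ?thesis by (simp add: power_divide)
    qed
    finally have "real m ^ n * real n ^ 2 \<le> t ^ n"
      using t0 n by (simp add: power_divide field_simps)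
    moreover have "2 * t \<le> real n ^ 2"
    proof -
      have "real n / (2 * l) \<le> real n / 2" using l n by (intro divide_left_mono) auto
      then have "2 * t \<le> real n" using t by simp
      also have "\<dots> \<le> real n ^ 2" using n by (intro self_le_power) auto
      finally show ?thesis .
    qed
    ultimately have "2 * t * real m ^ n \<le> t ^ n"
      using mult_right_mono[of "2 * t" "real n ^ 2" "real m ^ n"] by (simp add: mult.commute)
    then show "2 * (real m + 1) * real m ^ n \<le> (real m + 1) ^ n" by (simp add: t_def)
  qed
  define \<theta> where "\<theta> = 1 / g\<^sup>2"
  define \<delta> where "\<delta> = g\<^sup>2 * l\<^sup>2"
  have "real k - \<delta> \<le> \<mu>"
  proof (rule centre_ge[OF _ _ _ tail])
    show "0 < \<theta>" using g0 by (simp add: \<theta>_def)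
    show "\<theta> \<le> 1 / 16" using g1 g2 by (simp add: \<theta>_def field_simps)
    have "(real n + 1) * \<theta>\<^sup>2 = (g ^ 4 + 1) / g ^ 4"
      by (simp add: ng \<theta>_def power_divide flip: power_mult)
    also have "\<dots> \<le> 2" using g1 g2 by (simp add: field_simps)
    finally show "(real n + 1) * \<theta>\<^sup>2 \<le> 2" .
    have "(4 :: real) \<le> exp 3" using exp_ge_add_one_self[of 3] by simp
    then have "4 * exp 256 \<le> exp 3 * exp (256 :: real)" by (intro mult_right_mono) auto
    also have "\<dots> = exp 259" by (simp flip: exp_add)
    also have "(259 :: real) < 2 * \<theta> * \<delta>"
    proof -
      have "2 * \<theta> * \<delta> = 2 * l\<^sup>2" using g0 by (simp add: \<theta>_def \<delta>_def)
      moreover have "l \<le> l\<^sup>2" using l by (intro self_le_power) auto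
      ultimately show ?thesis using l by simp
    qed
    finally show "4 * exp 256 < exp (2 * \<theta> * \<delta>)" by simp
  qed
  \<comment> \<open>The 1 pays for rounding \<open>k\<close> down; together with \<delta> it uses up
    at most half of \<open>n / (4 * l)\<close>.\<close>
  moreover have "1 + \<delta> \<le> g ^ 4 / (8 * l)"
  proof -
    have l2: "1 \<le> l\<^sup>2" using l by (intro one_le_power) simp
    have "1 * 1 \<le> g\<^sup>2 * l\<^sup>2" using l2 g1 g2 by (intro mult_mono) auto
    then have "1 + \<delta> \<le> 2 * (g\<^sup>2 * l\<^sup>2)" by (simp add: \<delta>_def)
    also have "\<dots> \<le> g ^ 4 / (8 * l)"
    proof -
      have "16 * l ^ 3 \<le> l * l ^ 3" using l by (intro mult_right_mono) auto
      also have "\<dots> = l ^ 4" by (simp flip: power_Suc)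
      also have "\<dots> \<le> g\<^sup>2" using lg_g[of 4] g2 by simp
      finally have "g\<^sup>2 * (16 * l ^ 3) \<le> g\<^sup>2 * g\<^sup>2" by (intro mult_left_mono) auto
      then show ?thesis using l by (simp add: gg field_simps power2_eq_square power3_eq_cube power4_eq_xxxx)
    qed
    finally show ?thesis .
  qed
  moreover have "g ^ 4 / (4 * l) = 2 * (g ^ 4 / (8 * l))" "g ^ 4 / (8 * l) = 2 * (g ^ 4 / (16 * l))" by simp_all
  moreover have "0 \<le> g ^ 4 / (16 * l)" using l g0 by simp
  ultimately have centre: "g ^ 4 / (16 * l) \<le> \<mu>" using k(2) unfolding ng by linarith
  have "large_n n \<Phi> \<mu> r l g"
  proof unfold_locales
    show "1 \<le> r" by (rule r)
    show "l = ln (real n)" by (simp add: l_def)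
    show "10000 * real r ^ 4 \<le> l" using lg by (simp add: l_def)
    show "0 < g" by (rule g0)
    show "real n = g ^ 4" by (rule ng)
    show "l ^ 10 \<le> g" by (rule lg_g) simp
    show "g ^ 4 / (16 * l) \<le> \<mu>" by (rule centre)
  qed
  then show ?thesis unfolding l_def by blast
qed

lemma eventually_large_n:
  assumes "r \<ge> 1"
  shows "\<forall>\<^sub>F n in sequentially. \<exists>\<Phi> \<mu> g. large_n n \<Phi> \<mu> r (ln (real n)) g"
proof -
  have "filterlim (\<lambda>n. ln (real n)) at_top sequentially" by real_asymp
  then have "\<forall>\<^sub>F n in sequentially. 10000 * real r ^ 4 \<le> ln (real n)"
    by (simp add: filterlim_at_top)
  moreover have "\<forall>\<^sub>F n in sequentially. ln (real n) ^ 10 \<le> sqrt (sqrt (real n))" by real_asymp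
  moreover have "\<forall>\<^sub>F n in sequentially. (n::nat) \<ge> 1" by (rule eventually_ge_at_top)
  ultimately show ?thesis
    by eventually_elim (rule large_n_intro[OF assms])
qed

text \<open>The classes are the components of the weight-one graph on \<open>V\<close>, each named
  by the smallest code of its members to obtain natural numbers as labels. A spanning tree then
  needs edges of weight \<open>1 / n\<close> only between components.\<close>

lemma ex_arc_classes:
  assumes V: "finite V" "V \<noteq> {}" "V \<subseteq> arc_indices n"
  shows "\<exists>cls :: nat \<times> nat \<Rightarrow> nat.
    (\<forall>x\<in>V. \<forall>y\<in>V. fst x = fst y \<or> snd x = snd y \<longrightarrow> cls x = cls y) \<and>
    (1 / real n) ^ (card (cls ` V) - 1) \<le> max_tree_weight V (arc_weight n)"
proof -
  define R where "R = {(x, y). x \<in> V \<and> y \<in> V \<and> (fst x = fst y \<or> snd x = snd y)}"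
  define cls where "cls = (\<lambda>x. Min (prod_encode ` {u\<in>V. (x, u) \<in> R\<^sup>*}))"
  have symR: "(y, x) \<in> R\<^sup>*" if "(x, y) \<in> R\<^sup>*" for x y
  proof -
    have "sym R" by (auto simp: sym_def R_def)
    then show ?thesis using that by (meson sym_rtrancl symD)
  qed
  have cls_mem: "\<exists>u\<in>V. (x, u) \<in> R\<^sup>* \<and> cls x = prod_encode u" if "x \<in> V" for x
  proof -
    have "x \<in> {u\<in>V. (x, u) \<in> R\<^sup>*}" using that by simp
    then have "prod_encode ` {u\<in>V. (x, u) \<in> R\<^sup>*} \<noteq> {}" by blast
    then have "cls x \<in> prod_encode ` {u\<in>V. (x, u) \<in> R\<^sup>*}"
      unfolding cls_def using V(1) by (intro Min_in) auto
    then show ?thesis by auto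
  qed
  have cls_R: "cls x = cls y" if "(x, y) \<in> R\<^sup>*" for x y
  proof -
    have "(x, u) \<in> R\<^sup>* \<longleftrightarrow> (y, u) \<in> R\<^sup>*" for u using that symR by (meson rtrancl_trans)
    then show ?thesis by (simp add: cls_def)
  qed
  have R_cls: "(x, y) \<in> R\<^sup>*" if h: "x \<in> V" "y \<in> V" "cls x = cls y" for x y
  proof -
    obtain u v where "(x, u) \<in> R\<^sup>*" "cls x = prod_encode u" "(y, v) \<in> R\<^sup>*" "cls y = prod_encode v"
      using cls_mem[OF h(1)] cls_mem[OF h(2)] by blast
    then have "(x, u) \<in> R\<^sup>*" "(y, u) \<in> R\<^sup>*" using h(3) by (auto simp: prod_encode_eq)
    then show ?thesis using symR by (meson rtrancl_trans)
  qed
  have same: "cls x = cls y" if "x \<in> V" "y \<in> V" "fst x = fst y \<or> snd x = snd y" for x y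
    using that by (intro cls_R r_into_rtrancl) (auto simp: R_def)
  have n2: "n \<ge> 2" using V(2,3) by (auto simp: arc_indices_def)
  have weight: "arc_weight n {x, y} = (if fst x = fst y \<or> snd x = snd y then 1 else 1 / real n)" for x y
  proof -
    have "(\<exists>i j i' j'. {x, y} = {(i, j), (i', j')} \<and> (i = i' \<or> j = j')) \<longleftrightarrow> fst x = fst y \<or> snd x = snd y"
      by (cases x; cases y) (auto simp: doubleton_eq_iff)
    then show ?thesis by (simp only: arc_weight_def)
  qed
  have "\<exists>T. finite T \<and> (\<forall>e\<in>T. e \<subseteq> V \<and> card e = 2 \<and> arc_weight n e > 0) \<and> is_tree V T
    \<and> (1 / real n) ^ (card (cls ` V) - 1) \<le> (\<Prod>e\<in>T. arc_weight n e)"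
  proof (rule spanning_tree_with_classes[OF V(1,2)])
    fix A x y
    assume A: "A \<subseteq> V" "\<forall>x\<in>A. \<forall>y\<in>V - A. arc_weight n {x, y} < 1" "x \<in> A" "y \<in> V - A"
    show "cls x \<noteq> cls y"
    proof
      assume "cls x = cls y"
      then have "(x, y) \<in> R\<^sup>*" using A by (intro R_cls) auto
      then have "y \<in> A"
      proof (induction rule: rtrancl_induct)
        case (step u v)
        show ?case
        proof (rule ccontr)
          assume "v \<notin> A"
          then have "v \<in> V - A" using step.hyps(2) by (auto simp: R_def)
          then have "arc_weight n {u, v} < 1" using A(2) step.IH by blast
          then show False using step.hyps(2) by (auto simp: weight R_def)
        qed
      qed (rule A(3))
      then show False using A(4) by simp
    qed
  next
    fix x y assume "x \<in> V" "y \<in> V" "1 \<le> arc_weight n {x, y}"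
    then show "cls x = cls y" using n2 by (intro same) (auto simp: weight split: if_splits)
  qed (use n2 in \<open>auto simp: weight\<close>)
  then obtain T where T: "\<forall>e\<in>T. e \<subseteq> V \<and> card e = 2 \<and> arc_weight n e > 0" "is_tree V T"
    "(1 / real n) ^ (card (cls ` V) - 1) \<le> (\<Prod>e\<in>T. arc_weight n e)" by blast
  have "(\<Prod>e\<in>T. arc_weight n e) \<le> max_tree_weight V (arc_weight n)"
    by (rule max_tree_weight_ge[OF V(1) T(1,2)])
  then have "(1 / real n) ^ (card (cls ` V) - 1) \<le> max_tree_weight V (arc_weight n)" using T(3) by linarith
  then show ?thesis using same by blast
qed

text \<open>Joint moments of indicators are probabilities, hence at most 1.\<close>

lemma joint_cumulant_arcs_crude:
  assumes n: "n \<ge> 1" and a: "a ` {1..r} \<subseteq> arc_indices n"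
  shows "\<bar>joint_cumulant (measure_pmf (random_set_partition n)) r (\<lambda>i. arc_var (a i))\<bar> \<le> moebius_mass {1..r}"
proof -
  have "\<bar>joint_cumulant (measure_pmf (random_set_partition n)) r (\<lambda>i. arc_var (a i))\<bar>
      = norm (cumulant (\<lambda>S. urn_mean n (\<lambda>m. arcs_prob n (a ` S) (of_nat m))) {1..r})"
    unfolding joint_cumulant_eq_cumulant[OF n a, symmetric] by simp
  also have "\<dots> \<le> moebius_mass {1..r}"
  proof (rule norm_cumulant_le_mass)
    fix S assume "S \<subseteq> {1..r}"
    then have S: "a ` S \<subseteq> arc_indices n" using a by blast
    define N where "N = card {P. partition_on {1..n} P \<and> (\<forall>(i, j)\<in>a ` S. has_arc P i j)}"
    have "urn_mean n (\<lambda>m. arcs_prob n (a ` S) (of_nat m)) = of_real (real N / real (bell n))"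
      unfolding urn_mean_def N_def by (rule sums_unique[symmetric, OF arcs_prob_sums[OF S n]])
    moreover have "N \<le> bell n"
      unfolding N_def bell_def by (intro card_mono finitely_many_partition_on) auto
    ultimately show "norm (urn_mean n (\<lambda>m. arcs_prob n (a ` S) (of_nat m))) \<le> 1"
      using bell_pos[of n] by (simp only: norm_of_real) simp
  qed simp
  finally show ?thesis .
qed

text \<open>For fixed positive \<open>r\<close> the first case holds for all large \<open>n\<close>
  and decides the growth. In the finitely many other cases a power of \<open>n\<close> outweighs all
  factors \<open>1 / n\<close> on the right-hand side. Both exponents reflect that at most
  \<open>2 * r\<close> factors \<epsilon> or \<open>1 / n\<close> occur, with \<open>lg ^ 7\<close>
  in each \<epsilon>.\<close>

definition dependency_const :: "nat \<Rightarrow> nat \<Rightarrow> real" where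
  "dependency_const r n =
     (if \<exists>\<Phi> \<mu> g. large_n n \<Phi> \<mu> r (ln (real n)) g then (1 + \<bar>arc_const r\<bar>) * ln (real n) ^ (14 * r)
      else (1 + moebius_mass {1..r}) * real n ^ (2 * r))"

lemma large_n_ln_ge_1:
  assumes "large_n n \<Phi> \<mu> r (ln (real n)) g"
  shows "1 \<le> ln (real n)"
proof -
  interpret large_n n \<Phi> \<mu> r "ln (real n)" g by (rule assms)
  show ?thesis using lg_ge(1) by simp
qed

lemma dependency_const_pos:
  assumes "n \<ge> 1"
  shows "0 < dependency_const r n"
proof (cases "\<exists>\<Phi> \<mu> g. large_n n \<Phi> \<mu> r (ln (real n)) g")
  case True
  then have "1 \<le> ln (real n)" using large_n_ln_ge_1 by blast
  then show ?thesis using True by (simp add: dependency_const_def add_pos_nonneg)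
next
  case False
  then show ?thesis using assms moebius_mass_nonneg[of "{1..r}"]
    by (simp only: dependency_const_def if_False) (simp add: add_pos_nonneg)
qed

lemma dependency_const_soft_bigo:
  assumes "r \<ge> 1"
  shows "(\<lambda>n. dependency_const r n) \<in> soft_bigo (\<lambda>_. 1)"
proof -
  have "(\<lambda>n. dependency_const r n) \<in> O(\<lambda>n. 1 * ln (real n) powr real (14 * r))"
  proof (rule bigoI)
    show "\<forall>\<^sub>F n in sequentially. norm (dependency_const r n)
        \<le> (1 + \<bar>arc_const r\<bar>) * norm (1 * ln (real n) powr real (14 * r))"
      using eventually_large_n[OF assms]
    proof eventually_elim
      case (elim n)
      then have "1 \<le> ln (real n)" using large_n_ln_ge_1 by blast
      then have "ln (real n) powr real (14 * r) = ln (real n) ^ (14 * r)" by (intro powr_realpow) simp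
      then show ?case using elim \<open>1 \<le> ln (real n)\<close> by (simp add: dependency_const_def abs_mult)
    qed
  qed
  then show ?thesis unfolding soft_bigo_def by (intro CollectI exI[of _ "real (14 * r)"]) simp
qed

lemma joint_cumulant_arcs_le:
  assumes n: "n \<ge> 1" and r: "r \<ge> 1" and a: "a ` {1..r} \<subseteq> arc_indices n"
  shows "\<bar>joint_cumulant (measure_pmf (random_set_partition n)) r (\<lambda>i. arc_var (a i))\<bar>
    \<le> dependency_const r n * (1 / real n ^ card (a ` {1..r})) * max_tree_weight (a ` {1..r}) (arc_weight n)"
proof -
  define J where "J = \<bar>joint_cumulant (measure_pmf (random_set_partition n)) r (\<lambda>i. arc_var (a i))\<bar>"
  obtain cls where cls: "\<forall>x\<in>a ` {1..r}. \<forall>y\<in>a ` {1..r}. fst x = fst y \<or> snd x = snd y \<longrightarrow> (cls x :: nat) = cls y"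
    and M: "(1 / real n) ^ (card (cls ` a ` {1..r}) - 1) \<le> max_tree_weight (a ` {1..r}) (arc_weight n)"
  proof -
    have "finite (a ` {1..r})" "a ` {1..r} \<noteq> {}" using r by simp_all
    from ex_arc_classes[OF this a] that show ?thesis by blast
  qed
  define D where "D = card (a ` {1..r})"
  define c where "c = card (cls ` a ` {1..r})"
  have c1: "1 \<le> c" using r by (simp add: c_def card_gt_0_iff Suc_le_eq)
  have Dc: "D \<le> r" "c \<le> r"
    using card_image_le[of "{1..r}" a] card_image_le[of "{1..r}" "cls \<circ> a"]
    by (auto simp: D_def c_def image_comp)
  have "J \<le> dependency_const r n * (1 / real n) ^ (D + c - 1)"
  proof (cases "\<exists>\<Phi> \<mu> g. large_n n \<Phi> \<mu> r (ln (real n)) g")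
    case True
    then obtain \<Phi> \<mu> g where L: "large_n n \<Phi> \<mu> r (ln (real n)) g" by blast
    then have l1: "1 \<le> ln (real n)" by (rule large_n_ln_ge_1)
    interpret large_n n \<Phi> \<mu> r "ln (real n)" g by (rule L)
    have "J \<le> arc_const r * \<epsilon> ^ (card (a ` {1..r}) + card ((cls \<circ> a) ` {1..r}) - 1)"
      unfolding J_def
    proof (rule cumulant_arcs_bound[OF a])
      fix i i' assume ii: "i \<in> {1..r}" "i' \<in> {1..r}" "fst (a i) = fst (a i') \<or> snd (a i) = snd (a i')"
      then have "a i \<in> a ` {1..r}" "a i' \<in> a ` {1..r}" by (simp_all only: imageI)
      then have "cls (a i) = cls (a i')" using cls ii(3) by blast
      then show "(cls \<circ> a) i = (cls \<circ> a) i'" by (simp only: o_apply)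
    qed
    also have "\<dots> = arc_const r * \<epsilon> ^ (D + c - 1)" by (simp only: D_def c_def image_comp)
    also have "\<dots> \<le> (1 + \<bar>arc_const r\<bar>) * \<epsilon> ^ (D + c - 1)"
      using \<epsilon>_bounds by (intro mult_right_mono) auto
    also have "\<epsilon> ^ (D + c - 1) = ln (real n) ^ (7 * (D + c - 1)) * (1 / real n) ^ (D + c - 1)"
      by (simp add: \<epsilon>_def g(2)[symmetric] power_divide flip: power_mult)
    also have "(1 + \<bar>arc_const r\<bar>) * \<dots> \<le> (1 + \<bar>arc_const r\<bar>) * (ln (real n) ^ (14 * r) * (1 / real n) ^ (D + c - 1))"
      using l1 Dc by (intro mult_left_mono mult_right_mono power_increasing) auto
    also have "\<dots> = dependency_const r n * (1 / real n) ^ (D + c - 1)"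
      using True by (simp add: dependency_const_def)
    finally show ?thesis .
  next
    case False
    have "J \<le> moebius_mass {1..r}" unfolding J_def by (rule joint_cumulant_arcs_crude[OF n a])
    also have "\<dots> \<le> (1 + moebius_mass {1..r}) * (real n ^ (2 * r) * (1 / real n) ^ (D + c - 1))"
    proof -
      have "real n ^ (D + c - 1) \<le> real n ^ (2 * r)" using n Dc by (intro power_increasing) auto
      then have "1 \<le> real n ^ (2 * r) * (1 / real n) ^ (D + c - 1)"
        using n by (simp add: power_divide field_simps)
      then have "(1 + moebius_mass {1..r}) * 1 \<le> (1 + moebius_mass {1..r}) * (real n ^ (2 * r) * (1 / real n) ^ (D + c - 1))"
        using moebius_mass_nonneg[of "{1..r}"] by (intro mult_left_mono) auto
      then show ?thesis by simp
    qed
    also have "\<dots> = dependency_const r n * (1 / real n) ^ (D + c - 1)"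
      unfolding dependency_const_def using False by (simp only: if_False mult.assoc)
    finally show ?thesis .
  qed
  \<comment> \<open>\<open>D\<close> factors make up \<open>arc_Psi\<close>, and the other
    \<open>c - 1\<close> are bounded by the tree weight. That \<open>c\<close> is at least 1 matters
    for the truncated subtraction.\<close>
  also have "(1 / real n) ^ (D + c - 1) = (1 / real n ^ D) * (1 / real n) ^ (c - 1)"
  proof -
    have "D + c - 1 = D + (c - 1)" using c1 by simp
    then show ?thesis by (simp only: power_add power_one_over)
  qed
  also have "dependency_const r n * \<dots> \<le> dependency_const r n * ((1 / real n ^ D) * max_tree_weight (a ` {1..r}) (arc_weight n))"
    using M dependency_const_pos[OF n, of r] by (intro mult_left_mono) (auto simp: c_def less_imp_le)
  finally show ?thesis by (simp add: J_def D_def mult.assoc)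
qed

theorem theorem4p2:
  shows "\<exists>C :: nat \<Rightarrow> nat \<Rightarrow> real.
    (\<forall>r\<ge>1. \<forall>n\<ge>1. C r n > 0) \<and>
    (\<forall>r\<ge>1. (\<lambda>n. C r n) \<in> soft_bigo (\<lambda>_. 1)) \<and>
    (\<forall>n\<ge>1. weighted_dependency_graph
        (measure_pmf (random_set_partition n)) (arc_indices n) arc_var
        (arc_weight n) (arc_Psi n) (\<lambda>r. C r n))"
proof (intro exI[of _ dependency_const] conjI allI impI)
  fix r n :: nat assume "r \<ge> 1" "n \<ge> 1"
  then show "0 < dependency_const r n" by (intro dependency_const_pos)
next
  fix r :: nat assume "r \<ge> 1"
  then show "(\<lambda>n. dependency_const r n) \<in> soft_bigo (\<lambda>_. 1)" by (rule dependency_const_soft_bigo)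
next
  fix n :: nat assume n: "n \<ge> 1"
  let ?M = "measure_pmf (random_set_partition n)"
  show "weighted_dependency_graph ?M (arc_indices n) arc_var (arc_weight n) (arc_Psi n) (\<lambda>r. dependency_const r n)"
    unfolding weighted_dependency_graph_def
  proof (intro conjI ballI allI impI)
    show "prob_space ?M" by (rule prob_space_measure_pmf)
    fix \<alpha> assume "\<alpha> \<in> arc_indices n"
    show "arc_var \<alpha> \<in> borel_measurable ?M" by simp
    show "integrable ?M (\<lambda>\<omega>. \<bar>arc_var \<alpha> \<omega>\<bar> ^ k)" for k
      by (rule measure_pmf.integrable_const_bound[where B = 1])
        (auto simp: arc_var_def power_le_one split: prod.split)
  next
    show "weighted_graph (arc_indices n) (arc_weight n)"
      using n by (auto simp: weighted_graph_def arc_weight_def)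
  next
    fix r :: nat and a :: "nat \<Rightarrow> nat \<times> nat"
    assume "1 \<le> r" "a ` {1..r} \<subseteq> arc_indices n"
    from joint_cumulant_arcs_le[OF n this]
    show "\<bar>joint_cumulant ?M r (\<lambda>i. arc_var (a i))\<bar>
        \<le> dependency_const r n * arc_Psi n (image_mset a (mset_set {1..r})) * max_tree_weight (a ` {1..r}) (arc_weight n)"
      by (simp add: arc_Psi_def)
  qed
qed

end
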